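(* Let $\mathbb{k}$ be an algebraically closed field of characteristic $p>3$, let $\ell\geq 1$ be an integer, and let $\chi\in W_\ell^*$ be a linear form of height $r(\chi)=1$ with $\chi(e_0t^{\ell})\neq 0$. Then the set $\{\mathcal{Z}_\chi(\lambda):\lambda\in\Lambda(\chi)\}$ exhausts all non-isomorphic simple $U_\chi(W_\ell)$-modules; that is, each $\mathcal{Z}_\chi(\lambda)$ with $\lambda\in\Lambda(\chi)$ is simple, every simple $U_\chi(W_\ell)$-module is isomorphic to some $\mathcal{Z}_\chi(\lambda)$ with $\lambda\in\Lambda(\chi)$, and for $\lambda,\mu\in\Lambda(\chi)$ one has $\mathcal{Z}_\chi(\lambda)\cong\mathcal{Z}_\chi(\mu)$ if and only if $\lambda=\mu$.
   Context: The Witt algebra $W$ is the Lie algebra of derivations of $\mathbb{k}[X]/(X^p)$, with basis $e_i=x^{i+1}\partial$, $-1\le i\le p-2$, and bracket $[e_i,e_j]=(j-i)e_{i+j}$, where $e_{i+j}:=0$ if $i+j\notin\{-1,\dots,p-2\}$. For an integer $\ell\ge 0$, the truncated current Lie algebra is $W_\ell:=W\otimes\mathbb{k}[t]/(t^{\ell+1})$, with basis $e_it^j:=e_i\otimes t^j$ ($-1\le i\le p-2$, $0\le j\le\ell$) and bracket $[e_it^k,e_jt^l]=(j-i)e_{i+j}t^{k+l}$. It is a restricted Lie algebra with $p$-map determined by $(e_it^k)^{[p]}=\delta_{i,0}\,e_it^{kp}$ (with $t^m=0$ for $m>\ell$). Set $W_{\ell,[i]}:=\mathbb{k}e_i\otimes\mathbb{k}[t]/(t^{\ell+1})$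 and $W_{\ell,(i)}:=\sum_{j\ge i}W_{\ell,[j]}$ for $i\geq -1$. For $\chi\in W_\ell^*$, the height $r(\chi)$ is the smallest integer $i\ge -1$ with $\chi(W_{\ell,(i)})=(0)$. For a restricted Lie algebra $L$ and $\chi\in L^*$, the reduced enveloping algebra is $U_\chi(L):=U(L)/(x^p-x^{[p]}-\chi(x)^p\cdot 1:\ x\in L)$; for a restricted subalgebra $L'\subseteq L$, $U_\chi(L')$ is formed with $\chi|_{L'}$. Suppose $r(\chi)\le 1$. Put $\Lambda(\chi):=\{\lambda\in\mathbb{k}:\lambda^p-\lambda=\chi(e_0)^p\}$. For $\lambda\in\Lambda(\chi)$, let $\mathbb{k}_\lambda=\mathbb{k}v_\lambda$ be the one-dimensional $U_\chi(W_{\ell,(0)})$-module with $e_0.v_\lambda=\lambda v_\lambda$, $W_{\ell,(1)}.v_\lambda=0$, and $e_0t^i.v_\lambda=\chi_iv_\lambda$ for $1\le i\le\ell$, where the scalars $\chi_i$ are uniquely determined by $\chi$ through $\chi_i^p-\chi_{ip}=\chi(e_0t^i)^p$ (with $\chi_m:=0$ for $m>\ell$). The $\chi$-reduced Verma module is $\mathcal{Z}_\chi(\lambda):=U_\chi(W_\ell)\otimes_{U_\chi(W_{\ell,(0)})}\mathbb{k}_\lambda$. *)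

theory Defs
  imports
    "HOL-Computational_Algebra.Polynomial"
    "HOL-Algebra.QuotRing"
    "HOL-Algebra.Module"
    "HOL-Algebra.Generated_Groups"
    "HOL-Algebra.Free_Abelian_Groups"
begin

section \<open>Modules over a not necessarily commutative ring\<close>

text \<open>
  The library locale \<^locale>\<open>module\<close> asks for a commutative ring.  The record type
  and the locale \<^locale>\<open>submodule\<close> do not depend on commutativity and are reused; the
  record fields \<open>mult\<close> and \<open>one\<close> of a module carry no information.
\<close>

locale left_module = R?: ring R + M?: abelian_group M for R (structure) and M (structure) +
  assumes smult_closed:
      "\<lbrakk>a \<in> carrier R; x \<in> carrier M\<rbrakk> \<Longrightarrow> a \<odot>\<^bsub>M\<^esub> x \<in> carrier M"
    and smult_l_distr:
      "\<lbrakk>a \<in> carrier R; b \<in> carrier R; x \<in> carrier M\<rbrakk> \<Longrightarrow>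
        (a \<oplus> b) \<odot>\<^bsub>M\<^esub> x = a \<odot>\<^bsub>M\<^esub> x \<oplus>\<^bsub>M\<^esub> b \<odot>\<^bsub>M\<^esub> x"
    and smult_r_distr:
      "\<lbrakk>a \<in> carrier R; x \<in> carrier M; y \<in> carrier M\<rbrakk> \<Longrightarrow>
        a \<odot>\<^bsub>M\<^esub> (x \<oplus>\<^bsub>M\<^esub> y) = a \<odot>\<^bsub>M\<^esub> x \<oplus>\<^bsub>M\<^esub> a \<odot>\<^bsub>M\<^esub> y"
    and smult_assoc:
      "\<lbrakk>a \<in> carrier R; b \<in> carrier R; x \<in> carrier M\<rbrakk> \<Longrightarrow>
        (a \<otimes> b) \<odot>\<^bsub>M\<^esub> x = a \<odot>\<^bsub>M\<^esub> (b \<odot>\<^bsub>M\<^esub> x)"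
    and smult_one: "x \<in> carrier M \<Longrightarrow> \<one> \<odot>\<^bsub>M\<^esub> x = x"

definition simple_module :: "('r, 'a) ring_scheme \<Rightarrow> ('r, 'm, 'b) module_scheme \<Rightarrow> bool" where
  "simple_module R M \<longleftrightarrow> left_module R M \<and> carrier M \<noteq> {\<zero>\<^bsub>M\<^esub>} \<and>
     (\<forall>N. submodule N R M \<longrightarrow> N = {\<zero>\<^bsub>M\<^esub>} \<or> N = carrier M)"

definition module_isos ::
  "('r, 'a) ring_scheme \<Rightarrow> ('r, 'm, 'b) module_scheme \<Rightarrow> ('r, 'n, 'c) module_scheme \<Rightarrow> ('m \<Rightarrow> 'n) set" where
  "module_isos R M N = {f. bij_betw f (carrier M) (carrier N) \<and>
     (\<forall>x\<in>carrier M. \<forall>y\<in>carrier M. f (x \<oplus>\<^bsub>M\<^esub> y) = f x \<oplus>\<^bsub>N\<^esub> f y) \<and>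
     (\<forall>a\<in>carrier R. \<forall>x\<in>carrier M. f (a \<odot>\<^bsub>M\<^esub> x) = a \<odot>\<^bsub>N\<^esub> f x)}"

definition module_iso ::
  "('r, 'a) ring_scheme \<Rightarrow> ('r, 'm, 'b) module_scheme \<Rightarrow> ('r, 'n, 'c) module_scheme \<Rightarrow> bool" where
  "module_iso R M N \<longleftrightarrow> module_isos R M N \<noteq> {}"

text \<open>
  The map induced on a quotient, whose elements are cosets, by a map that is constant on cosets.
\<close>

definition on_cosets :: "('a \<Rightarrow> 'b) \<Rightarrow> 'a set \<Rightarrow> 'b" where
  "on_cosets f X = the_elem (f ` X)"

text \<open>
  For a ring homomorphism \<open>\<phi>\<close> from \<open>S\<close> to \<open>R\<close>, the \<open>R\<close>-module \<open>R \<otimes>\<^sub>S M\<close>, where \<open>S\<close> acts on \<open>R\<close>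
  from the right through \<open>\<phi>\<close>: the free abelian group on \<open>R \<times> M\<close> modulo the subgroup
  generated by the biadditivity and balancing relations.
\<close>

definition tensor_relations ::
  "('r, 'a) ring_scheme \<Rightarrow> ('s, 'b) ring_scheme \<Rightarrow> ('s \<Rightarrow> 'r) \<Rightarrow> ('s, 'm, 'c) module_scheme
    \<Rightarrow> ('r \<times> 'm \<Rightarrow>\<^sub>0 int) set" where
  "tensor_relations R S \<phi> M =
     {frag_of (a \<oplus>\<^bsub>R\<^esub> b, m) - frag_of (a, m) - frag_of (b, m) | a b m.
        a \<in> carrier R \<and> b \<in> carrier R \<and> m \<in> carrier M} \<union>
     {frag_of (a, m \<oplus>\<^bsub>M\<^esub> n) - frag_of (a, m) - frag_of (a, n) | a m n.
        a \<in> carrier R \<and> m \<in> carrier M \<and> n \<in> carrier M} \<union>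
     {frag_of (a \<otimes>\<^bsub>R\<^esub> \<phi> s, m) - frag_of (a, s \<odot>\<^bsub>M\<^esub> m) | a s m.
        a \<in> carrier R \<and> s \<in> carrier S \<and> m \<in> carrier M}"

definition induced_module ::
  "('r, 'a) ring_scheme \<Rightarrow> ('s, 'b) ring_scheme \<Rightarrow> ('s \<Rightarrow> 'r) \<Rightarrow> ('s, 'm, 'c) module_scheme
    \<Rightarrow> ('r, ('r \<times> 'm \<Rightarrow>\<^sub>0 int) set) module" where
  "induced_module R S \<phi> M =
     (let G = free_Abelian_group (carrier R \<times> carrier M);
          K = generate G (tensor_relations R S \<phi> M);
          T = G Mod K
      in \<lparr>carrier = carrier T, monoid.mult = undefined, one = undefined,
          ring.zero = \<one>\<^bsub>T\<^esub>, add = monoid.mult T,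
          smult = (\<lambda>u. on_cosets
            (\<lambda>z. K #>\<^bsub>G\<^esub> frag_extend (\<lambda>(a, m). frag_of (u \<otimes>\<^bsub>R\<^esub> a, m)) z))\<rparr>)"


section \<open>Restricted Lie algebras\<close>

text \<open>
  A (restricted) Lie algebra over the field \<open>'k\<close> is given by a subspace of an ambient additive
  group with a scalar multiplication; the characteristic is \<open>CHAR('k)\<close>.
\<close>

record ('k, 'v) restricted_lie =
  lie_space :: "'v set"
  lie_scale :: "'k \<Rightarrow> 'v \<Rightarrow> 'v"
  lie_bracket :: "'v \<Rightarrow> 'v \<Rightarrow> 'v"
  lie_pmap :: "'v \<Rightarrow> 'v"

definition linear_form :: "'v::ab_group_add set \<Rightarrow> ('k::field \<Rightarrow> 'v \<Rightarrow> 'v) \<Rightarrow> ('v \<Rightarrow> 'k) \<Rightarrow> bool" where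
  "linear_form V sc f \<longleftrightarrow> (\<forall>x\<in>V. \<forall>y\<in>V. f (x + y) = f x + f y) \<and>
     (\<forall>c. \<forall>x\<in>V. f (sc c x) = c * f x)"

text \<open>The coefficient of \<open>T\<^sup>j\<close> in \<open>ad(xT + y)\<^sup>n(x)\<close>.\<close>

primrec ad_coeff :: "('v::ab_group_add \<Rightarrow> 'v \<Rightarrow> 'v) \<Rightarrow> 'v \<Rightarrow> 'v \<Rightarrow> nat \<Rightarrow> nat \<Rightarrow> 'v" where
  "ad_coeff br x y 0 j = (if j = 0 then x else 0)"
| "ad_coeff br x y (Suc n) j =
     (if j = 0 then 0 else br x (ad_coeff br x y n (j - 1))) + br y (ad_coeff br x y n j)"

text \<open>
  The \<open>s\<^sub>i\<close> of Jacobson's formula: \<open>i s\<^sub>i(x,y)\<close> is the coefficient of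
  \<open>T\<^bsup>i-1\<^esup>\<close> in \<open>ad(xT + y)\<^bsup>p-1\<^esup>(x)\<close>.
\<close>

definition jacobson_s ::
  "('k::field \<Rightarrow> 'v \<Rightarrow> 'v) \<Rightarrow> ('v::ab_group_add \<Rightarrow> 'v \<Rightarrow> 'v) \<Rightarrow> nat \<Rightarrow> 'v \<Rightarrow> 'v \<Rightarrow> 'v" where
  "jacobson_s sc br i x y = sc (inverse (of_nat i)) (ad_coeff br x y (CHAR('k) - 1) (i - 1))"

definition is_pmap ::
  "'v::ab_group_add set \<Rightarrow> ('k::field \<Rightarrow> 'v \<Rightarrow> 'v) \<Rightarrow> ('v \<Rightarrow> 'v \<Rightarrow> 'v) \<Rightarrow> ('v \<Rightarrow> 'v) \<Rightarrow> bool" where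
  "is_pmap V sc br P \<longleftrightarrow> (\<forall>x\<in>V. P x \<in> V) \<and>
     (\<forall>x\<in>V. \<forall>y\<in>V. br (P x) y = (br x ^^ CHAR('k)) y) \<and>
     (\<forall>c. \<forall>x\<in>V. P (sc c x) = sc (c ^ CHAR('k)) (P x)) \<and>
     (\<forall>x\<in>V. \<forall>y\<in>V. P (x + y) = P x + P y + (\<Sum>i=1..<CHAR('k). jacobson_s sc br i x y))"


section \<open>Enveloping algebras\<close>

datatype 'a free_word = Word (letters: "'a list")

instantiation free_word :: (type) monoid_add
begin

definition zero_free_word :: "'a free_word" where
  "zero_free_word = Word []"

definition plus_free_word :: "'a free_word \<Rightarrow> 'a free_word \<Rightarrow> 'a free_word" where
  "plus_free_word v w = Word (letters v @ letters w)"

instance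
  by standard (simp_all add: zero_free_word_def plus_free_word_def)

end

text \<open>
  The free associative unital algebra on a set \<open>V\<close> is the algebra of the free monoid on \<open>V\<close>; the
  product of \<open>'v free_word \<Rightarrow>\<^sub>0 'k\<close> is the convolution product.
\<close>

definition free_algebra :: "'v set \<Rightarrow> ('v free_word \<Rightarrow>\<^sub>0 'k::field) ring" where
  "free_algebra V = \<lparr>carrier = {f. \<forall>w\<in>Poly_Mapping.keys f. set (letters w) \<subseteq> V},
     monoid.mult = (*), one = 1, ring.zero = 0, add = (+)\<rparr>"

definition free_gen :: "'v \<Rightarrow> ('v free_word \<Rightarrow>\<^sub>0 'k::field)" where
  "free_gen x = Poly_Mapping.single (Word [x]) 1"

definition free_scalar :: "'k::field \<Rightarrow> ('v free_word \<Rightarrow>\<^sub>0 'k)" where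
  "free_scalar c = Poly_Mapping.single 0 c"

text \<open>
  \<open>U(L)\<close> is presented by the elements of \<open>L\<close> as generators.  The first two families of
  relations turn the free algebra on the set \<open>L\<close> into the tensor algebra of the vector space \<open>L\<close>.
\<close>

definition uea_ideal :: "('k::field, 'v::ab_group_add) restricted_lie \<Rightarrow> ('v free_word \<Rightarrow>\<^sub>0 'k) set" where
  "uea_ideal L = Idl\<^bsub>free_algebra (lie_space L)\<^esub>
     ({free_gen (x + y) - free_gen x - free_gen y | x y. x \<in> lie_space L \<and> y \<in> lie_space L} \<union>
      {free_gen (lie_scale L c x) - free_scalar c * free_gen x | c x. x \<in> lie_space L} \<union>
      {free_gen x * free_gen y - free_gen y * free_gen x - free_gen (lie_bracket L x y) | x y.
         x \<in> lie_space L \<and> y \<in> lie_space L})"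

definition uea :: "('k::field, 'v::ab_group_add) restricted_lie \<Rightarrow> ('v free_word \<Rightarrow>\<^sub>0 'k) set ring" where
  "uea L = free_algebra (lie_space L) Quot uea_ideal L"

definition uea_class ::
  "('k::field, 'v::ab_group_add) restricted_lie \<Rightarrow> ('v free_word \<Rightarrow>\<^sub>0 'k) \<Rightarrow> ('v free_word \<Rightarrow>\<^sub>0 'k) set" where
  "uea_class L z = uea_ideal L +>\<^bsub>free_algebra (lie_space L)\<^esub> z"

definition reduced_ideal ::
  "('k::field, 'v::ab_group_add) restricted_lie \<Rightarrow> ('v \<Rightarrow> 'k) \<Rightarrow> ('v free_word \<Rightarrow>\<^sub>0 'k) set set" where
  "reduced_ideal L \<chi> = Idl\<^bsub>uea L\<^esub>
     {(uea_class L (free_gen x) [^]\<^bsub>uea L\<^esub> CHAR('k)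
        \<ominus>\<^bsub>uea L\<^esub> uea_class L (free_gen (lie_pmap L x)))
        \<ominus>\<^bsub>uea L\<^esub> uea_class L (free_scalar (\<chi> x ^ CHAR('k))) | x. x \<in> lie_space L}"

definition reduced_uea ::
  "('k::field, 'v::ab_group_add) restricted_lie \<Rightarrow> ('v \<Rightarrow> 'k) \<Rightarrow> ('v free_word \<Rightarrow>\<^sub>0 'k) set set ring" where
  "reduced_uea L \<chi> = uea L Quot reduced_ideal L \<chi>"

text \<open>
  The homomorphism \<open>U\<^sub>\<chi>(L') \<rightarrow> U\<^sub>\<chi>(L)\<close> for a restricted subalgebra \<open>L'\<close> of \<open>L\<close>; it depends on
  \<open>L'\<close> only through its domain.
\<close>

definition reduced_uea_incl ::
  "('k::field, 'v::ab_group_add) restricted_lie \<Rightarrow> ('v \<Rightarrow> 'k)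
    \<Rightarrow> ('v free_word \<Rightarrow>\<^sub>0 'k) set set \<Rightarrow> ('v free_word \<Rightarrow>\<^sub>0 'k) set set" where
  "reduced_uea_incl L \<chi> =
     on_cosets (\<lambda>X. reduced_ideal L \<chi> +>\<^bsub>uea L\<^esub> on_cosets (uea_class L) X)"

text \<open>
  The one-dimensional module on which each \<open>x\<close> in \<open>L\<close> acts by the scalar \<open>\<theta> x\<close>.
\<close>

definition free_eval :: "('v \<Rightarrow> 'k) \<Rightarrow> ('v free_word \<Rightarrow>\<^sub>0 'k::field) \<Rightarrow> 'k" where
  "free_eval \<theta> f =
     (\<Sum>w\<in>Poly_Mapping.keys f. Poly_Mapping.lookup f w * prod_list (map \<theta> (letters w)))"

definition one_dim_module ::
  "('v \<Rightarrow> 'k::field) \<Rightarrow> (('v free_word \<Rightarrow>\<^sub>0 'k) set set, 'k) module" where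
  "one_dim_module \<theta> = \<lparr>carrier = UNIV, monoid.mult = undefined, one = undefined,
     ring.zero = 0, add = (+), smult = (\<lambda>u c. on_cosets (on_cosets (free_eval \<theta>)) u * c)\<rparr>"


section \<open>The truncated current algebra of the Witt algebra\<close>

text \<open>
  Here \<open>W\<^sub>n\<close> is the tensor product of \<open>W\<close> with \<open>k[t]/(t\<^bsup>n+1\<^esup>)\<close>.
  An element of \<open>W\<^sub>n\<close> is the family of its coefficients: the value at \<open>(i, j)\<close> is the
  coefficient of \<open>e\<^sub>i t\<^sup>j\<close>.
\<close>

type_synonym 'k witt = "int \<times> nat \<Rightarrow>\<^sub>0 'k"

definition witt_e :: "nat \<Rightarrow> int \<Rightarrow> nat \<Rightarrow> 'k::field witt" where
  "witt_e n i j =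
     (if -1 \<le> i \<and> i \<le> int CHAR('k) - 2 \<and> j \<le> n then Poly_Mapping.single (i, j) 1 else 0)"

text \<open>\<open>W\<^bsub>n,(i)\<^esub>\<close>, meant for \<open>i \<ge> -1\<close>.\<close>

definition witt_filt :: "nat \<Rightarrow> int \<Rightarrow> 'k::field witt set" where
  "witt_filt n i = {x. Poly_Mapping.keys x \<subseteq> {i..int CHAR('k) - 2} \<times> {..n}}"

definition witt_space :: "nat \<Rightarrow> 'k::field witt set" where
  "witt_space n = witt_filt n (-1)"

definition witt_scale :: "'k::field \<Rightarrow> 'k witt \<Rightarrow> 'k witt" where
  "witt_scale c = Poly_Mapping.map ((*) c)"

definition witt_bracket :: "nat \<Rightarrow> 'k::field witt \<Rightarrow> 'k witt \<Rightarrow> 'k witt" where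
  "witt_bracket n x y =
     (\<Sum>(i, k)\<in>Poly_Mapping.keys x. \<Sum>(j, m)\<in>Poly_Mapping.keys y.
        witt_scale (Poly_Mapping.lookup x (i, k) * Poly_Mapping.lookup y (j, m) * of_int (j - i))
          (witt_e n (i + j) (k + m)))"

text \<open>
  A \<open>p\<close>-map is determined by its values on a basis; extensionality fixes the irrelevant values
  outside \<open>W\<^sub>n\<close>.
\<close>

definition witt_pmap :: "nat \<Rightarrow> 'k::field witt \<Rightarrow> 'k witt" where
  "witt_pmap n = (THE P. P \<in> extensional (witt_space n) \<and>
     is_pmap (witt_space n) witt_scale (witt_bracket n) P \<and>
     (\<forall>i\<in>{-1..int CHAR('k) - 2}. \<forall>k\<le>n.
        P (witt_e n i k) = (if i = 0 then witt_e n i (k * CHAR('k)) else 0)))"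

text \<open>The restricted subalgebra \<open>W\<^bsub>n,(i)\<^esub>\<close>; the whole of \<open>W\<^sub>n\<close> is the case \<open>i = -1\<close>.\<close>

definition witt_lie :: "nat \<Rightarrow> int \<Rightarrow> ('k::field, 'k witt) restricted_lie" where
  "witt_lie n i = \<lparr>lie_space = witt_filt n i, lie_scale = witt_scale,
     lie_bracket = witt_bracket n, lie_pmap = witt_pmap n\<rparr>"

definition witt_height :: "nat \<Rightarrow> ('k::field witt \<Rightarrow> 'k) \<Rightarrow> int" where
  "witt_height n \<chi> = (LEAST i. -1 \<le> i \<and> (\<forall>x\<in>witt_filt n i. \<chi> x = 0))"

definition weights :: "nat \<Rightarrow> ('k::field witt \<Rightarrow> 'k) \<Rightarrow> 'k set" where
  "weights n \<chi> = {l. l ^ CHAR('k) - l = \<chi> (witt_e n 0 0) ^ CHAR('k)}"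

text \<open>
  The scalars \<open>\<chi>\<^sub>i\<close> for \<open>1 \<le> i \<le> n\<close>.  The value at \<open>0\<close> is not used and is set to \<open>0\<close>.
\<close>

definition weight_coeffs :: "nat \<Rightarrow> ('k::field witt \<Rightarrow> 'k) \<Rightarrow> nat \<Rightarrow> 'k" where
  "weight_coeffs n \<chi> = (THE c. c 0 = 0 \<and> (\<forall>m>n. c m = 0) \<and>
     (\<forall>i\<in>{1..n}. c i ^ CHAR('k) - c (i * CHAR('k)) = \<chi> (witt_e n 0 i) ^ CHAR('k)))"

definition weight_form :: "nat \<Rightarrow> ('k::field witt \<Rightarrow> 'k) \<Rightarrow> 'k \<Rightarrow> 'k witt \<Rightarrow> 'k" where
  "weight_form n \<chi> l x = Poly_Mapping.lookup x (0, 0) * l +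
     (\<Sum>i=1..n. Poly_Mapping.lookup x (0, i) * weight_coeffs n \<chi> i)"

definition reduced_verma ::
  "nat \<Rightarrow> ('k::field witt \<Rightarrow> 'k) \<Rightarrow> 'k \<Rightarrow>
    (('k witt free_word \<Rightarrow>\<^sub>0 'k) set set, (('k witt free_word \<Rightarrow>\<^sub>0 'k) set set \<times> 'k \<Rightarrow>\<^sub>0 int) set) module" where
  "reduced_verma n \<chi> l = induced_module
     (reduced_uea (witt_lie n (-1)) \<chi>) (reduced_uea (witt_lie n 0) \<chi>)
     (reduced_uea_incl (witt_lie n (-1)) \<chi>) (one_dim_module (weight_form n \<chi> l))"

end

theory Submission
  imports Defs
begin

text \<open>
  The Verma module is spanned by ordered monomials in the \<open>z\<^sub>j = e\<^bsub>-1\<^esub>t\<^sup>j - \<chi>(e\<^bsub>-1\<^esub>t\<^sup>j)\<close>, with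
  exponents below \<open>p\<close>, applied to its highest weight vector.  Their independence needs no
  Poincare-Birkhoff-Witt theorem: \<open>W\<^sub>n\<close> acts by explicit differential operators on the polynomials in
  \<open>z\<^sub>0, \<dots>, z\<^sub>n\<close> of degree below \<open>p\<close> in each variable, and the Verma module maps onto this model.
  For the \<open>p\<close>-relations in the model, Jacobson's formula reduces to basis vectors; for these the
  difference of the two sides commutes with every \<open>z\<^sub>j\<close>, so that it vanishes as soon as it kills \<open>1\<close>.

  In the model the joint kernel of the operators \<open>e\<^sub>1t\<^sup>k\<close> is the line of constants: if \<open>\<partial>\<^sub>i f = 0\<close> for
  \<open>i < r\<close>, then \<open>e\<^sub>1t\<^bsup>n-r\<^esup> f = 0\<close> becomes \<open>2\<chi>\<^sub>n \<partial>\<^sub>r f = 0\<close>, up to a nilpotent operator when \<open>r = 0\<close>, and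
  \<open>\<chi>\<^sub>n \<noteq> 0\<close> because \<open>\<chi>(e\<^sub>0t\<^sup>n) \<noteq> 0\<close>.  On the other hand an Engel-type argument finds in every
  nonzero submodule of a \<open>U\<^sub>\<chi>(W\<^sub>n)\<close>-module a nonzero weight vector, and the \<open>e\<^sub>1t\<^sup>k\<close> annihilate it.
  Hence the Verma modules are simple, the eigenvalue of \<open>e\<^sub>0\<close> separates them, and every simple module
  is a quotient of one of them.
\<close>

section \<open>Identities in noncommutative rings\<close>

text \<open>The operators come from geometry. W consists of vector fields on the truncated line, so
  W_n acts by vector fields on its jets X(T), here twisted by the derivative of the field paired
  with the scalars lambda, chi_1, ..., chi_n. For an induced module coordinates and derivatives
  change roles as in a Fourier transform: d/dX_j becomes multiplication by z_j, up to a scalar, and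
  X_j becomes -d/dz_j. In characteristic p the p-th power of X_j is then zero, hence X(T)^p = 0, and
  this makes the truncation e_i = 0 for i > p - 2 compatible with the brackets.

  Two obstacles shape the rest. The p-map is prescribed on a basis only, so its existence and
  uniqueness have to be proved; W_n has no centre, and x^[p] is therefore determined by (ad x)^p.
  The elements of the algebras are nested cosets, so computations use representatives in the free
  algebra, and each map out of a quotient needs a proof that the relations act by zero.\<close>

abbreviation (input) lookup :: "('a \<Rightarrow>\<^sub>0 'b::zero) \<Rightarrow> 'a \<Rightarrow> 'b" where
  "lookup \<equiv> Poly_Mapping.lookup"

abbreviation (input) single :: "'a \<Rightarrow> 'b::zero \<Rightarrow> 'a \<Rightarrow>\<^sub>0 'b" where
  "single \<equiv> Poly_Mapping.single"

abbreviation (input) keys :: "('a \<Rightarrow>\<^sub>0 'b::zero) \<Rightarrow> 'a set" where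
  "keys \<equiv> Poly_Mapping.keys"

definition commutator :: "'a::ring_1 \<Rightarrow> 'a \<Rightarrow> 'a" where
  "commutator x y = x * y - y * x"

lemma commutator_sum_right: "commutator x (\<Sum>i\<in>A. f i) = (\<Sum>i\<in>A. commutator x (f i))"
  by (simp add: commutator_def sum_distrib_left sum_distrib_right sum_subtractf)

lemma commutator_sum_left: "commutator (\<Sum>i\<in>A. f i) x = (\<Sum>i\<in>A. commutator (f i) x)"
  by (simp add: commutator_def sum_distrib_left sum_distrib_right sum_subtractf)

text \<open>Left and right multiplication by w commute and \<open>commutator w\<close> is their
  difference, so this is the binomial theorem. The sign is (-1)^(n+m) because n - m in the exponent
  would bring in truncated subtraction.\<close>

lemma ad_power_expansion:
  fixes w x :: "'a::ring_1"
  shows "(commutator w ^^ n) x =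
    (\<Sum>m\<le>n. of_int ((-1) ^ (n + m) * int (n choose m)) * (w ^ m * x * w ^ (n - m)))"
proof (induction n)
  case (Suc n)
  define c where "c n m = (-1) ^ (n + m) * int (n choose m)" for n m :: nat
  define T where "T m = w ^ m * x * w ^ (Suc n - m)" for m
  have rec: "c (Suc n) (Suc m) = c n m - c n (Suc m)" for m
    by (simp add: c_def algebra_simps)
  have c0: "c (Suc n) 0 = - c n 0"
    by (simp add: c_def)
  have top: "c n (Suc n) = 0"
    by (simp add: c_def)
  have "(commutator w ^^ Suc n) x = commutator w (\<Sum>m\<le>n. of_int (c n m) * (w ^ m * x * w ^ (n - m)))"
    using Suc by (simp add: c_def)
  also have "\<dots> = (\<Sum>m\<le>n. of_int (c n m) * T (Suc m)) - (\<Sum>m\<le>n. of_int (c n m) * T m)"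
  proof -
    have "w * (\<Sum>m\<le>n. of_int (c n m) * (w ^ m * x * w ^ (n - m))) = (\<Sum>m\<le>n. of_int (c n m) * T (Suc m))"
      unfolding sum_distrib_left T_def
    proof (intro sum.cong refl)
      fix m
      have "w * (of_int (c n m) * (w ^ m * x * w ^ (n - m))) = (w * of_int (c n m)) * (w ^ m * x * w ^ (n - m))"
        by (simp add: mult.assoc)
      also have "w * of_int (c n m) = of_int (c n m) * w"
        by (simp add: mult_of_int_commute)
      finally show "w * (of_int (c n m) * (w ^ m * x * w ^ (n - m))) = of_int (c n m) * (w ^ Suc m * x * w ^ (Suc n - Suc m))"
        by (simp add: mult.assoc)
    qed
    moreover have "(\<Sum>m\<le>n. of_int (c n m) * (w ^ m * x * w ^ (n - m))) * w = (\<Sum>m\<le>n. of_int (c n m) * T m)"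
      unfolding sum_distrib_right T_def
    proof (intro sum.cong refl)
      fix m assume "m \<in> {..n}"
      then have "w ^ (Suc n - m) = w ^ (n - m) * w"
        by (metis Suc_diff_le atMost_iff power_Suc2)
      then show "of_int (c n m) * (w ^ m * x * w ^ (n - m)) * w = of_int (c n m) * (w ^ m * x * w ^ (Suc n - m))"
        by (simp add: mult.assoc)
    qed
    ultimately show ?thesis
      by (simp add: commutator_def)
  qed
  also have "(\<Sum>m\<le>n. of_int (c n m) * T m) = (\<Sum>m\<le>Suc n. of_int (c n m) * T m)"
    by (simp add: top)
  also have "\<dots> = of_int (c n 0) * T 0 + (\<Sum>m\<le>n. of_int (c n (Suc m)) * T (Suc m))"
    by (rule sum.atMost_Suc_shift)
  also have "(\<Sum>m\<le>n. of_int (c n m) * T (Suc m)) - \<dots> =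
      of_int (c (Suc n) 0) * T 0 + (\<Sum>m\<le>n. of_int (c (Suc n) (Suc m)) * T (Suc m))"
    unfolding rec c0 by (simp add: algebra_simps sum_subtractf)
  also have "\<dots> = (\<Sum>m\<le>Suc n. of_int (c (Suc n) m) * T m)"
    by (rule sum.atMost_Suc_shift[symmetric])
  finally show ?case
    by (simp add: c_def T_def)
qed simp

text \<open>By Pascal's rule and p | (p choose m+1), neighbouring coefficients of row p - 1 are
  opposite modulo p, so each is (-1)^m. The prime 2 is treated apart since p - 1 is then odd, but 1
  = -1 modulo 2.\<close>

lemma choose_pred_prime_mod:
  assumes "prime p" "m < p"
  shows "int p dvd (-1) ^ ((p - 1) + m) * int ((p - 1) choose m) - 1"
  using assms(2)
proof (induction m)
  case 0
  show ?case
  proof (cases "p = 2")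
    case False
    then have "odd p"
      using assms(1) primes_dvd_imp_eq two_is_prime_nat by blast
    then show ?thesis by simp
  qed simp
next
  case (Suc m)
  have "p dvd (p choose Suc m)"
    using assms(1) Suc.prems by (intro dvd_choose_prime) auto
  moreover have "(p choose Suc m) = ((p - 1) choose m) + ((p - 1) choose Suc m)"
    using prime_gt_0_nat[OF assms(1)] by (subst choose_reduce_nat) auto
  ultimately have d: "int p dvd int ((p - 1) choose m) + int ((p - 1) choose Suc m)"
    by (metis int_dvd_int_iff of_nat_add)
  have "(-1) ^ ((p - 1) + Suc m) * int ((p - 1) choose Suc m) - 1 =
        (((-1) ^ ((p - 1) + m) * int ((p - 1) choose m)) - 1) -
        (-1) ^ ((p - 1) + m) * (int ((p - 1) choose m) + int ((p - 1) choose Suc m))"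
    by (simp add: algebra_simps)
  then show ?case
    using d Suc by (metis Suc_lessD dvd_diff dvd_mult)
qed

lemma of_nat_zero_imp_of_int_eq:
  assumes "of_nat p = (0::'a::ring_1)" "int p dvd a - b"
  shows "of_int a = (of_int b :: 'a)"
proof -
  obtain k where "a - b = int p * k"
    using assms(2) by auto
  then have "of_int (a - b) = (of_nat p * of_int k :: 'a)"
    by (metis of_int_mult of_int_of_nat_eq)
  then show ?thesis
    using assms(1) by simp
qed

text \<open>In characteristic p, (a - b)^(p-1) is the sum of all a^m b^(p-1-m). The right side is
  what differentiating w^p in the direction x produces, and this is how the Lie bracket enters
  Jacobson's formula.\<close>

lemma ad_pred_prime:
  fixes w x :: "'a::ring_1"
  assumes "prime p" "of_nat p = (0::'a)"
  shows "(commutator w ^^ (p - 1)) x = (\<Sum>m<p. w ^ m * x * w ^ (p - 1 - m))"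
proof -
  have "{..p - 1} = {..<p}"
    using prime_gt_0_nat[OF assms(1)] by auto
  moreover have "of_int ((-1) ^ ((p - 1) + m) * int ((p - 1) choose m)) = (1::'a)" if "m < p" for m
    using of_nat_zero_imp_of_int_eq[OF assms(2) choose_pred_prime_mod[OF assms(1) that]] by simp
  ultimately show ?thesis
    unfolding ad_power_expansion by (intro sum.cong) auto
qed

text \<open>One more commutator makes the preceding sum telescope. This is the axiom ad(w^[p]) = (ad
  w)^p for the p-th power in an associative ring.\<close>

lemma ad_prime_power:
  fixes w x :: "'a::ring_1"
  assumes "prime p" "of_nat p = (0::'a)"
  shows "(commutator w ^^ p) x = commutator (w ^ p) x"
proof -
  define T where "T m = w ^ m * x * w ^ (p - m)" for m
  have p: "p > 0"
    using assms(1) by (rule prime_gt_0_nat)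
  have "(commutator w ^^ p) x = commutator w ((commutator w ^^ (p - 1)) x)"
    using p by (metis One_nat_def Suc_pred comp_apply funpow.simps(2))
  also have "\<dots> = (\<Sum>m<p. T (Suc m) - T m)"
    unfolding ad_pred_prime[OF assms] commutator_sum_right
  proof (intro sum.cong refl)
    fix m assume "m \<in> {..<p}"
    then have "w ^ (p - m) = w ^ (p - 1 - m) * w"
      by (metis Suc_diff_Suc diff_Suc_eq_diff_pred lessThan_iff power_Suc2)
    then show "commutator w (w ^ m * x * w ^ (p - 1 - m)) = T (Suc m) - T m"
      by (simp add: commutator_def T_def mult.assoc)
  qed
  also have "\<dots> = T p - T 0"
    by (rule sum_lessThan_telescope)
  finally show ?thesis
    by (simp add: T_def commutator_def)
qed

lemma poly_mapping_keys_induct [consumes 1, case_names zero single add]: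
  fixes f :: "'a \<Rightarrow>\<^sub>0 'b::comm_monoid_add"
  assumes "keys f \<subseteq> S"
    and "P 0" "\<And>k a. k \<in> S \<Longrightarrow> P (single k a)" "\<And>f g. P f \<Longrightarrow> P g \<Longrightarrow> P (f + g)"
  shows "P f"
proof -
  have "P (\<Sum>k\<in>A. single k (lookup f k))" if "finite A" "A \<subseteq> S" for A
    using that assms(2-4) by (induction A) auto
  moreover have "(\<Sum>k\<in>keys f. single k (lookup f k)) = f"
    by (rule poly_mapping_eqI)
      (auto simp: lookup_sum lookup_single when_def in_keys_iff sum.delta)
  ultimately show ?thesis
    using assms(1) by (metis finite_keys)
qed

lemmas poly_mapping_sum_induct =
  poly_mapping_keys_induct[OF subset_UNIV, case_names zero single add]

text \<open>
  In the next lemmas \<open>'a\<close>-valued polynomials in a central variable \<open>T\<close> are elements of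
  \<open>nat \<Rightarrow>\<^sub>0 'a\<close>, because the type \<open>'a poly\<close> requires commutative coefficients.
\<close>

lemma lookup_single_mult:
  "lookup (single k a * f) j = (if k \<le> j then a * lookup f (j - k) else 0)"
  for f :: "nat \<Rightarrow>\<^sub>0 'a::ring_1"
proof (induction f rule: poly_mapping_sum_induct)
  case (single i b)
  then show ?case
    by (auto simp: mult_single lookup_single when_def)
next
  case (add f g)
  then show ?case
    by (simp add: algebra_simps lookup_add)
qed simp

lemma lookup_mult_single:
  "lookup (f * single k a) j = (if k \<le> j then lookup f (j - k) * a else 0)"
  for f :: "nat \<Rightarrow>\<^sub>0 'a::ring_1"
proof (induction f rule: poly_mapping_sum_induct)
  case (single i b)
  then show ?case
    by (auto simp: mult_single lookup_single when_def)
next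
  case (add f g)
  then show ?case
    by (simp add: algebra_simps lookup_add)
qed simp

section \<open>Jacobson's formula from the polynomial (xT + y)^p\<close>

definition lin_pencil :: "'a::ring_1 \<Rightarrow> 'a \<Rightarrow> nat \<Rightarrow>\<^sub>0 'a" where
  "lin_pencil x y = single 1 x + single 0 y"

lemma lookup_lin_pencil_mult:
  "lookup (lin_pencil x y * f) j = (if j = 0 then 0 else x * lookup f (j - 1)) + y * lookup f j"
  by (simp add: lin_pencil_def distrib_right lookup_add lookup_single_mult Suc_le_eq)

lemma lookup_mult_lin_pencil:
  "lookup (f * lin_pencil x y) j = (if j = 0 then 0 else lookup f (j - 1) * x) + lookup f j * y"
  by (simp add: lin_pencil_def distrib_left lookup_add lookup_mult_single Suc_le_eq)

text \<open>Identifies the recursion \<open>ad_coeff\<close>, through which p-maps are defined, with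
  iterated commutators of polynomials in T, to which the identities above apply.\<close>

lemma lookup_ad_lin_pencil:
  "lookup ((commutator (lin_pencil x y) ^^ m) (single 0 x)) j = ad_coeff commutator x y m j"
  by (induction m arbitrary: j)
    (auto simp: lookup_single when_def commutator_def lookup_minus lookup_lin_pencil_mult lookup_mult_lin_pencil)

text \<open>The noncommutative product rule for the derivative of (xT + y)^n in T. For n = p the sum
  on the right is the one of \<open>ad_pred_prime\<close>.\<close>

lemma lookup_lin_pencil_power_derivative:
  "of_nat (Suc j) * lookup (lin_pencil x y ^ n) (Suc j) =
    lookup (\<Sum>m<n. lin_pencil x y ^ m * single 0 x * lin_pencil x y ^ (n - 1 - m)) j"
proof (induction n arbitrary: j)
  case 0
  show ?case by (simp add: lookup_one when_def)
next
  case (Suc n)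
  let ?w = "lin_pencil x y"
  define S where "S n = (\<Sum>m<n. ?w ^ m * single 0 x * ?w ^ (n - 1 - m))" for n
  have S: "S (Suc n) = single 0 x * ?w ^ n + ?w * S n"
    unfolding S_def by (simp add: sum.lessThan_Suc_shift sum_distrib_left mult.assoc del: sum.lessThan_Suc)
  have IH: "of_nat (Suc j) * lookup (?w ^ n) (Suc j) = lookup (S n) j" for j
    unfolding S_def by (rule Suc)
  have comm: "of_nat k * (z * u) = z * (of_nat k * u)" for k and z u :: 'a
    by (metis mult.assoc mult_of_nat_commute)
  have "of_nat (Suc j) * lookup (?w ^ Suc n) (Suc j) =
      of_nat (Suc j) * (x * lookup (?w ^ n) j) + y * lookup (S n) j"
    by (simp add: lookup_lin_pencil_mult distrib_left comm flip: IH del: of_nat_Suc)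
  also have "of_nat (Suc j) * (x * lookup (?w ^ n) j) =
      x * lookup (?w ^ n) j + (if j = 0 then 0 else x * lookup (S n) (j - 1))"
  proof (cases j)
    case (Suc i)
    have "of_nat (Suc j) * (x * lookup (?w ^ n) j) = x * lookup (?w ^ n) j + of_nat (Suc i) * (x * lookup (?w ^ n) (Suc i))"
      unfolding Suc by (subst of_nat_Suc) (simp add: distrib_right del: of_nat_Suc)
    then show ?thesis
      unfolding comm IH using Suc by simp
  qed simp
  finally show ?case
    unfolding S_def[symmetric] S
    by (simp add: lookup_add lookup_lin_pencil_mult lookup_single_mult add.assoc)
qed

lemma lookup_lin_pencil_power_gt: "n < j \<Longrightarrow> lookup (lin_pencil x y ^ n) j = 0"
  by (induction n arbitrary: j) (auto simp: lookup_one lookup_lin_pencil_mult)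

lemma lookup_lin_pencil_power_top: "lookup (lin_pencil x y ^ n) n = x ^ n"
  by (induction n) (auto simp: lookup_one lookup_lin_pencil_mult lookup_lin_pencil_power_gt)

lemma lookup_lin_pencil_power_0: "lookup (lin_pencil x y ^ n) 0 = y ^ n"
  by (induction n) (auto simp: lookup_one lookup_lin_pencil_mult)

lemma sum_lookup_lin_pencil_power: "(\<Sum>j\<le>n. lookup (lin_pencil x y ^ n) j) = (x + y) ^ n"
proof (induction n)
  case (Suc n)
  have "(\<Sum>j\<le>Suc n. lookup (lin_pencil x y ^ Suc n) j) =
      (\<Sum>j\<le>Suc n. if j = 0 then 0 else x * lookup (lin_pencil x y ^ n) (j - 1)) +
      (\<Sum>j\<le>Suc n. y * lookup (lin_pencil x y ^ n) j)"
    by (simp add: lookup_lin_pencil_mult sum.distrib)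
  also have "(\<Sum>j\<le>Suc n. if j = 0 then 0 else x * lookup (lin_pencil x y ^ n) (j - 1)) =
      x * (\<Sum>j\<le>n. lookup (lin_pencil x y ^ n) j)"
    by (subst sum.atMost_Suc_shift) (simp add: sum_distrib_left)
  also have "(\<Sum>j\<le>Suc n. y * lookup (lin_pencil x y ^ n) j) = y * (\<Sum>j\<le>n. lookup (lin_pencil x y ^ n) j)"
    by (simp add: sum_distrib_left lookup_lin_pencil_power_gt)
  finally show ?case
    by (simp add: Suc distrib_right)
qed (simp add: lookup_one)

text \<open>Set T = 1 in (xT + y)^p. The outer coefficients are x^p and y^p; the i-th one in between
  is obtained from the derivative on division by i, which is invertible for 0 < i < p. The map s
  carries the scalar 1/i into the ring, which has no scalar multiplication of its own.\<close>

theorem jacobson_formula: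
  fixes x y :: "'a::ring_1" and s :: "'k::field \<Rightarrow> 'a"
  assumes "prime p" "of_nat p = (0::'a)" "CHAR('k) = p"
    and s: "s 1 = 1" "\<And>a b. s (a + b) = s a + s b" "\<And>a b. s (a * b) = s a * s b"
  shows "(x + y) ^ p = x ^ p + y ^ p +
    (\<Sum>i=1..<p. s (inverse (of_nat i)) * ad_coeff commutator x y (p - 1) (i - 1))"
proof -
  let ?w = "lin_pencil x y"
  have p: "p > 1"
    using assms(1) prime_gt_1_nat by blast
  have s0: "s 0 = 0"
    using s(2)[of 0 0] by simp
  have s_nat: "s (of_nat i) = of_nat i" for i
    by (induction i) (simp_all add: s s0)
  have q: "of_nat p = (0 :: nat \<Rightarrow>\<^sub>0 'a)"
    using assms(2) by (metis single_of_nat single_zero)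
  have coeff: "lookup (?w ^ p) i = s (inverse (of_nat i)) * ad_coeff commutator x y (p - 1) (i - 1)"
    if "i \<in> {1..<p}" for i
  proof -
    have "of_nat i * lookup (?w ^ p) i = ad_coeff commutator x y (p - 1) (i - 1)"
      using that lookup_lin_pencil_power_derivative[of "i - 1" x y p]
      unfolding ad_pred_prime[OF assms(1) q, symmetric] lookup_ad_lin_pencil by simp
    moreover have "s (inverse (of_nat i)) * of_nat i = 1"
    proof -
      have "of_nat i \<noteq> (0::'k)"
        using that assms(3) by (auto simp: of_nat_eq_0_iff_char_dvd dest: dvd_imp_le)
      then show ?thesis
        by (metis left_inverse s(1) s(3) s_nat)
    qed
    ultimately show ?thesis
      by (metis mult.assoc mult_1)
  qed
  have "(x + y) ^ p = (\<Sum>i\<le>p. lookup (?w ^ p) i)"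
    by (rule sum_lookup_lin_pencil_power[symmetric])
  also have "{..p} = insert 0 (insert p {1..<p})"
    using p by auto
  also have "(\<Sum>i\<in>insert 0 (insert p {1..<p}). lookup (?w ^ p) i) =
      x ^ p + y ^ p + (\<Sum>i=1..<p. lookup (?w ^ p) i)"
    using p by (simp add: lookup_lin_pencil_power_top lookup_lin_pencil_power_0)
  finally show ?thesis
    using coeff by simp
qed

section \<open>Linear endomorphisms of a free vector space\<close>

definition pm_scale :: "'k::field \<Rightarrow> ('b \<Rightarrow>\<^sub>0 'k) \<Rightarrow> ('b \<Rightarrow>\<^sub>0 'k)" where
  "pm_scale c = Poly_Mapping.map ((*) c)"

lemma lookup_pm_scale [simp]: "lookup (pm_scale c f) b = c * lookup f b"
  by (simp add: pm_scale_def Poly_Mapping.map.rep_eq when_def)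

lemma pm_scale_simps [simp]:
  "pm_scale c 0 = 0" "pm_scale 0 f = 0" "pm_scale 1 f = f"
  "pm_scale c (single b a) = single b (c * a)"
  by (auto intro!: poly_mapping_eqI simp: lookup_single when_def)

lemma pm_scale_scale: "pm_scale c (pm_scale d f) = pm_scale (c * d) f"
  by (auto intro!: poly_mapping_eqI simp: lookup_single when_def)

lemma pm_scale_distribs:
  "pm_scale c (f + g) = pm_scale c f + pm_scale c g"
  "pm_scale c (f - g) = pm_scale c f - pm_scale c g"
  "pm_scale c (- f) = - pm_scale c f"
  "pm_scale (c + d) f = pm_scale c f + pm_scale d f"
  "pm_scale (c - d) f = pm_scale c f - pm_scale d f"
  "pm_scale (- c) f = - pm_scale c f"
  by (auto intro!: poly_mapping_eqI simp: lookup_add lookup_minus algebra_simps)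

lemma pm_scale_sum: "pm_scale c (\<Sum>i\<in>A. f i) = (\<Sum>i\<in>A. pm_scale c (f i))"
  by (induction A rule: infinite_finite_induct) (auto simp: pm_scale_distribs)

lemma keys_pm_scale: "keys (pm_scale c f) \<subseteq> keys f"
  by (auto simp: in_keys_iff)

lemma poly_mapping_expansion:
  "f = (\<Sum>b\<in>keys f. pm_scale (lookup f b) (single b 1))"
  by (rule poly_mapping_eqI) (auto simp: lookup_sum lookup_single when_def in_keys_iff sum.delta)

definition linear_extension :: "('b \<Rightarrow> ('c \<Rightarrow>\<^sub>0 'k::field)) \<Rightarrow> ('b \<Rightarrow>\<^sub>0 'k) \<Rightarrow> ('c \<Rightarrow>\<^sub>0 'k)" where
  "linear_extension \<phi> f = (\<Sum>b\<in>keys f. pm_scale (lookup f b) (\<phi> b))"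

lemma linear_extension_superset:
  assumes "finite S" "keys f \<subseteq> S"
  shows "linear_extension \<phi> f = (\<Sum>b\<in>S. pm_scale (lookup f b) (\<phi> b))"
  unfolding linear_extension_def using assms
  by (intro sum.mono_neutral_left) (auto simp: in_keys_iff)

lemma linear_extension_add:
  "linear_extension \<phi> (f + g) = linear_extension \<phi> f + linear_extension \<phi> g"
proof -
  let ?S = "keys f \<union> keys g"
  have "finite ?S" "keys (f + g) \<subseteq> ?S"
    using Poly_Mapping.keys_add[of f g] by auto
  then show ?thesis
    by (simp add: linear_extension_superset[of ?S] lookup_add pm_scale_distribs sum.distrib)
qed

lemma linear_extension_scale:
  "linear_extension \<phi> (pm_scale c f) = pm_scale c (linear_extension \<phi> f)"
  by (subst linear_extension_superset[OF finite_keys keys_pm_scale])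
    (simp add: linear_extension_def pm_scale_sum pm_scale_scale)

lemma linear_extension_single [simp]:
  "linear_extension \<phi> (single b a) = pm_scale a (\<phi> b)"
  by (simp add: linear_extension_def)

text \<open>A type of its own, so that endomorphisms form an instance of \<open>ring_1\<close> and
  the commutator identities apply to operators as ring elements.\<close>

typedef (overloaded) ('b, 'k::field) endo =
  "{\<phi> :: ('b \<Rightarrow>\<^sub>0 'k) \<Rightarrow> ('b \<Rightarrow>\<^sub>0 'k).
     (\<forall>f g. \<phi> (f + g) = \<phi> f + \<phi> g) \<and> (\<forall>c f. \<phi> (pm_scale c f) = pm_scale c (\<phi> f))}"
  morphisms app Endo
  by (rule exI[of _ id]) simp

setup_lifting type_definition_endo

instantiation endo :: (type, field) ring_1
begin

lift_definition zero_endo :: "('a, 'b) endo" is "\<lambda>_. 0"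
  by simp

lift_definition one_endo :: "('a, 'b) endo" is "\<lambda>f. f"
  by simp

lift_definition plus_endo :: "('a, 'b) endo \<Rightarrow> ('a, 'b) endo \<Rightarrow> ('a, 'b) endo" is "\<lambda>\<phi> \<psi> f. \<phi> f + \<psi> f"
  by (auto simp: pm_scale_distribs algebra_simps)

lift_definition minus_endo :: "('a, 'b) endo \<Rightarrow> ('a, 'b) endo \<Rightarrow> ('a, 'b) endo" is "\<lambda>\<phi> \<psi> f. \<phi> f - \<psi> f"
  by (auto simp: pm_scale_distribs algebra_simps)

lift_definition uminus_endo :: "('a, 'b) endo \<Rightarrow> ('a, 'b) endo" is "\<lambda>\<phi> f. - \<phi> f"
  by (auto simp: pm_scale_distribs algebra_simps)

lift_definition times_endo :: "('a, 'b) endo \<Rightarrow> ('a, 'b) endo \<Rightarrow> ('a, 'b) endo" is "\<lambda>\<phi> \<psi> f. \<phi> (\<psi> f)"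
  by auto

instance
proof
  have "single undefined 1 \<noteq> (0 :: 'a \<Rightarrow>\<^sub>0 'b)"
    by (metis lookup_single_eq lookup_zero zero_neq_one)
  then show "(0 :: ('a, 'b) endo) \<noteq> 1"
    by transfer (auto dest: fun_cong[where x = "single undefined 1"])
  fix a b c :: "('a, 'b) endo"
  show "a * b * c = a * (b * c)" "1 * a = a" "a * 1 = a" "a + b + c = a + (b + c)" "0 + a = a"
    "- a + a = 0" "a - b = a + - b" "(a + b) * c = a * c + b * c"
    by (transfer, simp add: add.assoc)+
  show "a + b = b + a"
    by transfer (simp add: add.commute)
  show "a * (b + c) = a * b + a * c"
    by transfer simp
qed

end

lemma app_simps [simp]:
  "app 0 f = 0" "app 1 f = f" "app (\<phi> + \<psi>) f = app \<phi> f + app \<psi> f" "app (\<phi> - \<psi>) f = app \<phi> f - app \<psi> f"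
  "app (- \<phi>) f = - app \<phi> f" "app (\<phi> * \<psi>) f = app \<phi> (app \<psi> f)"
  by (simp_all add: zero_endo.rep_eq one_endo.rep_eq plus_endo.rep_eq minus_endo.rep_eq
      uminus_endo.rep_eq times_endo.rep_eq)

lemma app_add: "app \<phi> (f + g) = app \<phi> f + app \<phi> g"
  using app[of \<phi>] by simp

lemma app_scale: "app \<phi> (pm_scale c f) = pm_scale c (app \<phi> f)"
  using app[of \<phi>] by simp

lemma app_zero [simp]: "app \<phi> 0 = 0"
  using app_scale[of \<phi> 0 0] by simp

lemma app_diff: "app \<phi> (f - g) = app \<phi> f - app \<phi> g"
  by (metis add_diff_cancel app_add diff_add_cancel)

lemma app_sum: "app \<phi> (\<Sum>i\<in>A. f i) = (\<Sum>i\<in>A. app \<phi> (f i))"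
  by (induction A rule: infinite_finite_induct) (auto simp: app_add)

lemma app_sum_left: "app (\<Sum>i\<in>A. \<phi> i) f = (\<Sum>i\<in>A. app (\<phi> i) f)"
  by (induction A rule: infinite_finite_induct) auto

lemma app_power: "app (\<phi> ^ m) f = (app \<phi> ^^ m) f"
  by (induction m) auto

lemma endo_eqI:
  assumes "\<And>b. app \<phi> (single b 1) = app \<psi> (single b 1)"
  shows "\<phi> = \<psi>"
proof -
  have "app \<phi> f = app \<psi> f" for f
    by (subst (1 2) poly_mapping_expansion[of f]) (simp only: app_sum app_scale assms)
  then show ?thesis
    by (metis app_inject ext)
qed

lift_definition basis_endo :: "('b \<Rightarrow> ('b \<Rightarrow>\<^sub>0 'k::field)) \<Rightarrow> ('b, 'k) endo" is linear_extension
  by (simp add: linear_extension_add linear_extension_scale)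

lemma app_basis_endo_single [simp]: "app (basis_endo \<phi>) (single b a) = pm_scale a (\<phi> b)"
  by transfer simp

lift_definition scalar_endo :: "'k::field \<Rightarrow> ('b, 'k) endo" is pm_scale
  by (simp add: pm_scale_distribs pm_scale_scale mult.commute)

lemma app_scalar_endo [simp]: "app (scalar_endo c) f = pm_scale c f"
  by transfer simp

lemma app_eqI: "(\<And>f. app \<phi> f = app \<psi> f) \<Longrightarrow> \<phi> = \<psi>"
  by (metis app_inject ext)

lemma of_nat_endo: "of_nat m = (scalar_endo (of_nat m) :: ('b, 'k::field) endo)"
  by (induction m) (auto intro!: app_eqI simp: pm_scale_distribs)

lemma of_nat_CHAR_endo: "of_nat CHAR('k) = (0 :: ('b, 'k::field) endo)"
  by (auto intro!: app_eqI simp: of_nat_endo)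

section \<open>Evaluation of the free algebra in a ring with central scalars\<close>

locale scalar_hom =
  fixes s :: "'k::field \<Rightarrow> 'a::ring_1"
  assumes s_add: "s (c + d) = s c + s d"
    and s_mult: "s (c * d) = s c * s d"
    and s_one: "s 1 = 1"
    and s_central: "s c * a = a * s c"
begin

lemma s_zero: "s 0 = 0"
  using s_add[of 0 0] by simp

text \<open>The homomorphism given by the universal property of the free algebra. The target is the
  field for one-dimensional modules and an operator ring for the model.\<close>

definition alg_eval :: "('v \<Rightarrow> 'a) \<Rightarrow> ('v free_word \<Rightarrow>\<^sub>0 'k) \<Rightarrow> 'a" where
  "alg_eval r f =
    (\<Sum>w\<in>keys f. s (lookup f w) * prod_list (map r (letters w)))"

lemma alg_eval_superset:
  assumes "finite S" "keys f \<subseteq> S"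
  shows "alg_eval r f = (\<Sum>w\<in>S. s (lookup f w) * prod_list (map r (letters w)))"
  unfolding alg_eval_def using assms
  by (intro sum.mono_neutral_left) (auto simp: in_keys_iff s_zero)

lemma alg_eval_add: "alg_eval r (f + g) = alg_eval r f + alg_eval r g"
proof -
  let ?S = "keys f \<union> keys g"
  have "finite ?S" "keys (f + g) \<subseteq> ?S"
    using Poly_Mapping.keys_add[of f g] by auto
  then show ?thesis
    by (simp add: alg_eval_superset[of ?S] lookup_add s_add sum.distrib algebra_simps)
qed

lemma alg_eval_zero [simp]: "alg_eval r 0 = 0"
  by (simp add: alg_eval_def)

lemma alg_eval_diff: "alg_eval r (f - g) = alg_eval r f - alg_eval r g"
  by (metis add_diff_cancel alg_eval_add diff_add_cancel)

lemma alg_eval_single: "alg_eval r (single w a) = s a * prod_list (map r (letters w))"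
  by (simp add: alg_eval_def s_zero)

lemma alg_eval_mult: "alg_eval r (f * g) = alg_eval r f * alg_eval r g"
proof (induction f rule: poly_mapping_sum_induct)
  case (single v a)
  show ?case
  proof (induction g rule: poly_mapping_sum_induct)
    case (single w b)
    have "s a * s b * (prod_list (map r (letters v)) * prod_list (map r (letters w))) =
      s a * prod_list (map r (letters v)) * (s b * prod_list (map r (letters w)))"
      by (metis mult.assoc s_central)
    then show ?case
      by (simp add: mult_single alg_eval_single plus_free_word_def s_mult)
  next
    case (add g h)
    then show ?case
      by (simp add: distrib_left alg_eval_add)
  qed simp
next
  case (add f h)
  then show ?case
    by (simp add: distrib_right alg_eval_add)
qed simp

lemma alg_eval_one [simp]: "alg_eval r 1 = 1"
  using alg_eval_single[of r 0 1] unfolding single_one by (simp add: s_one zero_free_word_def)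

lemma alg_eval_power: "alg_eval r (f ^ m) = alg_eval r f ^ m"
  by (induction m) (auto simp: alg_eval_mult)

lemma alg_eval_gen [simp]: "alg_eval r (free_gen x) = r x"
  by (simp add: free_gen_def alg_eval_single s_one)

lemma alg_eval_scalar [simp]: "alg_eval r (free_scalar c) = s c"
  by (simp add: free_scalar_def alg_eval_single zero_free_word_def)

end

interpretation id_scalar: scalar_hom "\<lambda>c :: 'k::field. c"
  by standard (simp_all add: mult.commute)

interpretation endo_scalar: scalar_hom "scalar_endo :: 'k::field \<Rightarrow> ('b, 'k) endo"
  by standard (auto intro!: app_eqI simp: pm_scale_distribs pm_scale_scale app_scale mult.commute)

lemma free_eval_eq_alg_eval: "free_eval \<theta> = id_scalar.alg_eval \<theta>"
  by (simp add: fun_eq_iff free_eval_def id_scalar.alg_eval_def)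

section \<open>Reduced enveloping algebras\<close>

lemma carrier_free_algebra: "f \<in> carrier (free_algebra V) \<longleftrightarrow> (\<forall>w\<in>keys f. set (letters w) \<subseteq> V)"
  by (simp add: free_algebra_def)

lemma free_algebra_simps [simp]:
  "f \<otimes>\<^bsub>free_algebra V\<^esub> g = f * g" "f \<oplus>\<^bsub>free_algebra V\<^esub> g = f + g"
  "\<one>\<^bsub>free_algebra V\<^esub> = 1" "\<zero>\<^bsub>free_algebra V\<^esub> = 0"
  by (simp_all add: free_algebra_def)

lemma free_algebra_closed [simp, intro]:
  assumes "f \<in> carrier (free_algebra V)" "g \<in> carrier (free_algebra V)"
  shows "f + g \<in> carrier (free_algebra V)" "f - g \<in> carrier (free_algebra V)"
    "- f \<in> carrier (free_algebra V)" "f * g \<in> carrier (free_algebra V)"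
proof -
  show "f * g \<in> carrier (free_algebra V)"
    unfolding carrier_free_algebra
  proof
    fix w assume "w \<in> keys (f * g)"
    then obtain u v where "w = u + v" "u \<in> keys f" "v \<in> keys g"
      using keys_mult by blast
    then show "set (letters w) \<subseteq> V"
      using assms by (auto simp: carrier_free_algebra plus_free_word_def)
  qed
  show "f + g \<in> carrier (free_algebra V)"
    using assms Poly_Mapping.keys_add[of f g] by (auto simp: carrier_free_algebra subset_iff)
  show "f - g \<in> carrier (free_algebra V)"
    using assms keys_diff[of f g] by (auto simp: carrier_free_algebra subset_iff)
  show "- f \<in> carrier (free_algebra V)"
    using assms by (auto simp: carrier_free_algebra in_keys_iff)
qed

lemma free_algebra_closed_basic [simp, intro]:
  "0 \<in> carrier (free_algebra V)" "1 \<in> carrier (free_algebra V)"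
  "free_scalar c \<in> carrier (free_algebra V)"
  "x \<in> V \<Longrightarrow> free_gen x \<in> carrier (free_algebra V)"
  by (auto simp: carrier_free_algebra free_scalar_def free_gen_def zero_free_word_def in_keys_iff
      lookup_single lookup_one when_def split: if_splits)

lemma free_algebra_closed_power [simp, intro]:
  "f \<in> carrier (free_algebra V) \<Longrightarrow> f ^ m \<in> carrier (free_algebra V)"
  by (induction m) auto

lemma free_algebra_closed_sum:
  "(\<And>i. i \<in> A \<Longrightarrow> f i \<in> carrier (free_algebra V)) \<Longrightarrow> (\<Sum>i\<in>A. f i) \<in> carrier (free_algebra V)"
  by (induction A rule: infinite_finite_induct) auto

lemma free_algebra_mono: "V \<subseteq> W \<Longrightarrow> f \<in> carrier (free_algebra V) \<Longrightarrow> f \<in> carrier (free_algebra W)"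
  by (auto simp: carrier_free_algebra)

lemma ring_free_algebra: "ring (free_algebra V :: ('v free_word \<Rightarrow>\<^sub>0 'k::field) ring)"
proof (rule ringI)
  show "abelian_group (free_algebra V :: ('v free_word \<Rightarrow>\<^sub>0 'k::field) ring)"
  proof (rule abelian_groupI)
    fix f :: "'v free_word \<Rightarrow>\<^sub>0 'k"
    assume "f \<in> carrier (free_algebra V)"
    then show "\<exists>g\<in>carrier (free_algebra V). g \<oplus>\<^bsub>free_algebra V\<^esub> f = \<zero>\<^bsub>free_algebra V\<^esub>"
      by (intro bexI[of _ "- f"]) auto
  qed (auto simp: algebra_simps)
  show "monoid (free_algebra V :: ('v free_word \<Rightarrow>\<^sub>0 'k::field) ring)"
    by (rule monoidI) (auto simp: mult.assoc)
qed (auto simp: algebra_simps)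

lemma a_inv_free_algebra:
  fixes f :: "'v free_word \<Rightarrow>\<^sub>0 'k::field"
  assumes "f \<in> carrier (free_algebra V)"
  shows "\<ominus>\<^bsub>free_algebra V\<^esub> f = - f"
proof -
  interpret F: ring "free_algebra V :: ('v free_word \<Rightarrow>\<^sub>0 'k) ring"
    by (rule ring_free_algebra)
  show ?thesis
    using assms F.minus_equality[of "- f" f] by simp
qed

lemma a_minus_free_algebra:
  fixes f :: "'v free_word \<Rightarrow>\<^sub>0 'k::field"
  assumes "f \<in> carrier (free_algebra V)" "g \<in> carrier (free_algebra V)"
  shows "f \<ominus>\<^bsub>free_algebra V\<^esub> g = f - g"
  using assms by (simp add: a_minus_def a_inv_free_algebra)

lemma pow_free_algebra [simp]: "f [^]\<^bsub>free_algebra V\<^esub> (m::nat) = f ^ m"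
  by (induction m) (auto simp: nat_pow_def power_commutes)

text \<open>Generators are multiplied on the left only, which matches left modules: the action of
  \<open>free_gen x * g\<close> is that of g followed by that of x.\<close>

lemma free_algebra_induct [consumes 1, case_names scalar gen_mult add]:
  assumes f: "f \<in> carrier (free_algebra V)"
    and scalar: "\<And>c. P (free_scalar c)"
    and gen_mult: "\<And>x g. x \<in> V \<Longrightarrow> g \<in> carrier (free_algebra V) \<Longrightarrow> P g \<Longrightarrow> P (free_gen x * g)"
    and add: "\<And>g h. g \<in> carrier (free_algebra V) \<Longrightarrow> h \<in> carrier (free_algebra V) \<Longrightarrow> P g \<Longrightarrow> P h \<Longrightarrow> P (g + h)"
  shows "P f"
proof -
  have word: "P (single (Word xs) c) \<and> single (Word xs) c \<in> carrier (free_algebra V)"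
    if "set xs \<subseteq> V" for xs c
    using that
  proof (induction xs)
    case Nil
    then show ?case
      using scalar[of c] free_algebra_closed_basic(3)[of c V] by (simp add: free_scalar_def zero_free_word_def)
  next
    case (Cons x xs)
    have "single (Word (x # xs)) c = free_gen x * single (Word xs) c"
      by (simp add: free_gen_def mult_single plus_free_word_def)
    then show ?case
      using Cons gen_mult by auto
  qed
  have "keys f \<subseteq> {w. set (letters w) \<subseteq> V}"
    using f by (auto simp: carrier_free_algebra)
  then have "P f \<and> f \<in> carrier (free_algebra V)"
  proof (induction f rule: poly_mapping_keys_induct)
    case zero
    then show ?case
      using scalar[of 0] by (simp add: free_scalar_def)
  next
    case (single w c)
    then show ?case
      using word[of "letters w"] by simp
  qed (auto intro: add)
  then show ?thesis ..
qed

section \<open>Reduced enveloping algebras through representatives in the free algebra\<close>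

lemma the_elem_image_const: "X \<noteq> {} \<Longrightarrow> (\<And>x. x \<in> X \<Longrightarrow> f x = c) \<Longrightarrow> on_cosets f X = c"
  unfolding on_cosets_def by (metis image_constant_conv image_cong the_elem_eq)

text \<open>Bundles the two successive quotients, so that U_chi(L) can be handled as an algebra
  given by generators and relations in a single step.\<close>

definition uq ::
  "('k::field, 'v::ab_group_add) restricted_lie \<Rightarrow> ('v \<Rightarrow> 'k) \<Rightarrow> ('v free_word \<Rightarrow>\<^sub>0 'k)
    \<Rightarrow> ('v free_word \<Rightarrow>\<^sub>0 'k) set set" where
  "uq L \<chi> f = reduced_ideal L \<chi> +>\<^bsub>uea L\<^esub> uea_class L f"

text \<open>Closure puts the Lie relations and the p-relations inside the free algebra on L, so that
  the two quotients are taken by genuine ideals.\<close>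

locale closed_lie =
  fixes L :: "('k::field, 'v::ab_group_add) restricted_lie" and \<chi> :: "'v \<Rightarrow> 'k"
  assumes add_closed: "x \<in> lie_space L \<Longrightarrow> y \<in> lie_space L \<Longrightarrow> x + y \<in> lie_space L"
    and scale_closed: "x \<in> lie_space L \<Longrightarrow> lie_scale L c x \<in> lie_space L"
    and bracket_closed: "x \<in> lie_space L \<Longrightarrow> y \<in> lie_space L \<Longrightarrow> lie_bracket L x y \<in> lie_space L"
    and pmap_closed: "x \<in> lie_space L \<Longrightarrow> lie_pmap L x \<in> lie_space L"
begin

abbreviation F :: "('v free_word \<Rightarrow>\<^sub>0 'k) ring" where
  "F \<equiv> free_algebra (lie_space L)"

abbreviation U :: "('v free_word \<Rightarrow>\<^sub>0 'k) set set ring" where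
  "U \<equiv> reduced_uea L \<chi>"

definition lie_relations :: "('v free_word \<Rightarrow>\<^sub>0 'k) set" where
  "lie_relations =
     {free_gen (x + y) - free_gen x - free_gen y | x y. x \<in> lie_space L \<and> y \<in> lie_space L} \<union>
     {free_gen (lie_scale L c x) - free_scalar c * free_gen x | c x. x \<in> lie_space L} \<union>
     {free_gen x * free_gen y - free_gen y * free_gen x - free_gen (lie_bracket L x y) | x y.
        x \<in> lie_space L \<and> y \<in> lie_space L}"

definition p_relation :: "'v \<Rightarrow> 'v free_word \<Rightarrow>\<^sub>0 'k" where
  "p_relation x = free_gen x ^ CHAR('k) - free_gen (lie_pmap L x) - free_scalar (\<chi> x ^ CHAR('k))"

lemma lie_relations_closed: "lie_relations \<subseteq> carrier F"
  unfolding lie_relations_def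
  by (auto intro!: free_algebra_closed free_algebra_closed_basic add_closed scale_closed bracket_closed)

lemma p_relation_closed: "x \<in> lie_space L \<Longrightarrow> p_relation x \<in> carrier F"
  unfolding p_relation_def by (auto intro!: free_algebra_closed free_algebra_closed_basic pmap_closed)

sublocale F: ring F
  by (rule ring_free_algebra)

lemma uea_ideal_eq: "uea_ideal L = Idl\<^bsub>F\<^esub> lie_relations"
  by (simp add: uea_ideal_def lie_relations_def)

sublocale I: ideal "uea_ideal L" F
  unfolding uea_ideal_eq by (rule F.genideal_ideal[OF lie_relations_closed])

sublocale E: ring "uea L"
  unfolding uea_def by (rule I.quotient_is_ring)

lemma uea_class_hom: "uea_class L \<in> ring_hom F (uea L)"
  using I.rcos_ring_hom unfolding uea_def uea_class_def[abs_def] by simp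

lemma uea_class_surj: "carrier (uea L) = uea_class L ` carrier F"
  by (auto simp: uea_def FactRing_def A_RCOSETS_def' uea_class_def a_r_coset_def)

lemma uea_class_eq_iff:
  assumes "f \<in> carrier F" "g \<in> carrier F"
  shows "uea_class L f = uea_class L g \<longleftrightarrow> f - g \<in> uea_ideal L"
  using F.quotient_eq_iff_same_a_r_cos[OF I.is_ideal assms(1,2)] assms
  by (simp add: uea_class_def a_minus_free_algebra)

interpretation c: ring_hom_ring F "uea L" "uea_class L"
  by (rule ring_hom_ringI2[OF F.ring_axioms E.ring_axioms uea_class_hom])

lemma uea_class_diff:
  "f \<in> carrier F \<Longrightarrow> g \<in> carrier F \<Longrightarrow> uea_class L f \<ominus>\<^bsub>uea L\<^esub> uea_class L g = uea_class L (f - g)"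
  by (metis F.minus_closed a_minus_def a_minus_free_algebra c.hom_add c.hom_a_inv F.a_inv_closed)

definition p_relations :: "('v free_word \<Rightarrow>\<^sub>0 'k) set set" where
  "p_relations = (\<lambda>x. uea_class L (p_relation x)) ` lie_space L"

lemma p_relations_closed: "p_relations \<subseteq> carrier (uea L)"
  unfolding p_relations_def uea_class_surj using p_relation_closed by auto

lemma reduced_ideal_eq: "reduced_ideal L \<chi> = Idl\<^bsub>uea L\<^esub> p_relations"
proof -
  have "(uea_class L (free_gen x) [^]\<^bsub>uea L\<^esub> CHAR('k)
        \<ominus>\<^bsub>uea L\<^esub> uea_class L (free_gen (lie_pmap L x)))
        \<ominus>\<^bsub>uea L\<^esub> uea_class L (free_scalar (\<chi> x ^ CHAR('k))) = uea_class L (p_relation x)"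
    if "x \<in> lie_space L" for x
    using that pmap_closed
    by (simp add: uea_class_diff p_relation_def free_algebra_closed free_algebra_closed_basic
        flip: c.hom_nat_pow)
  then have "{(uea_class L (free_gen x) [^]\<^bsub>uea L\<^esub> CHAR('k)
        \<ominus>\<^bsub>uea L\<^esub> uea_class L (free_gen (lie_pmap L x)))
        \<ominus>\<^bsub>uea L\<^esub> uea_class L (free_scalar (\<chi> x ^ CHAR('k))) | x. x \<in> lie_space L} = p_relations"
    unfolding p_relations_def image_def by (metis (mono_tags, lifting))
  then show ?thesis
    by (simp add: reduced_ideal_def)
qed

sublocale J: ideal "reduced_ideal L \<chi>" "uea L"
  unfolding reduced_ideal_eq by (rule E.genideal_ideal[OF p_relations_closed])

sublocale U: ring U
  unfolding reduced_uea_def by (rule J.quotient_is_ring)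

lemma uq_hom: "uq L \<chi> \<in> ring_hom F U"
proof -
  have "uq L \<chi> = (+>\<^bsub>uea L\<^esub>) (reduced_ideal L \<chi>) \<circ> uea_class L"
    by (simp add: fun_eq_iff uq_def)
  then show ?thesis
    using ring_hom_trans[OF uea_class_hom J.rcos_ring_hom] by (simp add: reduced_uea_def)
qed

lemma uq_surj: "carrier U = uq L \<chi> ` carrier F"
proof -
  have "carrier U = (\<lambda>X. reduced_ideal L \<chi> +>\<^bsub>uea L\<^esub> X) ` carrier (uea L)"
    by (auto simp: reduced_uea_def FactRing_def A_RCOSETS_def' a_r_coset_def)
  then show ?thesis
    by (simp add: uea_class_surj image_image uq_def)
qed

sublocale uq: ring_hom_ring F U "uq L \<chi>"
  by (rule ring_hom_ringI2[OF F.ring_axioms U.ring_axioms uq_hom])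

lemma uq_closed [simp]: "f \<in> carrier F \<Longrightarrow> uq L \<chi> f \<in> carrier U"
  by (rule uq.hom_closed)

lemma uq_eqI_lie:
  assumes "f \<in> carrier F" "g \<in> carrier F" "f - g \<in> lie_relations"
  shows "uq L \<chi> f = uq L \<chi> g"
proof -
  have "f - g \<in> uea_ideal L"
    unfolding uea_ideal_eq using assms(3) F.genideal_self[OF lie_relations_closed] by blast
  then show ?thesis
    using assms uea_class_eq_iff[of f g] by (simp add: uq_def)
qed

lemma uq_add:
  assumes "x \<in> lie_space L" "y \<in> lie_space L"
  shows "uq L \<chi> (free_gen (x + y)) = uq L \<chi> (free_gen x + free_gen y)"
proof (rule uq_eqI_lie)
  have "free_gen (x + y) - free_gen x - free_gen y \<in> lie_relations"
    unfolding lie_relations_def using assms by blast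
  then show "free_gen (x + y) - (free_gen x + free_gen y) \<in> lie_relations"
    by (simp add: diff_diff_eq)
qed (simp_all add: assms add_closed free_algebra_closed)

lemma uq_scale:
  assumes "x \<in> lie_space L"
  shows "uq L \<chi> (free_gen (lie_scale L c x)) = uq L \<chi> (free_scalar c * free_gen x)"
proof (rule uq_eqI_lie)
  show "free_gen (lie_scale L c x) - free_scalar c * free_gen x \<in> lie_relations"
    unfolding lie_relations_def using assms by blast
qed (simp_all add: assms scale_closed free_algebra_closed)

lemma uq_bracket:
  assumes "x \<in> lie_space L" "y \<in> lie_space L"
  shows "uq L \<chi> (free_gen x * free_gen y) =
    uq L \<chi> (free_gen y * free_gen x + free_gen (lie_bracket L x y))"
proof (rule uq_eqI_lie)
  have "free_gen x * free_gen y - free_gen y * free_gen x - free_gen (lie_bracket L x y) \<in> lie_relations"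
    unfolding lie_relations_def using assms by blast
  then show "free_gen x * free_gen y - (free_gen y * free_gen x + free_gen (lie_bracket L x y)) \<in> lie_relations"
    by (simp add: diff_diff_eq)
qed (simp_all add: assms bracket_closed free_algebra_closed)

lemma uq_pmap:
  assumes "x \<in> lie_space L"
  shows "uq L \<chi> (free_gen x ^ CHAR('k)) = uq L \<chi> (free_gen (lie_pmap L x) + free_scalar (\<chi> x ^ CHAR('k)))"
proof -
  have "uea_class L (p_relation x) \<in> reduced_ideal L \<chi>"
    unfolding reduced_ideal_eq p_relations_def
    using assms E.genideal_self[OF p_relations_closed] by (auto simp: p_relations_def)
  then have "uq L \<chi> (p_relation x) = \<zero>\<^bsub>U\<^esub>"
    using assms by (simp add: uq_def reduced_uea_def FactRing_def J.a_rcos_const)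
  moreover have "free_gen x ^ CHAR('k) = p_relation x + (free_gen (lie_pmap L x) + free_scalar (\<chi> x ^ CHAR('k)))"
    by (simp add: p_relation_def)
  ultimately show ?thesis
    using assms p_relation_closed[OF assms] pmap_closed[OF assms]
    by (metis F.add.m_closed U.l_zero free_algebra_closed_basic(3,4) free_algebra_simps(2) uq.hom_add uq.hom_closed)
qed

text \<open>This is how a map on U_chi(L) is shown to be well defined: take for K the
  representatives that it sends to zero. As U_chi(L) is a quotient of a quotient, K is first pushed
  forward to U(L), where its image is an ideal that contains the p-relations.\<close>

lemma uq_kernel_minimal:
  assumes K: "ideal K F" and lie: "lie_relations \<subseteq> K" and p: "\<And>x. x \<in> lie_space L \<Longrightarrow> p_relation x \<in> K"
    and f: "f \<in> carrier F" "g \<in> carrier F" "uq L \<chi> f = uq L \<chi> g"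
  shows "f - g \<in> K"
proof -
  interpret K: ideal K F by (rule K)
  have IK: "uea_ideal L \<subseteq> K"
    unfolding uea_ideal_eq by (rule F.genideal_minimal[OF K lie])
  have KF: "K \<subseteq> carrier F"
    by (rule K.a_subset)
  have "ideal (uea_class L ` K) (uea L)"
  proof (rule idealI[OF E.ring_axioms])
    show "subgroup (uea_class L ` K) (add_monoid (uea L))"
      using c.img_is_add_subgroup[OF K.a_subgroup] .
    fix a x assume "a \<in> uea_class L ` K" "x \<in> carrier (uea L)"
    then obtain k h where k: "a = uea_class L k" "k \<in> K" "x = uea_class L h" "h \<in> carrier F"
      by (auto simp: uea_class_surj)
    then have "x \<otimes>\<^bsub>uea L\<^esub> a = uea_class L (h * k)" "a \<otimes>\<^bsub>uea L\<^esub> x = uea_class L (k * h)"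
      using KF c.hom_mult by auto
    moreover have "h * k \<in> K" "k * h \<in> K"
      using k K.I_l_closed[of k h] K.I_r_closed[of k h] by auto
    ultimately show "x \<otimes>\<^bsub>uea L\<^esub> a \<in> uea_class L ` K" "a \<otimes>\<^bsub>uea L\<^esub> x \<in> uea_class L ` K"
      by auto
  qed
  then have JK: "reduced_ideal L \<chi> \<subseteq> uea_class L ` K"
    unfolding reduced_ideal_eq by (rule E.genideal_minimal) (auto simp: p_relations_def p)
  have "uea_class L (f - g) \<in> reduced_ideal L \<chi>"
  proof -
    have "uea_class L f \<ominus>\<^bsub>uea L\<^esub> uea_class L g \<in> reduced_ideal L \<chi>"
      using f E.quotient_eq_iff_same_a_r_cos[OF J.is_ideal, of "uea_class L f" "uea_class L g"]
      by (simp add: uq_def)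
    then show ?thesis
      using f by (simp add: uea_class_diff)
  qed
  then obtain k where k: "k \<in> K" "uea_class L (f - g) = uea_class L k"
    using JK by auto
  \<comment> \<open>Both representatives have the same class in U(L), so they differ by an element
    of \<open>uea_ideal L\<close>, and this ideal lies in K.\<close>
  then have "f - g - k \<in> K"
    using IK KF f uea_class_eq_iff[of "f - g" k] free_algebra_closed by blast
  then have "f - g - k + k \<in> K"
    using k K.a_closed[of "f - g - k" k] by simp
  then show ?thesis
    by simp
qed

lemma on_cosets_uea_class:
  assumes "\<And>f g. f \<in> carrier F \<Longrightarrow> g \<in> carrier F \<Longrightarrow> uea_class L f = uea_class L g \<Longrightarrow> \<phi> f = \<phi> g"
    and "f \<in> carrier F"
  shows "on_cosets \<phi> (uea_class L f) = \<phi> f"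
proof (rule the_elem_image_const)
  show "uea_class L f \<noteq> {}"
    using assms(2) I.a_rcos_self by (auto simp: uea_class_def)
  fix g assume g: "g \<in> uea_class L f"
  then have "g \<in> carrier F"
    using assms(2) F.a_r_coset_subset_G[OF I.a_subset assms(2)] by (auto simp: uea_class_def)
  moreover have "uea_class L f = uea_class L g"
    using I.a_repr_independence'[OF g[unfolded uea_class_def] assms(2)] by (simp add: uea_class_def)
  ultimately show "\<phi> g = \<phi> f"
    using assms by metis
qed

text \<open>Elements of U_chi(L) are sets of cosets. The inner map \<psi> is left general because
  the module actions and the map between two reduced algebras treat the inner level
  differently.\<close>

lemma on_cosets_uq_general:
  assumes \<psi>: "\<And>g. g \<in> carrier F \<Longrightarrow> \<psi> (uea_class L g) = \<phi> g"
    and \<phi>: "\<And>f g. f \<in> carrier F \<Longrightarrow> g \<in> carrier F \<Longrightarrow> uq L \<chi> f = uq L \<chi> g \<Longrightarrow> \<phi> f = \<phi> g"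
    and f: "f \<in> carrier F"
  shows "on_cosets \<psi> (uq L \<chi> f) = \<phi> f"
proof (rule the_elem_image_const)
  have cf: "uea_class L f \<in> carrier (uea L)"
    using f by simp
  show "uq L \<chi> f \<noteq> {}"
    using J.a_rcos_self[OF cf] by (auto simp: uq_def)
  fix X assume X: "X \<in> uq L \<chi> f"
  then have "X \<in> carrier (uea L)"
    using cf E.a_r_coset_subset_G[OF J.a_subset cf] by (auto simp: uq_def)
  then obtain g where g: "g \<in> carrier F" "X = uea_class L g"
    by (auto simp: uea_class_surj)
  have "uq L \<chi> f = uq L \<chi> g"
    using J.a_repr_independence'[OF X[unfolded uq_def] cf] g by (simp add: uq_def)
  then show "\<psi> X = \<phi> f"
    unfolding g(2) \<psi>[OF g(1)] by (intro \<phi>[OF g(1) f]) simp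
qed

lemma on_cosets_uq:
  assumes "\<And>f g. f \<in> carrier F \<Longrightarrow> g \<in> carrier F \<Longrightarrow> uq L \<chi> f = uq L \<chi> g \<Longrightarrow> \<phi> f = \<phi> g"
    and "f \<in> carrier F"
  shows "on_cosets (on_cosets \<phi>) (uq L \<chi> f) = \<phi> f"
proof (rule on_cosets_uq_general[OF _ assms])
  fix g assume "g \<in> carrier F"
  then show "on_cosets \<phi> (uea_class L g) = \<phi> g"
    by (rule on_cosets_uea_class[rotated]) (rule assms(1), simp_all add: uq_def)
qed

lemma uq_kernel_ideal: "ideal {g \<in> carrier F. uq L \<chi> g = \<zero>\<^bsub>U\<^esub>} F"
  using uq.kernel_is_ideal unfolding a_kernel_def' .

end

text \<open>Serves the map from U_chi(L') to U_chi(L): restricting the ideal of L to words in L'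
  gives an ideal that contains the relations of L', and minimality then compares the two.\<close>

lemma ideal_free_algebra_restrict:
  fixes K :: "('v free_word \<Rightarrow>\<^sub>0 'k::field) set"
  assumes "ideal K (free_algebra V)" "V' \<subseteq> V"
  shows "ideal (K \<inter> carrier (free_algebra V')) (free_algebra V')"
proof -
  interpret K: ideal K "free_algebra V" by (rule assms(1))
  have inc: "f \<in> carrier (free_algebra V)" if "f \<in> carrier (free_algebra V')" for f :: "'v free_word \<Rightarrow>\<^sub>0 'k"
    using free_algebra_mono[OF assms(2) that] .
  show ?thesis
  proof (rule idealI[OF ring_free_algebra])
    show "subgroup (K \<inter> carrier (free_algebra V')) (add_monoid (free_algebra V'))"
    proof (rule subgroup.intro)
      fix x assume x: "x \<in> K \<inter> carrier (free_algebra V')"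
      have "- 1 \<in> carrier (free_algebra V)"
        by (rule free_algebra_closed(3)[of 1 _ 1]) simp_all
      then have "- x \<in> K"
        using K.I_l_closed[of x "- 1"] x by simp
      then show "inv\<^bsub>add_monoid (free_algebra V')\<^esub> x \<in> K \<inter> carrier (free_algebra V')"
        using x a_inv_free_algebra[of x V'] free_algebra_closed(3)[of x V' x] by (simp add: a_inv_def)
    next
      show "K \<inter> carrier (free_algebra V') \<subseteq> carrier (add_monoid (free_algebra V'))"
        by simp
      show "\<one>\<^bsub>add_monoid (free_algebra V')\<^esub> \<in> K \<inter> carrier (free_algebra V')"
        using additive_subgroup.zero_closed[OF K.additive_subgroup_axioms] by simp
      fix x y assume "x \<in> K \<inter> carrier (free_algebra V')" "y \<in> K \<inter> carrier (free_algebra V')"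
      then show "x \<otimes>\<^bsub>add_monoid (free_algebra V')\<^esub> y \<in> K \<inter> carrier (free_algebra V')"
        using additive_subgroup.a_closed[OF K.additive_subgroup_axioms, of x y] free_algebra_closed(1)[of x V' y] by simp
    qed
    fix a x :: "'v free_word \<Rightarrow>\<^sub>0 'k"
    assume "a \<in> K \<inter> carrier (free_algebra V')" "x \<in> carrier (free_algebra V')"
    then show "x \<otimes>\<^bsub>free_algebra V'\<^esub> a \<in> K \<inter> carrier (free_algebra V')"
      "a \<otimes>\<^bsub>free_algebra V'\<^esub> x \<in> K \<inter> carrier (free_algebra V')"
      using inc[of x] K.I_l_closed[of a x] K.I_r_closed[of a x] by auto
  qed
qed

section \<open>Induced modules\<close>

context left_module
begin

lemma smult_zero [simp]: "x \<in> carrier M \<Longrightarrow> \<zero> \<odot>\<^bsub>M\<^esub> x = \<zero>\<^bsub>M\<^esub>"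
  by (metis M.add.l_cancel_one R.l_zero R.zero_closed smult_closed smult_l_distr)

lemma smult_r_zero [simp]: "a \<in> carrier R \<Longrightarrow> a \<odot>\<^bsub>M\<^esub> \<zero>\<^bsub>M\<^esub> = \<zero>\<^bsub>M\<^esub>"
  by (metis M.add.l_cancel_one M.l_zero M.zero_closed smult_closed smult_r_distr)

end

locale tensor_data = R: ring R + S: ring S + M: left_module S M
  for R :: "('r, 'a) ring_scheme" and S :: "('s, 'b) ring_scheme" and M :: "('s, 'm, 'c) module_scheme" +
  fixes \<phi> :: "'s \<Rightarrow> 'r"
  assumes \<phi>: "\<phi> \<in> ring_hom S R"
begin

abbreviation G :: "('r \<times> 'm \<Rightarrow>\<^sub>0 int) monoid" where
  "G \<equiv> free_Abelian_group (carrier R \<times> carrier M)"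

abbreviation K :: "('r \<times> 'm \<Rightarrow>\<^sub>0 int) set" where
  "K \<equiv> generate G (tensor_relations R S \<phi> M)"

abbreviation I :: "('r, ('r \<times> 'm \<Rightarrow>\<^sub>0 int) set) module" where
  "I \<equiv> induced_module R S \<phi> M"

definition cls :: "('r \<times> 'm \<Rightarrow>\<^sub>0 int) \<Rightarrow> ('r \<times> 'm \<Rightarrow>\<^sub>0 int) set" where
  "cls z = K #>\<^bsub>G\<^esub> z"

definition tens :: "'r \<Rightarrow> 'm \<Rightarrow> ('r \<times> 'm \<Rightarrow>\<^sub>0 int) set" where
  "tens a m = cls (frag_of (a, m))"

definition left_mult :: "'r \<Rightarrow> ('r \<times> 'm \<Rightarrow>\<^sub>0 int) \<Rightarrow> ('r \<times> 'm \<Rightarrow>\<^sub>0 int)" where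
  "left_mult u = frag_extend (\<lambda>(a, m). frag_of (u \<otimes>\<^bsub>R\<^esub> a, m))"

sublocale G: comm_group G
  by (rule abelian_free_Abelian_group)

lemma \<phi>_closed: "s \<in> carrier S \<Longrightarrow> \<phi> s \<in> carrier R"
  using \<phi> by (auto simp: ring_hom_def)

lemma relations_closed: "tensor_relations R S \<phi> M \<subseteq> carrier G"
proof -
  have "keys (x - y) \<subseteq> A" if "keys x \<subseteq> A" "keys y \<subseteq> A" for x y :: "'r \<times> 'm \<Rightarrow>\<^sub>0 int" and A
    using that keys_diff[of x y] by blast
  then show ?thesis
    unfolding tensor_relations_def using \<phi>_closed
    by (auto simp: carrier_free_Abelian_group_iff keys_frag_of M.smult_closed
        simp del: frag_of_in_free_Abelian_group)
qed

lemma subgroup_K: "subgroup K G"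
  by (rule G.generate_is_subgroup[OF relations_closed])

sublocale N: normal K G
  by (rule G.subgroup_imp_normal[OF subgroup_K])

lemma K_closed: "z \<in> K \<Longrightarrow> z \<in> carrier G"
  using subgroup.subset[OF subgroup_K] by blast

lemma K_zero: "0 \<in> K"
  using subgroup.one_closed[OF subgroup_K] by simp

lemma inv_G: "z \<in> carrier G \<Longrightarrow> inv\<^bsub>G\<^esub> z = - z"
  by (rule inv_free_Abelian_group) (simp only: carrier_free_Abelian_group_iff)

lemma K_diff:
  assumes "z \<in> K" "w \<in> K"
  shows "z - w \<in> K"
proof -
  have "inv\<^bsub>G\<^esub> w \<in> K"
    by (rule subgroup.m_inv_closed[OF subgroup_K assms(2)])
  then have "z \<otimes>\<^bsub>G\<^esub> (- w) \<in> K"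
    unfolding inv_G[OF K_closed[OF assms(2)]] by (rule subgroup.m_closed[OF subgroup_K assms(1)])
  then show ?thesis
    by simp
qed

lemma K_add: "z \<in> K \<Longrightarrow> w \<in> K \<Longrightarrow> z + w \<in> K"
  using subgroup.m_closed[OF subgroup_K, of z "w"] by simp

lemma K_rel: "z \<in> tensor_relations R S \<phi> M \<Longrightarrow> z \<in> K"
  by (rule generate.incl)

lemma cls_eq: "cls z = {k + z | k. k \<in> K}"
  by (auto simp: cls_def r_coset_def)

lemma cls_eq_iff: "cls z = cls w \<longleftrightarrow> z - w \<in> K"
proof
  assume "cls z = cls w"
  moreover have "z \<in> cls z"
    using K_zero by (auto simp: cls_eq intro!: exI[of _ 0])
  ultimately have "z \<in> cls w"
    by simp
  then show "z - w \<in> K"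
    by (auto simp: cls_eq)
next
  assume d: "z - w \<in> K"
  show "cls z = cls w"
  proof (intro subset_antisym subsetI)
    fix x assume "x \<in> cls z"
    then obtain k where "k \<in> K" "x = k + z" by (auto simp: cls_eq)
    then show "x \<in> cls w"
      using K_add[OF \<open>k \<in> K\<close> d] by (auto simp: cls_eq intro!: exI[of _ "k + (z - w)"])
  next
    fix x assume "x \<in> cls w"
    then obtain k where "k \<in> K" "x = k + w" by (auto simp: cls_eq)
    then show "x \<in> cls z"
      using K_diff[OF \<open>k \<in> K\<close> d] by (auto simp: cls_eq intro!: exI[of _ "k - (z - w)"])
  qed
qed

lemma in_cls_iff: "w \<in> cls z \<longleftrightarrow> w - z \<in> K"
  by (auto simp: cls_eq intro!: exI[of _ "w - z"])

lemma left_mult_simps [simp]: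
  "left_mult u (frag_of (a, m)) = frag_of (u \<otimes>\<^bsub>R\<^esub> a, m)"
  "left_mult u (z - w) = left_mult u z - left_mult u w"
  "left_mult u (z + w) = left_mult u z + left_mult u w"
  "left_mult u (- z) = - left_mult u z"
  "left_mult u 0 = 0"
  by (simp_all add: left_mult_def frag_extend_diff frag_extend_add frag_extend_minus)

lemma left_mult_closed:
  assumes "u \<in> carrier R" "z \<in> carrier G"
  shows "left_mult u z \<in> carrier G"
proof -
  have "keys z \<subseteq> carrier R \<times> carrier M"
    using assms(2) by simp
  then have "keys (left_mult u z) \<subseteq> carrier R \<times> carrier M"
  proof (induction z rule: frag_induction)
    case (one x)
    then show ?case
      using assms(1) by (cases x) (auto simp: keys_frag_of)
  next
    case (diff a b)
    then show ?case
      using keys_diff[of "left_mult u a" "left_mult u b"] by auto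
  qed simp
  then show ?thesis
    by simp
qed

text \<open>Distributivity in R handles the first family and associativity the third, while the
  second keeps its form. Hence left multiplication descends to the tensor product.\<close>

lemma left_mult_relations:
  assumes u: "u \<in> carrier R" and h: "h \<in> tensor_relations R S \<phi> M"
  shows "left_mult u h \<in> tensor_relations R S \<phi> M"
proof -
  from h consider
      (1) a b m where "h = frag_of (a \<oplus>\<^bsub>R\<^esub> b, m) - frag_of (a, m) - frag_of (b, m)"
        "a \<in> carrier R" "b \<in> carrier R" "m \<in> carrier M"
    | (2) a m n where "h = frag_of (a, m \<oplus>\<^bsub>M\<^esub> n) - frag_of (a, m) - frag_of (a, n)"
        "a \<in> carrier R" "m \<in> carrier M" "n \<in> carrier M"
    | (3) a s m where "h = frag_of (a \<otimes>\<^bsub>R\<^esub> \<phi> s, m) - frag_of (a, s \<odot>\<^bsub>M\<^esub> m)"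
        "a \<in> carrier R" "s \<in> carrier S" "m \<in> carrier M"
    unfolding tensor_relations_def by blast
  then show ?thesis
  proof cases
    case 1
    have "u \<otimes>\<^bsub>R\<^esub> (a \<oplus>\<^bsub>R\<^esub> b) = u \<otimes>\<^bsub>R\<^esub> a \<oplus>\<^bsub>R\<^esub> u \<otimes>\<^bsub>R\<^esub> b"
      using 1 u by (simp add: R.r_distr)
    moreover have "u \<otimes>\<^bsub>R\<^esub> a \<in> carrier R" "u \<otimes>\<^bsub>R\<^esub> b \<in> carrier R"
      using 1 u by auto
    ultimately show ?thesis
      using 1 unfolding tensor_relations_def by (simp; blast)
  next
    case 2
    have "u \<otimes>\<^bsub>R\<^esub> a \<in> carrier R"
      using 2 u by auto
    then show ?thesis
      using 2 unfolding tensor_relations_def by (simp; blast)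
  next
    case 3
    have "u \<otimes>\<^bsub>R\<^esub> (a \<otimes>\<^bsub>R\<^esub> \<phi> s) = u \<otimes>\<^bsub>R\<^esub> a \<otimes>\<^bsub>R\<^esub> \<phi> s"
      using 3 u \<phi>_closed by (simp add: R.m_assoc)
    moreover have "u \<otimes>\<^bsub>R\<^esub> a \<in> carrier R"
      using 3 u by auto
    ultimately show ?thesis
      using 3 unfolding tensor_relations_def by (simp; blast)
  qed
qed

lemma left_mult_K:
  assumes u: "u \<in> carrier R" and z: "z \<in> K"
  shows "left_mult u z \<in> K"
  using z
proof (induction rule: generate.induct)
  case one
  then show ?case by (simp add: K_zero)
next
  case (incl h)
  then show ?case
    by (intro K_rel left_mult_relations[OF u])
next
  case (inv h)
  then have "inv\<^bsub>G\<^esub> h = - h"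
    using relations_closed by (intro inv_G) (rule subsetD)
  moreover have "left_mult u h \<in> K"
    using inv by (intro K_rel left_mult_relations[OF u])
  ultimately show ?case
    using K_diff[OF K_zero] by simp
next
  case (eng h1 h2)
  then show ?case by (simp add: K_add)
qed

lemma carrier_I: "carrier I = cls ` carrier G"
  by (auto simp: induced_module_def Let_def carrier_FactGroup cls_def)

lemma zero_I: "\<zero>\<^bsub>I\<^esub> = cls 0"
  by (simp add: induced_module_def Let_def cls_eq)

lemma add_I:
  assumes "z \<in> carrier G" "w \<in> carrier G"
  shows "cls z \<oplus>\<^bsub>I\<^esub> cls w = cls (z + w)"
  using N.rcos_sum[OF assms] by (simp add: induced_module_def Let_def cls_def)

lemma smult_I:
  assumes u: "u \<in> carrier R" and z: "z \<in> carrier G"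
  shows "u \<odot>\<^bsub>I\<^esub> cls z = cls (left_mult u z)"
proof -
  have "on_cosets (\<lambda>z. cls (left_mult u z)) (cls z) = cls (left_mult u z)"
  proof (rule the_elem_image_const)
    show "cls z \<noteq> {}"
      using K_zero by (auto simp: cls_eq)
    fix w assume "w \<in> cls z"
    then have "w - z \<in> K"
      by (simp add: in_cls_iff)
    then have "left_mult u (w - z) \<in> K"
      by (rule left_mult_K[OF u])
    then show "cls (left_mult u w) = cls (left_mult u z)"
      by (simp add: cls_eq_iff)
  qed
  then show ?thesis
    by (simp add: induced_module_def Let_def cls_def left_mult_def)
qed

lemma G_closed:
  "z \<in> carrier G \<Longrightarrow> w \<in> carrier G \<Longrightarrow> z + w \<in> carrier G"
  "z \<in> carrier G \<Longrightarrow> w \<in> carrier G \<Longrightarrow> z - w \<in> carrier G"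
  "0 \<in> carrier G" "z \<in> carrier G \<Longrightarrow> - z \<in> carrier G"
  using G.m_closed[of z w] keys_diff[of z w] by auto

lemma tens_closed: "a \<in> carrier R \<Longrightarrow> m \<in> carrier M \<Longrightarrow> tens a m \<in> carrier I"
  unfolding tens_def carrier_I by (intro imageI) simp

lemma smult_tens:
  "u \<in> carrier R \<Longrightarrow> a \<in> carrier R \<Longrightarrow> m \<in> carrier M \<Longrightarrow> u \<odot>\<^bsub>I\<^esub> tens a m = tens (u \<otimes>\<^bsub>R\<^esub> a) m"
  unfolding tens_def by (subst smult_I) simp_all

lemma relation_add_left:
  "a \<in> carrier R \<Longrightarrow> b \<in> carrier R \<Longrightarrow> m \<in> carrier M \<Longrightarrow>
    frag_of (a \<oplus>\<^bsub>R\<^esub> b, m) - frag_of (a, m) - frag_of (b, m) \<in> K"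
  by (rule K_rel) (simp add: tensor_relations_def, blast)

lemma tens_balanced:
  assumes "a \<in> carrier R" "s \<in> carrier S" "m \<in> carrier M"
  shows "tens (a \<otimes>\<^bsub>R\<^esub> \<phi> s) m = tens a (s \<odot>\<^bsub>M\<^esub> m)"
proof -
  have "frag_of (a \<otimes>\<^bsub>R\<^esub> \<phi> s, m) - frag_of (a, s \<odot>\<^bsub>M\<^esub> m) \<in> K"
    using assms by (intro K_rel) (simp add: tensor_relations_def, blast)
  then show ?thesis
    by (simp only: tens_def cls_eq_iff)
qed

lemma G_induct [consumes 1, case_names zero tens diff]:
  assumes "z \<in> carrier G" and "P 0"
    and "\<And>a m. a \<in> carrier R \<Longrightarrow> m \<in> carrier M \<Longrightarrow> P (frag_of (a, m))"
    and "\<And>z w. z \<in> carrier G \<Longrightarrow> w \<in> carrier G \<Longrightarrow> P z \<Longrightarrow> P w \<Longrightarrow> P (z - w)"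
  shows "P z"
proof -
  have "keys z \<subseteq> carrier R \<times> carrier M"
    using assms(1) by simp
  then have "P z \<and> z \<in> carrier G"
    by (induction z rule: frag_induction) (use assms(2-4) G_closed in \<open>auto simp: keys_frag_of\<close>)
  then show ?thesis ..
qed

lemma abelian_group_I: "abelian_group I"
proof (rule abelian_groupI)
  show "\<zero>\<^bsub>I\<^esub> \<in> carrier I"
    unfolding zero_I carrier_I using G_closed by blast
  fix x y z assume "x \<in> carrier I" "y \<in> carrier I" "z \<in> carrier I"
  then obtain x' y' z' where eq: "x = cls x'" "y = cls y'" "z = cls z'"
    and G: "x' \<in> carrier G" "y' \<in> carrier G" "z' \<in> carrier G"
    by (auto simp only: carrier_I)
  show "x \<oplus>\<^bsub>I\<^esub> y \<in> carrier I"
    unfolding eq add_I[OF G(1,2)] carrier_I using G G_closed by blast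
  show "x \<oplus>\<^bsub>I\<^esub> y \<oplus>\<^bsub>I\<^esub> z = x \<oplus>\<^bsub>I\<^esub> (y \<oplus>\<^bsub>I\<^esub> z)"
    unfolding eq using G G_closed by (simp only: add_I add.assoc)
  show "x \<oplus>\<^bsub>I\<^esub> y = y \<oplus>\<^bsub>I\<^esub> x"
    unfolding eq using G G_closed by (simp only: add_I add.commute)
  show "\<zero>\<^bsub>I\<^esub> \<oplus>\<^bsub>I\<^esub> x = x"
    unfolding eq zero_I using G G_closed by (simp only: add_I add_0)
  show "\<exists>y\<in>carrier I. y \<oplus>\<^bsub>I\<^esub> x = \<zero>\<^bsub>I\<^esub>"
    unfolding eq zero_I carrier_I
    using G G_closed by (intro bexI[of _ "cls (- x')"] imageI) (simp only: add_I left_minus, blast)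
qed

lemma left_module_I: "left_module R I"
proof (intro left_module.intro left_module_axioms.intro R.ring_axioms abelian_group_I)
  fix a b x y
  assume ab: "a \<in> carrier R" "b \<in> carrier R" and "x \<in> carrier I" "y \<in> carrier I"
  then obtain x' y' where eq: "x = cls x'" "y = cls y'" and G: "x' \<in> carrier G" "y' \<in> carrier G"
    by (auto simp only: carrier_I)
  note [simp] = left_mult_closed[OF ab(1)] left_mult_closed[OF ab(2)] G
  show "a \<odot>\<^bsub>I\<^esub> (x \<oplus>\<^bsub>I\<^esub> y) = a \<odot>\<^bsub>I\<^esub> x \<oplus>\<^bsub>I\<^esub> a \<odot>\<^bsub>I\<^esub> y"
    unfolding eq using ab G G_closed left_mult_closed
    by (simp only: add_I smult_I left_mult_simps)
next
  fix a x assume a: "a \<in> carrier R" and "x \<in> carrier I"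
  then obtain x' where eq: "x = cls x'" and G: "x' \<in> carrier G"
    by (auto simp only: carrier_I)
  show "a \<odot>\<^bsub>I\<^esub> x \<in> carrier I"
    unfolding eq smult_I[OF a G] carrier_I using left_mult_closed[OF a G] by blast
next
  fix a b x assume ab: "a \<in> carrier R" "b \<in> carrier R" and "x \<in> carrier I"
  then obtain x' where eq: "x = cls x'" and G: "x' \<in> carrier G"
    by (auto simp only: carrier_I)
  have "left_mult (a \<otimes>\<^bsub>R\<^esub> b) x' = left_mult a (left_mult b x')"
    using G ab by (induction rule: G_induct) (simp_all add: R.m_assoc)
  then show "(a \<otimes>\<^bsub>R\<^esub> b) \<odot>\<^bsub>I\<^esub> x = a \<odot>\<^bsub>I\<^esub> (b \<odot>\<^bsub>I\<^esub> x)"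
    unfolding eq using ab G left_mult_closed by (simp only: smult_I R.m_closed)
  \<comment> \<open>The other module laws hold already in the free abelian group; additivity in the
    scalar holds only modulo the biadditivity relations.\<close>
  have "left_mult (a \<oplus>\<^bsub>R\<^esub> b) x' - (left_mult a x' + left_mult b x') \<in> K"
    using G
  proof (induction rule: G_induct)
    case zero
    then show ?case by (simp add: K_zero)
  next
    case (tens c m)
    then have "a \<otimes>\<^bsub>R\<^esub> c \<in> carrier R" "b \<otimes>\<^bsub>R\<^esub> c \<in> carrier R"
      using ab by simp_all
    then have "frag_of (a \<otimes>\<^bsub>R\<^esub> c \<oplus>\<^bsub>R\<^esub> b \<otimes>\<^bsub>R\<^esub> c, m) - frag_of (a \<otimes>\<^bsub>R\<^esub> c, m) - frag_of (b \<otimes>\<^bsub>R\<^esub> c, m) \<in> K"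
      by (rule relation_add_left) (rule tens)
    then show ?case
      using ab tens by (simp add: R.l_distr diff_diff_eq)
  next
    case (diff z w)
    then show ?case
      using K_diff[OF diff(3,4)] by (simp add: algebra_simps)
  qed
  then have "cls (left_mult (a \<oplus>\<^bsub>R\<^esub> b) x') = cls (left_mult a x' + left_mult b x')"
    by (simp only: cls_eq_iff)
  then show "(a \<oplus>\<^bsub>R\<^esub> b) \<odot>\<^bsub>I\<^esub> x = a \<odot>\<^bsub>I\<^esub> x \<oplus>\<^bsub>I\<^esub> b \<odot>\<^bsub>I\<^esub> x"
    unfolding eq using ab G left_mult_closed by (simp only: smult_I add_I R.a_closed)
next
  fix x assume "x \<in> carrier I"
  then obtain x' where eq: "x = cls x'" and G: "x' \<in> carrier G"
    by (auto simp only: carrier_I)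
  have "left_mult \<one>\<^bsub>R\<^esub> x' = x'"
    using G by (induction rule: G_induct) simp_all
  then show "\<one>\<^bsub>R\<^esub> \<odot>\<^bsub>I\<^esub> x = x"
    unfolding eq using G by (simp only: smult_I R.one_closed)
qed

lemma submodule_eq_carrier:
  assumes N: "submodule N R I"
    and tens: "\<And>a m. a \<in> carrier R \<Longrightarrow> m \<in> carrier M \<Longrightarrow> tens a m \<in> N"
  shows "N = carrier I"
proof
  interpret A: abelian_group I by (rule abelian_group_I)
  have sub: "subgroup N (add_monoid I)"
    using N by (rule submodule.axioms(1))
  show "N \<subseteq> carrier I"
    using subgroup.subset[OF sub] by simp
  have "cls z \<in> N" if "z \<in> carrier G" for z
    using that
  proof (induction rule: G_induct)
    case zero
    show ?case
      using subgroup.one_closed[OF sub] by (simp add: zero_I)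
  next
    case (tens a m)
    then show ?case
      using assms(2) by (simp add: tens_def)
  next
    case (diff z w)
    have "cls (- w) \<oplus>\<^bsub>I\<^esub> cls w = \<zero>\<^bsub>I\<^esub>"
      using diff G_closed by (simp only: add_I zero_I left_minus)
    then have "\<ominus>\<^bsub>I\<^esub> cls w = cls (- w)"
      using diff G_closed by (intro A.minus_equality) (auto simp only: carrier_I)
    then have "cls (- w) \<in> N"
      using subgroup.m_inv_closed[OF sub diff(4)] by (simp add: a_inv_def)
    then have "cls z \<oplus>\<^bsub>I\<^esub> cls (- w) \<in> N"
      using subgroup.m_closed[OF sub diff(3)] by simp
    then show ?case
      using diff G_closed by (simp only: add_I add_uminus_conv_diff)
  qed
  then show "carrier I \<subseteq> N"
    by (auto simp only: carrier_I)
qed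

text \<open>The tensor-hom adjunction: an S-linear map from M to N, regarded as an S-module through
  \<phi>, extends R-linearly to the induced module. The relations die because f is additive and
  balanced and N is a module.\<close>

lemma induced_module_universal:
  assumes N: "left_module R N"
    and f: "\<And>m. m \<in> carrier M \<Longrightarrow> f m \<in> carrier N"
      "\<And>m n. m \<in> carrier M \<Longrightarrow> n \<in> carrier M \<Longrightarrow> f (m \<oplus>\<^bsub>M\<^esub> n) = f m \<oplus>\<^bsub>N\<^esub> f n"
      "\<And>s m. s \<in> carrier S \<Longrightarrow> m \<in> carrier M \<Longrightarrow> f (s \<odot>\<^bsub>M\<^esub> m) = \<phi> s \<odot>\<^bsub>N\<^esub> f m"
  obtains h where "\<And>x. x \<in> carrier I \<Longrightarrow> h x \<in> carrier N"
    "\<And>x y. x \<in> carrier I \<Longrightarrow> y \<in> carrier I \<Longrightarrow> h (x \<oplus>\<^bsub>I\<^esub> y) = h x \<oplus>\<^bsub>N\<^esub> h y"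
    "\<And>u x. u \<in> carrier R \<Longrightarrow> x \<in> carrier I \<Longrightarrow> h (u \<odot>\<^bsub>I\<^esub> x) = u \<odot>\<^bsub>N\<^esub> h x"
    "\<And>a m. a \<in> carrier R \<Longrightarrow> m \<in> carrier M \<Longrightarrow> h (tens a m) = a \<odot>\<^bsub>N\<^esub> f m"
proof -
  interpret N: left_module R N by (rule N)
  have "(\<lambda>(a, m). a \<odot>\<^bsub>N\<^esub> f m) ` (carrier R \<times> carrier M) \<subseteq> carrier (add_monoid N)"
    using f N.smult_closed by auto
  from comm_group.free_Abelian_group_universal[OF N.M.a_comm_group this]
  obtain h0 where h0: "h0 \<in> hom G (add_monoid N)"
    and h0_of: "\<And>x. x \<in> carrier R \<times> carrier M \<Longrightarrow> h0 (frag_of x) = (case x of (a, m) \<Rightarrow> a \<odot>\<^bsub>N\<^esub> f m)"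
    by blast
  interpret h0: group_hom G "add_monoid N" h0
    by (rule group_hom.intro[OF group_free_Abelian_group N.M.a_group])
      (simp add: group_hom_axioms_def h0)
  have h0_closed: "h0 z \<in> carrier N" if "z \<in> carrier G" for z
    using h0.hom_closed[OF that] by simp
  have h0_add: "h0 (z + w) = h0 z \<oplus>\<^bsub>N\<^esub> h0 w" if "z \<in> carrier G" "w \<in> carrier G" for z w
    using h0.hom_mult[OF that] by simp
  have h0_zero: "h0 0 = \<zero>\<^bsub>N\<^esub>"
    using h0.hom_one by simp
  have h0_diff: "h0 (z - w) = h0 z \<ominus>\<^bsub>N\<^esub> h0 w" if "z \<in> carrier G" "w \<in> carrier G" for z w
    using h0_add[OF that(1) G_closed(4)[OF that(2)]] h0.hom_inv[OF that(2)] that(2)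
    by (simp add: a_minus_def a_inv_def)
  have h0_frag: "h0 (frag_of (a, m)) = a \<odot>\<^bsub>N\<^esub> f m" if "a \<in> carrier R" "m \<in> carrier M" for a m
    using h0_of[of "(a, m)"] that by simp
  have rel: "h0 z = \<zero>\<^bsub>N\<^esub>" if z: "z \<in> tensor_relations R S \<phi> M" for z
  proof -
    have sub: "h0 z = \<zero>\<^bsub>N\<^esub>" if a: "z = x - y - w" "x \<in> carrier G" "y \<in> carrier G" "w \<in> carrier G"
        "h0 x = h0 y \<oplus>\<^bsub>N\<^esub> h0 w" for x y w
    proof -
      have "h0 z = h0 x \<ominus>\<^bsub>N\<^esub> h0 (y + w)"
        unfolding a(1) diff_diff_eq by (rule h0_diff[OF a(2) G_closed(1)[OF a(3,4)]])
      then show ?thesis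
        using h0_add[OF a(3,4)] a(5) h0_closed[OF a(3)] h0_closed[OF a(4)]
        by (simp add: a_minus_def N.M.r_neg)
    qed
    from z consider
        (1) a b m where "z = frag_of (a \<oplus>\<^bsub>R\<^esub> b, m) - frag_of (a, m) - frag_of (b, m)"
          "a \<in> carrier R" "b \<in> carrier R" "m \<in> carrier M"
      | (2) a m n where "z = frag_of (a, m \<oplus>\<^bsub>M\<^esub> n) - frag_of (a, m) - frag_of (a, n)"
          "a \<in> carrier R" "m \<in> carrier M" "n \<in> carrier M"
      | (3) a s m where "z = frag_of (a \<otimes>\<^bsub>R\<^esub> \<phi> s, m) - frag_of (a, s \<odot>\<^bsub>M\<^esub> m)"
          "a \<in> carrier R" "s \<in> carrier S" "m \<in> carrier M"
      unfolding tensor_relations_def by blast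
    then show ?thesis
    proof cases
      case 1
      show ?thesis
        by (rule sub[OF 1(1)]) (use 1(2-4) f(1) in \<open>simp_all add: h0_frag N.smult_l_distr\<close>)
    next
      case 2
      show ?thesis
        by (rule sub[OF 2(1)]) (use 2(2-4) f(1,2) in \<open>simp_all add: h0_frag N.smult_r_distr\<close>)
    next
      case 3
      have "h0 z = h0 (frag_of (a \<otimes>\<^bsub>R\<^esub> \<phi> s, m)) \<ominus>\<^bsub>N\<^esub> h0 (frag_of (a, s \<odot>\<^bsub>M\<^esub> m))"
        unfolding 3(1) using 3(2-4) \<phi>_closed M.smult_closed by (intro h0_diff) simp_all
      also have "h0 (frag_of (a \<otimes>\<^bsub>R\<^esub> \<phi> s, m)) = a \<odot>\<^bsub>N\<^esub> (\<phi> s \<odot>\<^bsub>N\<^esub> f m)"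
        using 3(2-4) f(1) \<phi>_closed by (simp add: h0_frag N.smult_assoc)
      also have "h0 (frag_of (a, s \<odot>\<^bsub>M\<^esub> m)) = a \<odot>\<^bsub>N\<^esub> (\<phi> s \<odot>\<^bsub>N\<^esub> f m)"
        using 3(2-4) f(3) M.smult_closed by (simp add: h0_frag)
      finally show ?thesis
        using 3(2-4) f(1) \<phi>_closed by (simp add: N.smult_closed N.M.r_neg a_minus_def)
    qed
  qed
  have K: "h0 z = \<zero>\<^bsub>N\<^esub>" if "z \<in> K" for z
    using that
  proof (induction rule: generate.induct)
    case (inv h)
    then show ?case
      using h0.hom_inv[of h] subsetD[OF relations_closed inv] rel[OF inv]
      by (simp del: inv_free_Abelian_group add: N.M.add.inv_one)
  next
    case (eng h1 h2)
    then show ?case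
      using h0_add[OF K_closed K_closed] by simp
  qed (simp_all add: h0_zero rel)
  define h where "h = on_cosets h0"
  have h: "h (cls z) = h0 z" if z: "z \<in> carrier G" for z
    unfolding h_def
  proof (rule the_elem_image_const)
    show "cls z \<noteq> {}"
      using K_zero by (auto simp: cls_eq)
    fix w assume "w \<in> cls z"
    then have k: "w - z \<in> K"
      by (simp add: in_cls_iff)
    have "h0 ((w - z) + z) = h0 (w - z) \<oplus>\<^bsub>N\<^esub> h0 z"
      by (rule h0_add[OF K_closed[OF k] z])
    then show "h0 w = h0 z"
      using K[OF k] h0_closed[OF z] by simp
  qed
  show ?thesis
  proof (rule that[of h])
    fix x assume "x \<in> carrier I"
    then obtain x' where x: "x = cls x'" "x' \<in> carrier G"
      by (auto simp only: carrier_I)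
    then show "h x \<in> carrier N"
      using h h0_closed by metis
    fix u assume u: "u \<in> carrier R"
    have "h0 (left_mult u x') = u \<odot>\<^bsub>N\<^esub> h0 x'"
      using x(2)
    proof (induction rule: G_induct)
      case zero
      then show ?case using u by (simp add: h0_zero)
    next
      case (tens a m)
      then show ?case using u f by (simp add: h0_frag N.smult_assoc)
    next
      \<comment> \<open>Linearity passes to differences by cancellation: additivity is applied to z
        = (z - w) + w before and after multiplication by u.\<close>
      case (diff z w)
      note closed = left_mult_closed[OF u diff(1)] left_mult_closed[OF u diff(2)]
        G_closed(2)[OF diff(1,2)] left_mult_closed[OF u G_closed(2)[OF diff(1,2)]]
      have "h0 z = h0 (z - w) \<oplus>\<^bsub>N\<^esub> h0 w"
        using h0_add[OF closed(3) diff(2)] by simp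
      then have "u \<odot>\<^bsub>N\<^esub> h0 z = u \<odot>\<^bsub>N\<^esub> h0 (z - w) \<oplus>\<^bsub>N\<^esub> u \<odot>\<^bsub>N\<^esub> h0 w"
        using N.smult_r_distr[OF u h0_closed[OF closed(3)] h0_closed[OF diff(2)]] by simp
      moreover have "h0 (left_mult u z) = h0 (left_mult u (z - w)) \<oplus>\<^bsub>N\<^esub> h0 (left_mult u w)"
        using h0_add[OF closed(4,2)] by simp
      ultimately have "h0 (left_mult u (z - w)) \<oplus>\<^bsub>N\<^esub> u \<odot>\<^bsub>N\<^esub> h0 w = u \<odot>\<^bsub>N\<^esub> h0 (z - w) \<oplus>\<^bsub>N\<^esub> u \<odot>\<^bsub>N\<^esub> h0 w"
        using diff(3,4) by simp
      then show ?case
        using N.M.add.right_cancel[of "h0 (left_mult u (z - w))" "u \<odot>\<^bsub>N\<^esub> h0 w" "u \<odot>\<^bsub>N\<^esub> h0 (z - w)"]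
          h0_closed[OF closed(4)] N.smult_closed[OF u h0_closed[OF closed(3)]] N.smult_closed[OF u h0_closed[OF diff(2)]]
        by simp
    qed
    then show "h (u \<odot>\<^bsub>I\<^esub> x) = u \<odot>\<^bsub>N\<^esub> h x"
      using x u left_mult_closed by (simp only: smult_I h)
  next
    fix x y assume "x \<in> carrier I" "y \<in> carrier I"
    then obtain x' y' where x: "x = cls x'" "x' \<in> carrier G" "y = cls y'" "y' \<in> carrier G"
      by (auto simp only: carrier_I)
    then show "h (x \<oplus>\<^bsub>I\<^esub> y) = h x \<oplus>\<^bsub>N\<^esub> h y"
      using G_closed h0_add by (simp only: add_I h)
  next
    fix a m assume "a \<in> carrier R" "m \<in> carrier M"
    then show "h (tens a m) = a \<odot>\<^bsub>N\<^esub> f m"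
      unfolding tens_def by (subst h) (simp_all add: h0_frag)
  qed
qed

end

section \<open>The \<open>p\<close>-map of the truncated current algebra\<close>

lemma app_commutator: "app (commutator \<phi> \<psi>) f = app \<phi> (app \<psi> f) - app \<psi> (app \<phi> f)"
  by (simp add: commutator_def)

text \<open>
  A representation that respects brackets only on an invariant subspace \<open>V\<close> still satisfies
  Jacobson's formula there.
\<close>

locale lie_rep_on =
  fixes L :: "'v::ab_group_add set" and sc :: "'k::field \<Rightarrow> 'v \<Rightarrow> 'v" and br :: "'v \<Rightarrow> 'v \<Rightarrow> 'v"
    and r :: "'v \<Rightarrow> ('b, 'k) endo" and V :: "('b \<Rightarrow>\<^sub>0 'k) set"
  assumes L_zero: "0 \<in> L" and L_add: "x \<in> L \<Longrightarrow> y \<in> L \<Longrightarrow> x + y \<in> L"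
    and L_scale: "x \<in> L \<Longrightarrow> sc c x \<in> L" and L_bracket: "x \<in> L \<Longrightarrow> y \<in> L \<Longrightarrow> br x y \<in> L"
    and r_add: "x \<in> L \<Longrightarrow> y \<in> L \<Longrightarrow> r (x + y) = r x + r y"
    and r_scale: "x \<in> L \<Longrightarrow> r (sc c x) = scalar_endo c * r x"
    and r_V: "x \<in> L \<Longrightarrow> f \<in> V \<Longrightarrow> app (r x) f \<in> V"
    and r_bracket: "x \<in> L \<Longrightarrow> y \<in> L \<Longrightarrow> f \<in> V \<Longrightarrow> app (r (br x y)) f = app (commutator (r x) (r y)) f"
    and prime_CHAR: "prime CHAR('k)"
begin

lemma r_zero: "r 0 = 0"
  using r_add[OF L_zero L_zero] by simp

lemma L_sum: "(\<And>i. i \<in> A \<Longrightarrow> f i \<in> L) \<Longrightarrow> (\<Sum>i\<in>A. f i) \<in> L"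
  by (induction A rule: infinite_finite_induct) (auto intro: L_zero L_add)

lemma r_sum: "(\<And>i. i \<in> A \<Longrightarrow> f i \<in> L) \<Longrightarrow> r (\<Sum>i\<in>A. f i) = (\<Sum>i\<in>A. r (f i))"
  by (induction A rule: infinite_finite_induct) (auto simp: r_zero r_add L_sum)

lemma ad_coeff_closed: "x \<in> L \<Longrightarrow> y \<in> L \<Longrightarrow> ad_coeff br x y m j \<in> L"
  by (induction m arbitrary: j) (auto intro!: L_zero L_add L_bracket)

text \<open>Brackets are respected only on vectors of V, so f is generalised in the induction:
  unfolding one commutator leads to the vectors f and \<open>app (r z) f\<close>, and invariance
  keeps the latter in V.\<close>

lemma app_ad_coeff:
  assumes "x \<in> L" "y \<in> L" "f \<in> V"
  shows "app (ad_coeff commutator (r x) (r y) m j) f = app (r (ad_coeff br x y m j)) f"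
  using assms(3)
proof (induction m arbitrary: j f)
  case (Suc m)
  have "app (commutator (r z) (ad_coeff commutator (r x) (r y) m i)) f = app (r (br z (ad_coeff br x y m i))) f"
    if "z \<in> L" for z i
    using Suc r_bracket[OF that ad_coeff_closed[OF assms(1,2)]] r_V[OF that Suc.prems]
    by (simp add: app_commutator)
  then show ?case
    using assms(1,2) by (auto simp: r_add L_zero L_bracket ad_coeff_closed r_zero)
qed (simp add: r_zero)

lemma jacobson_s_closed: "x \<in> L \<Longrightarrow> y \<in> L \<Longrightarrow> jacobson_s sc br i x y \<in> L"
  by (simp add: jacobson_s_def L_scale ad_coeff_closed)

text \<open>Jacobson's formula holds for the operators themselves. Only its correction terms have to
  be turned into images of Lie elements, and this is where f must lie in V.\<close>

lemma app_jacobson: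
  assumes "x \<in> L" "y \<in> L" "f \<in> V"
  shows "app (r (x + y) ^ CHAR('k)) f = app (r x ^ CHAR('k)) f + app (r y ^ CHAR('k)) f +
    app (r (\<Sum>i=1..<CHAR('k). jacobson_s sc br i x y)) f"
proof -
  have "r (x + y) ^ CHAR('k) = r x ^ CHAR('k) + r y ^ CHAR('k) +
    (\<Sum>i=1..<CHAR('k). scalar_endo (inverse (of_nat i)) * ad_coeff commutator (r x) (r y) (CHAR('k) - 1) (i - 1))"
    unfolding r_add[OF assms(1,2)]
    by (rule jacobson_formula[OF prime_CHAR of_nat_CHAR_endo refl])
      (rule endo_scalar.s_one endo_scalar.s_add endo_scalar.s_mult)+
  moreover have "r (\<Sum>i=1..<CHAR('k). jacobson_s sc br i x y) = (\<Sum>i=1..<CHAR('k). r (jacobson_s sc br i x y))"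
    by (rule r_sum) (rule jacobson_s_closed[OF assms(1,2)])
  ultimately show ?thesis
    using assms by (simp add: app_sum_left app_ad_coeff jacobson_s_def r_scale ad_coeff_closed)
qed

end

section \<open>The Lie algebra W_n: Jacobi identity and trivial centre\<close>

lemma witt_scale_eq: "witt_scale = pm_scale"
  by (simp add: fun_eq_iff witt_scale_def pm_scale_def)

lemma witt_bracket_eq:
  "witt_bracket n x y = linear_extension (\<lambda>a. linear_extension
     (\<lambda>b. pm_scale (of_int (fst b - fst a)) (witt_e n (fst a + fst b) (snd a + snd b))) y) x"
  unfolding witt_bracket_def linear_extension_def witt_scale_eq pm_scale_sum
  by (intro sum.cong refl) (auto simp: pm_scale_scale mult.assoc intro!: sum.cong)

lemma witt_bracket_add_left: "witt_bracket n (x + x') y = witt_bracket n x y + witt_bracket n x' y"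
  by (simp add: witt_bracket_eq linear_extension_add)

lemma witt_bracket_scale_left: "witt_bracket n (pm_scale c x) y = pm_scale c (witt_bracket n x y)"
  by (simp add: witt_bracket_eq linear_extension_scale)

lemma witt_bracket_add_right: "witt_bracket n x (y + y') = witt_bracket n x y + witt_bracket n x y'"
  unfolding witt_bracket_eq linear_extension_add
  by (simp add: linear_extension_def[of _ x] pm_scale_distribs sum.distrib)

lemma witt_bracket_scale_right: "witt_bracket n x (pm_scale c y) = pm_scale c (witt_bracket n x y)"
  unfolding witt_bracket_eq linear_extension_scale
  by (simp add: linear_extension_def[of _ x] pm_scale_sum pm_scale_scale mult.commute)

lemma witt_bracket_diff_left: "witt_bracket n (x - x') y = witt_bracket n x y - witt_bracket n x' y"
  by (metis add_diff_cancel diff_add_cancel witt_bracket_add_left)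

lemma witt_bracket_zero [simp]: "witt_bracket n 0 y = 0" "witt_bracket n x 0 = 0"
  using witt_bracket_scale_left[of n 0 0 y] witt_bracket_scale_right[of n x 0 0] by simp_all

lemmas witt_bracket_bilinear =
  witt_bracket_add_left witt_bracket_add_right witt_bracket_scale_left witt_bracket_scale_right

text \<open>The type argument carries the field and hence p, which cannot be read off from the other
  arguments.\<close>

definition in_range :: "'k::field itself \<Rightarrow> nat \<Rightarrow> int \<Rightarrow> nat \<Rightarrow> bool" where
  "in_range T n i k \<longleftrightarrow> -1 \<le> i \<and> i \<le> int CHAR('k) - 2 \<and> k \<le> n"

lemma witt_e_eq:
  "(witt_e n i k :: 'k::field witt) = (if in_range TYPE('k) n i k then single (i, k) 1 else 0)"
  by (simp add: witt_e_def in_range_def)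

lemma witt_bracket_e:
  assumes "in_range TYPE('k::field) n i k" "in_range TYPE('k) n j m"
  shows "witt_bracket n (witt_e n i k) (witt_e n j m) =
    pm_scale (of_int (j - i)) (witt_e n (i + j) (k + m) :: 'k witt)"
  using assms by (simp add: witt_bracket_eq witt_e_eq)

lemma witt_filt_zero [simp]: "0 \<in> witt_filt n i"
  by (simp add: witt_filt_def)

lemma witt_filt_add: "x \<in> witt_filt n i \<Longrightarrow> y \<in> witt_filt n i \<Longrightarrow> x + y \<in> witt_filt n i"
  unfolding witt_filt_def using Poly_Mapping.keys_add[of x y] by blast

lemma witt_filt_scale: "x \<in> witt_filt n i \<Longrightarrow> pm_scale c x \<in> witt_filt n i"
  unfolding witt_filt_def using keys_pm_scale[of c x] by blast

lemma witt_filt_mono: "i \<le> j \<Longrightarrow> witt_filt n j \<subseteq> witt_filt n i"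
  unfolding witt_filt_def by auto

lemma witt_e_in_filt: "i \<le> j \<Longrightarrow> witt_e n j k \<in> witt_filt n i"
  by (auto simp: witt_filt_def witt_e_def)

lemma witt_e_in_space: "witt_e n j k \<in> witt_filt n (-1)"
  by (auto simp: witt_filt_def witt_e_def)

lemma witt_filt_induct [consumes 2, case_names zero e scale add]:
  fixes x :: "'k::field witt"
  assumes x: "x \<in> witt_filt n i" and i: "-1 \<le> i" and zero: "P 0"
    and e: "\<And>j k. i \<le> j \<Longrightarrow> in_range TYPE('k) n j k \<Longrightarrow> P (witt_e n j k)"
    and scale: "\<And>c y. y \<in> witt_filt n i \<Longrightarrow> P y \<Longrightarrow> P (pm_scale c y)"
    and add: "\<And>y z. y \<in> witt_filt n i \<Longrightarrow> z \<in> witt_filt n i \<Longrightarrow> P y \<Longrightarrow> P z \<Longrightarrow> P (y + z)"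
  shows "P x"
proof -
  have "keys x \<subseteq> {i..int CHAR('k) - 2} \<times> {..n}"
    using x by (simp add: witt_filt_def)
  then have "P x \<and> x \<in> witt_filt n i"
  proof (induction x rule: poly_mapping_keys_induct)
    case (single b a)
    obtain j k where b: "b = (j, k)" by fastforce
    then have *: "i \<le> j" "in_range TYPE('k) n j k"
      using single i by (auto simp: in_range_def)
    then have "single b a = pm_scale a (witt_e n j k)"
      by (simp add: b witt_e_eq)
    then show ?case
      using * e scale witt_e_in_filt witt_filt_scale by metis
  qed (auto simp: zero intro: add witt_filt_add)
  then show ?thesis ..
qed

lemmas witt_space_induct =
  witt_filt_induct[OF _ order_refl, consumes 1, case_names zero e scale add]

lemma witt_bracket_antisym: "witt_bracket n x y = - witt_bracket n y x"
proof (induction x rule: poly_mapping_sum_induct)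
  case (single a c)
  show ?case
  proof (induction y rule: poly_mapping_sum_induct)
    case (single b d)
    show ?case
      by (simp add: witt_bracket_eq pm_scale_scale add.commute mult.commute
          flip: pm_scale_distribs(6)) (simp add: algebra_simps)
  qed (simp_all add: witt_bracket_bilinear)
qed (simp_all add: witt_bracket_bilinear)

text \<open>The delicate case is a = -1 with b + c = p - 1: the inner bracket is zero by truncation,
  while the basis vector e_(p-2) on the right need not vanish. There the coefficient b + c - a
  equals p, so the closed form survives the truncation.\<close>

lemma witt_double_bracket_e:
  fixes n :: nat
  assumes r: "in_range TYPE('k::field) n a k" "in_range TYPE('k) n b l" "in_range TYPE('k) n c m"
  shows "witt_bracket n (witt_e n a k) (witt_bracket n (witt_e n b l) (witt_e n c m)) =
    pm_scale (of_int ((c - b) * (b + c - a))) (witt_e n (a + b + c) (k + l + m) :: 'k witt)"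
proof (cases "in_range TYPE('k) n (b + c) (l + m)")
  case True
  then show ?thesis
    using r by (simp add: witt_bracket_e witt_bracket_scale_right pm_scale_scale add.assoc)
next
  case False
  then have "l + m > n \<or> c - b = 0 \<or> a + b + c > int CHAR('k) - 2 \<or> b + c - a = int CHAR('k)"
    using r unfolding in_range_def by arith
  then consider "l + m > n" | "c - b = 0" | "a + b + c > int CHAR('k) - 2" | "b + c - a = int CHAR('k)"
    by blast
  then have "pm_scale (of_int ((c - b) * (b + c - a))) (witt_e n (a + b + c) (k + l + m) :: 'k witt) = 0"
  proof cases
    case 4
    then have "of_int ((c - b) * (b + c - a)) = (0 :: 'k)"
      by (simp only: of_int_mult of_int_of_nat_eq of_nat_CHAR mult_zero_right)
    then show ?thesis
      by (simp del: of_int_mult of_int_diff of_int_add)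
  qed (auto simp: witt_e_eq in_range_def)
  moreover have "(witt_e n (b + c) (l + m) :: 'k witt) = 0"
    using False by (simp add: witt_e_eq)
  ultimately show ?thesis
    using r by (simp add: witt_bracket_e)
qed

text \<open>On basis vectors all three terms are multiples of the same vector, and the closed form
  of double brackets reduces the claim to (b-a)(c-a-b) = (c-b)(b+c-a) - (c-a)(a+c-b). Truncation has
  been dealt with in that closed form.\<close>

lemma witt_jacobi:
  fixes x y z :: "'k::field witt"
  assumes "x \<in> witt_filt n (-1)" "y \<in> witt_filt n (-1)" "z \<in> witt_filt n (-1)"
  shows "witt_bracket n (witt_bracket n x y) z =
    witt_bracket n x (witt_bracket n y z) - witt_bracket n y (witt_bracket n x z)"
proof -
  have base: "witt_bracket n (witt_bracket n (witt_e n a k) (witt_e n b l)) (witt_e n c m :: 'k witt) =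
      witt_bracket n (witt_e n a k) (witt_bracket n (witt_e n b l) (witt_e n c m)) -
      witt_bracket n (witt_e n b l) (witt_bracket n (witt_e n a k) (witt_e n c m))"
    if r: "in_range TYPE('k) n a k" "in_range TYPE('k) n b l" "in_range TYPE('k) n c m" for a b c k l m
  proof -
    have "c + a + b = a + b + c" "b + a + c = a + b + c" "m + k + l = k + l + m" "l + k + m = k + l + m"
      by simp_all
    moreover have "(of_int (- ((b - a) * (a + b - c))) :: 'k) =
        of_int ((c - b) * (b + c - a)) - of_int ((c - a) * (a + c - b))"
      unfolding of_int_diff[symmetric] by (rule arg_cong[of _ _ of_int]) (simp add: algebra_simps)
    ultimately show ?thesis
      unfolding witt_bracket_antisym[of n "witt_bracket n (witt_e n a k) (witt_e n b l)"]
      by (simp only: witt_double_bracket_e[OF r] witt_double_bracket_e[OF r(3,1,2)]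
          witt_double_bracket_e[OF r(2,1,3)] flip: pm_scale_distribs(5,6) of_int_minus)
  qed
  show ?thesis
    using assms(1)
  proof (induction x rule: witt_space_induct)
    case (e a k)
    show ?case
      using assms(2)
    proof (induction y rule: witt_space_induct)
      case (e b l)
      show ?case
        using assms(3)
      proof (induction z rule: witt_space_induct)
        case (e c m)
        then show ?case
          using base \<open>in_range TYPE('k) n a k\<close> \<open>in_range TYPE('k) n b l\<close> by blast
      qed (simp_all add: witt_bracket_bilinear pm_scale_distribs)
    qed (simp_all add: witt_bracket_bilinear pm_scale_distribs)
  qed (simp_all add: witt_bracket_bilinear pm_scale_distribs)
qed

lemma witt_bracket_filt:
  fixes x y :: "'k::field witt"
  assumes "i \<in> {-1, 0}" "x \<in> witt_filt n i" "y \<in> witt_filt n i"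
  shows "witt_bracket n x y \<in> witt_filt n i"
proof -
  have i: "-1 \<le> i"
    using assms(1) by auto
  show ?thesis
    using assms(2) i
  proof (induction x rule: witt_filt_induct)
    case (e a k)
    note a = e
    show ?case
      using assms(3) i
    proof (induction y rule: witt_filt_induct)
      case (e b l)
      have "witt_e n (a + b) (k + l) \<in> (witt_filt n i :: 'k witt set)"
      proof (cases "i = 0")
        case True
        then show ?thesis
          using a e by (intro witt_e_in_filt) auto
      next
        case False
        then show ?thesis
          using assms(1) witt_e_in_space by auto
      qed
      then show ?case
        using a e by (simp add: witt_bracket_e witt_filt_scale)
    qed (simp_all add: witt_bracket_bilinear witt_filt_add witt_filt_scale)
  qed (simp_all add: witt_bracket_bilinear witt_filt_add witt_filt_scale)
qed

lemmas witt_bracket_space = witt_bracket_filt[of "-1", simplified]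

lemma lookup_witt_bracket_e_right:
  fixes x :: "'k::field witt"
  assumes x: "x \<in> witt_filt n (-1)" and r: "in_range TYPE('k) n j 0" "in_range TYPE('k) n i k" "in_range TYPE('k) n (i - j) k"
  shows "lookup (witt_bracket n x (witt_e n j 0)) (i, k) =
    of_int (j - (i - j)) * lookup x (i - j, k)"
  using x
proof (induction x rule: witt_space_induct)
  case (e a m)
  then show ?case
    using r unfolding witt_bracket_e[OF e(2) r(1)]
    by (auto simp: witt_e_eq lookup_single when_def in_range_def)
next
  case (scale c y)
  then show ?case
    by (simp only: witt_bracket_bilinear lookup_pm_scale mult.left_commute)
next
  case (add y z)
  then show ?case
    by (simp only: witt_bracket_bilinear lookup_add distrib_left)
qed simp

text \<open>Bracketing with e_0 multiplies the coefficient of e_i t^k by -i, which is nonzero in the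
  field unless i = 0; bracketing with e_(-1) recovers the coefficients of the e_0 t^k. The trivial
  centre is what makes a p-map on W_n unique.\<close>

lemma witt_centerless:
  fixes x :: "'k::field witt"
  assumes p: "CHAR('k) > 2" and x: "x \<in> witt_filt n (-1)"
    and c: "\<And>y. y \<in> witt_filt n (-1) \<Longrightarrow> witt_bracket n x y = 0"
  shows "x = 0"
proof (rule poly_mapping_eqI)
  fix b :: "int \<times> nat"
  obtain i k where b: "b = (i, k)" by fastforce
  show "lookup x b = lookup 0 b"
  proof (cases "in_range TYPE('k) n i k")
    case False
    then have "b \<notin> keys x"
      using x by (auto simp: b witt_filt_def in_range_def)
    then show ?thesis
      by (simp add: in_keys_iff)
  next
    case True
    have r: "in_range TYPE('k) n 0 0" "in_range TYPE('k) n (-1) 0"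
      using p by (auto simp: in_range_def)
    show ?thesis
    proof (cases "i = 0")
      case False
      have "\<not> int CHAR('k) dvd i"
        using p True False by (auto simp: in_range_def dest!: dvd_imp_le_int)
      then have "of_int (- i) \<noteq> (0::'k)"
        by (simp add: of_int_eq_0_iff_char_dvd)
      moreover have "of_int (- i) * lookup x (i, k) = 0"
        using lookup_witt_bracket_e_right[OF x r(1) True] True c[OF witt_e_in_space] by simp
      ultimately show ?thesis
        by (simp add: b)
    next
      case i0: True
      have "in_range TYPE('k) n (-1) k" "in_range TYPE('k) n (-1 - -1) k"
        using True i0 by (auto simp: in_range_def)
      from lookup_witt_bracket_e_right[OF x r(2) this] c[OF witt_e_in_space]
      show ?thesis
        by (simp add: b i0)
    qed
  qed
qed

section \<open>Powers of ad x and the p-map of W_n\<close>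

lemma of_int_power_CHAR:
  assumes "prime CHAR('k::field)"
  shows "(of_int j :: 'k) ^ CHAR('k) = of_int j"
proof (induction j rule: int_induct[of _ 0])
  case (step1 i)
  then show ?case
    by (simp add: freshmans_dream[OF assms refl])
next
  case (step2 i)
  have "((of_int (i - 1) :: 'k) + 1) ^ CHAR('k) = of_int (i - 1) ^ CHAR('k) + 1"
    by (simp only: freshmans_dream[OF assms refl] power_one)
  then show ?case
    using step2 by (simp add: algebra_simps)
qed (use prime_gt_0_nat[OF assms] in simp)

definition ad_endo :: "nat \<Rightarrow> 'k::field witt \<Rightarrow> (int \<times> nat, 'k) endo" where
  "ad_endo n x = basis_endo (\<lambda>b. witt_bracket n x (single b 1))"

lemma app_ad_endo: "app (ad_endo n x) y = witt_bracket n x y"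
proof (induction y rule: poly_mapping_sum_induct)
  case (single b a)
  have "single b a = pm_scale a (single b 1)"
    by simp
  then show ?case
    by (simp only: app_scale witt_bracket_scale_right) (simp add: ad_endo_def)
qed (simp_all add: app_add witt_bracket_add_right)

text \<open>The classical route to a p-map. In a Lie algebra without centre at most one q satisfies
  ad q = (ad x)^p. The set of x that possess such a q is closed under scalars and, by Jacobson's
  formula, under sums, so basis vectors suffice.\<close>

definition witt_pth_power :: "nat \<Rightarrow> 'k::field witt \<Rightarrow> 'k witt \<Rightarrow> bool" where
  "witt_pth_power n x q \<longleftrightarrow> q \<in> witt_filt n (-1) \<and>
     (\<forall>y\<in>witt_filt n (-1). witt_bracket n q y = (witt_bracket n x ^^ CHAR('k)) y)"

lemma witt_pth_power_unique:
  assumes "CHAR('k::field) > 2" "witt_pth_power n x q" "witt_pth_power n x q'"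
  shows "q = (q' :: 'k witt)"
proof -
  have "q + pm_scale (-1) q' = 0"
  proof (rule witt_centerless[OF assms(1)])
    show "q + pm_scale (-1) q' \<in> witt_filt n (-1)"
      using assms(2,3) by (simp add: witt_pth_power_def witt_filt_add witt_filt_scale)
    fix y :: "'k witt"
    assume "y \<in> witt_filt n (-1)"
    then show "witt_bracket n (q + pm_scale (-1) q') y = 0"
      using assms(2,3) by (simp add: witt_pth_power_def witt_bracket_bilinear witt_bracket_diff_left pm_scale_distribs)
  qed
  then show ?thesis
    by (simp add: pm_scale_distribs)
qed

text \<open>The Jacobi identity is available only on the subspace W_n of the ambient type, so the
  adjoint action is a representation on an invariant subspace.\<close>

lemma lie_rep_on_ad:
  assumes "prime CHAR('k::field)"
  shows "lie_rep_on (witt_filt n (-1)) pm_scale (witt_bracket n) (ad_endo n) (witt_filt n (-1) :: 'k witt set)"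
  by unfold_locales
    (auto intro!: app_eqI witt_filt_add witt_filt_scale witt_bracket_space assms
      simp: app_ad_endo app_commutator witt_bracket_bilinear witt_jacobi)

lemma witt_pth_power_scale:
  fixes x :: "'k::field witt"
  assumes "witt_pth_power n x q"
  shows "witt_pth_power n (pm_scale c x) (pm_scale (c ^ CHAR('k)) q)"
proof -
  have "(witt_bracket n (pm_scale c x) ^^ m) y = pm_scale (c ^ m) ((witt_bracket n x ^^ m) y)" for m y
    by (induction m) (simp_all add: witt_bracket_bilinear pm_scale_scale mult.commute)
  then show ?thesis
    using assms by (simp add: witt_pth_power_def witt_filt_scale witt_bracket_bilinear)
qed

lemma witt_pth_power_add:
  fixes x y :: "'k::field witt"
  assumes p: "prime CHAR('k)" and xy: "x \<in> witt_filt n (-1)" "y \<in> witt_filt n (-1)"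
    and q: "witt_pth_power n x q" "witt_pth_power n y q'"
  shows "witt_pth_power n (x + y)
    (q + q' + (\<Sum>i=1..<CHAR('k). jacobson_s pm_scale (witt_bracket n) i x y))"
proof -
  interpret lie_rep_on "witt_filt n (-1)" pm_scale "witt_bracket n" "ad_endo n" "witt_filt n (-1) :: 'k witt set"
    by (rule lie_rep_on_ad[OF p])
  have ad: "app (ad_endo n z) = witt_bracket n z" for z :: "'k witt"
    by (simp add: fun_eq_iff app_ad_endo)
  have "(\<Sum>i=1..<CHAR('k). jacobson_s pm_scale (witt_bracket n) i x y) \<in> witt_filt n (-1)"
    by (intro L_sum jacobson_s_closed xy)
  then show ?thesis
    using q app_jacobson[OF xy] by (simp add: witt_pth_power_def app_power ad witt_filt_add witt_bracket_bilinear)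
qed

lemma witt_ad_power_e:
  fixes n :: nat
  assumes "in_range TYPE('k::field) n i k" "in_range TYPE('k) n j l"
  shows "\<exists>c. (witt_bracket n (witt_e n i k) ^^ m) (witt_e n j l) = pm_scale c (witt_e n (j + int m * i) (l + m * k) :: 'k witt)"
proof (induction m)
  case (Suc m)
  then obtain c where c: "(witt_bracket n (witt_e n i k) ^^ m) (witt_e n j l) = pm_scale c (witt_e n (j + int m * i) (l + m * k) :: 'k witt)"
    by blast
  show ?case
  proof (cases "in_range TYPE('k) n (j + int m * i) (l + m * k)")
    case True
    have eq: "j + int (Suc m) * i = i + (j + int m * i)" "l + Suc m * k = k + (l + m * k)"
      by (simp_all add: algebra_simps)
    have "(witt_bracket n (witt_e n i k) ^^ Suc m) (witt_e n j l) =
        pm_scale c (witt_bracket n (witt_e n i k) (witt_e n (j + int m * i) (l + m * k)) :: 'k witt)"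
      using c by (simp add: witt_bracket_bilinear)
    then show ?thesis
      unfolding eq witt_bracket_e[OF assms(1) True] pm_scale_scale by blast
  next
    case False
    then show ?thesis
      using c by (auto simp: witt_e_eq intro!: exI[of _ 0])
  qed
qed (auto intro: exI[of _ 1])

lemma witt_ad_power_e0:
  fixes n :: nat
  assumes "in_range TYPE('k::field) n 0 k" "in_range TYPE('k) n j l"
  shows "(witt_bracket n (witt_e n 0 k) ^^ m) (witt_e n j l) = pm_scale (of_int j ^ m) (witt_e n j (l + m * k) :: 'k witt)"
proof (induction m)
  case (Suc m)
  show ?case
  proof (cases "in_range TYPE('k) n j (l + m * k)")
    case True
    then show ?thesis
      using Suc witt_bracket_e[OF assms(1) True]
      by (simp add: witt_bracket_bilinear pm_scale_scale algebra_simps)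
  next
    case False
    then have "\<not> in_range TYPE('k) n j (l + Suc m * k)"
      using assms(2) by (auto simp: in_range_def)
    then show ?thesis
      using Suc False by (simp add: witt_e_eq)
  qed
qed simp

text \<open>For i = 0 each bracket multiplies by j, and j^p = j in the field. For i nonzero, p
  brackets move the index from j to j + pi, which is out of range: below -1 if i = -1, above p - 2
  if i > 0.\<close>

lemma witt_pth_power_e:
  fixes n :: nat
  assumes p: "prime CHAR('k::field)" and r: "in_range TYPE('k) n i k"
  shows "witt_pth_power n (witt_e n i k) (if i = 0 then witt_e n 0 (k * CHAR('k)) else 0 :: 'k witt)"
proof -
  have "(witt_bracket n (witt_e n i k) ^^ CHAR('k)) y =
      witt_bracket n (if i = 0 then witt_e n 0 (k * CHAR('k)) else 0) y" if "y \<in> witt_filt n (-1)" for y :: "'k witt"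
    using that
  proof (induction y rule: witt_space_induct)
    case zero
    have "(witt_bracket n (witt_e n i k) ^^ m) 0 = (0 :: 'k witt)" for m
      by (induction m) auto
    then show ?case by simp
  next
    case (e j l)
    show ?case
    proof (cases "i = 0")
      case True
      have "witt_bracket n (witt_e n 0 (k * CHAR('k))) (witt_e n j l) =
          pm_scale (of_int j) (witt_e n j (l + CHAR('k) * k) :: 'k witt)"
      proof (cases "k * CHAR('k) \<le> n")
        case True
        then have "in_range TYPE('k) n 0 (k * CHAR('k))"
          using r \<open>i = 0\<close> by (simp add: in_range_def)
        then show ?thesis
          using e by (simp add: witt_bracket_e algebra_simps)
      qed (simp add: witt_e_eq in_range_def algebra_simps)
      then show ?thesis
        using witt_ad_power_e0[OF r[unfolded True] e(2), of "CHAR('k)"] True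
        by (simp add: of_int_power_CHAR[OF p])
    next
      case False
      have "int CHAR('k) > 0"
        using prime_gt_0_nat[OF p] by simp
      then have "\<not> in_range TYPE('k) n (j + int CHAR('k) * i) (l + CHAR('k) * k)"
      proof (cases "i = -1")
        case False
        then have "i \<ge> 1"
          using \<open>i \<noteq> 0\<close> r by (auto simp: in_range_def)
        then have "int CHAR('k) * 1 \<le> int CHAR('k) * i"
          by (intro mult_left_mono) auto
        then show ?thesis
          using e(1) unfolding in_range_def mult_1_right by linarith
      qed (use e in \<open>auto simp: in_range_def\<close>)
      then show ?thesis
        using witt_ad_power_e[OF r e(2), of "CHAR('k)"] False by (auto simp: witt_e_eq)
    qed
  next
    case (scale c y)
    have "(witt_bracket n (witt_e n i k) ^^ m) (pm_scale c y) = pm_scale c ((witt_bracket n (witt_e n i k) ^^ m) y)" for m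
      by (induction m) (simp_all add: witt_bracket_bilinear)
    then show ?case
      using scale by (simp add: witt_bracket_bilinear)
  next
    case (add y z)
    have "(witt_bracket n (witt_e n i k) ^^ m) (y + z) =
      (witt_bracket n (witt_e n i k) ^^ m) y + (witt_bracket n (witt_e n i k) ^^ m) z" for m
      by (induction m) (simp_all add: witt_bracket_bilinear)
    then show ?case
      using add by (simp add: witt_bracket_bilinear)
  qed
  then show ?thesis
    by (simp add: witt_pth_power_def witt_e_in_space)
qed

lemma witt_pth_power_exists:
  fixes x :: "'k::field witt"
  assumes p: "prime CHAR('k)" and x: "x \<in> witt_filt n (-1)"
  shows "\<exists>q. witt_pth_power n x q"
  using x
proof (induction x rule: witt_space_induct)
  case zero
  have "(witt_bracket n 0 ^^ CHAR('k)) y = (0 :: 'k witt)" for y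
    using prime_gt_0_nat[OF p] by (cases "CHAR('k)") auto
  then have "witt_pth_power n 0 (0 :: 'k witt)"
    by (simp add: witt_pth_power_def)
  then show ?case ..
next
  case (e j k)
  show ?case
    by (rule exI, rule witt_pth_power_e[OF p e(2)])
next
  case (scale c y)
  then obtain q where "witt_pth_power n y q" by blast
  then show ?case
    by (intro exI) (rule witt_pth_power_scale)
next
  case (add y z)
  then obtain q q' where "witt_pth_power n y q" "witt_pth_power n z q'" by blast
  then show ?case
    by (intro exI) (rule witt_pth_power_add[OF p add(1,2)])
qed

text \<open>Justifies the definite description. A candidate is assembled from p-th powers of ad x.
  It is unique because the axiom ad(x^[p]) = (ad x)^p determines the value at each x in W_n, and
  extensionality fixes the values elsewhere.\<close>

lemma witt_pmap_spec:
  assumes p: "CHAR('k::field) > 2"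
  shows "witt_pmap n \<in> extensional (witt_space n :: 'k witt set) \<and>
    is_pmap (witt_space n :: 'k witt set) witt_scale (witt_bracket n) (witt_pmap n) \<and>
     (\<forall>i\<in>{-1..int CHAR('k) - 2}. \<forall>k\<le>n.
        witt_pmap n (witt_e n i k :: 'k witt) = (if i = 0 then witt_e n i (k * CHAR('k)) else 0))"
proof -
  have prime: "prime CHAR('k)"
    using p by (intro prime_CHAR_semidom) simp
  note unique = witt_pth_power_unique[OF p]
  define P where "P = restrict (\<lambda>x. THE q. witt_pth_power n x q) (witt_filt n (-1) :: 'k witt set)"
  have P: "witt_pth_power n x (P x)" if x: "x \<in> witt_filt n (-1)" for x
  proof -
    obtain q where q: "witt_pth_power n x q"
      using witt_pth_power_exists[OF prime x] by blast
    then have "(THE q. witt_pth_power n x q) = q"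
      by (rule the_equality) (rule unique[OF _ q])
    then show ?thesis
      using q x by (simp add: P_def)
  qed
  let ?spec = "\<lambda>P. P \<in> extensional (witt_space n :: 'k witt set) \<and>
    is_pmap (witt_space n) witt_scale (witt_bracket n) P \<and>
     (\<forall>i\<in>{-1..int CHAR('k) - 2}. \<forall>k\<le>n.
        P (witt_e n i k) = (if i = 0 then witt_e n i (k * CHAR('k)) else 0))"
  have "?spec P"
  proof (intro conjI ballI allI impI)
    show "P \<in> extensional (witt_space n)"
      by (simp add: P_def witt_space_def)
    show "is_pmap (witt_space n) witt_scale (witt_bracket n) P"
      unfolding is_pmap_def witt_space_def witt_scale_eq
    proof (intro conjI ballI allI)
      fix x :: "'k witt" assume x: "x \<in> witt_filt n (-1)"
      show "P x \<in> witt_filt n (-1)"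
        using P[OF x] by (simp add: witt_pth_power_def)
      show "P (pm_scale c x) = pm_scale (c ^ CHAR('k)) (P x)" for c
        by (rule unique[OF P witt_pth_power_scale[OF P]]) (simp_all add: x witt_filt_scale)
      fix y :: "'k witt" assume y: "y \<in> witt_filt n (-1)"
      show "witt_bracket n (P x) y = (witt_bracket n x ^^ CHAR('k)) y"
        using P[OF x] y by (simp add: witt_pth_power_def)
      show "P (x + y) = P x + P y + (\<Sum>i=1..<CHAR('k). jacobson_s pm_scale (witt_bracket n) i x y)"
        by (rule unique[OF P witt_pth_power_add[OF prime x y P P]]) (simp_all add: x y witt_filt_add)
    qed
    fix i k assume "i \<in> {-1..int CHAR('k) - 2}" "k \<le> n"
    then have "witt_pth_power n (witt_e n i k) (if i = 0 then witt_e n 0 (k * CHAR('k)) else 0 :: 'k witt)"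
      by (intro witt_pth_power_e[OF prime]) (auto simp: in_range_def)
    from unique[OF P[OF witt_e_in_space] this]
    show "P (witt_e n i k) = (if i = 0 then witt_e n i (k * CHAR('k)) else 0)"
      by simp
  qed
  moreover have "P' = P" if "?spec P'" for P' :: "'k witt \<Rightarrow> 'k witt"
  proof
    fix x :: "'k witt"
    show "P' x = P x"
    proof (cases "x \<in> witt_filt n (-1)")
      case True
      have "witt_pth_power n x (P' x)"
        using that True unfolding is_pmap_def witt_space_def witt_pth_power_def by blast
      then show ?thesis
        using unique[OF _ P[OF True]] by blast
    next
      case False
      then show ?thesis
        using that by (simp add: P_def extensional_def witt_space_def)
    qed
  qed
  ultimately show ?thesis
    unfolding witt_pmap_def by (rule theI[of ?spec P])
qed

lemma witt_pmap_e:
  assumes "CHAR('k::field) > 2" "in_range TYPE('k) n i k"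
  shows "witt_pmap n (witt_e n i k :: 'k witt) = (if i = 0 then witt_e n 0 (k * CHAR('k)) else 0)"
  using witt_pmap_spec[OF assms(1)] assms(2) by (auto simp: in_range_def)

lemma witt_pmap_facts:
  fixes x y :: "'k::field witt"
  assumes p: "CHAR('k) > 2" and x: "x \<in> witt_filt n (-1)"
  shows "witt_pmap n x \<in> witt_filt n (-1)"
    "y \<in> witt_filt n (-1) \<Longrightarrow> witt_bracket n (witt_pmap n x) y = (witt_bracket n x ^^ CHAR('k)) y"
    "witt_pmap n (pm_scale c x) = pm_scale (c ^ CHAR('k)) (witt_pmap n x)"
    "y \<in> witt_filt n (-1) \<Longrightarrow> witt_pmap n (x + y) = witt_pmap n x + witt_pmap n y +
      (\<Sum>i=1..<CHAR('k). jacobson_s pm_scale (witt_bracket n) i x y)"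
proof -
  have "is_pmap (witt_filt n (-1)) pm_scale (witt_bracket n) (witt_pmap n :: 'k witt \<Rightarrow> 'k witt)"
    using witt_pmap_spec[OF p, of n] unfolding witt_space_def witt_scale_eq by blast
  note P = this[unfolded is_pmap_def]
  show "witt_pmap n x \<in> witt_filt n (-1)"
    using P x by blast
  show "y \<in> witt_filt n (-1) \<Longrightarrow> witt_bracket n (witt_pmap n x) y = (witt_bracket n x ^^ CHAR('k)) y"
    using P x by blast
  show "witt_pmap n (pm_scale c x) = pm_scale (c ^ CHAR('k)) (witt_pmap n x)"
    using P x by blast
  show "y \<in> witt_filt n (-1) \<Longrightarrow> witt_pmap n (x + y) = witt_pmap n x + witt_pmap n y +
      (\<Sum>i=1..<CHAR('k). jacobson_s pm_scale (witt_bracket n) i x y)"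
    using P x by blast
qed

text \<open>Jacobson's formula reduces the claim to basis vectors, since its correction terms are
  combinations of iterated brackets and stay in the subalgebra.\<close>

lemma witt_pmap_filt:
  fixes x :: "'k::field witt"
  assumes p: "CHAR('k) > 2" and i: "i \<in> {-1, 0}" and x: "x \<in> witt_filt n i"
  shows "witt_pmap n x \<in> witt_filt n i"
proof -
  have sub: "witt_filt n i \<subseteq> (witt_filt n (-1) :: 'k witt set)"
    using i by (intro witt_filt_mono) auto
  have adc: "ad_coeff (witt_bracket n) y z m j \<in> witt_filt n i"
    if "y \<in> witt_filt n i" "z \<in> witt_filt n i" for y z :: "'k witt" and m j
    using that i by (induction m arbitrary: j) (auto intro!: witt_filt_add witt_bracket_filt)
  have sum: "(\<Sum>j\<in>A. f j) \<in> witt_filt n i" if "\<And>j. j \<in> A \<Longrightarrow> f j \<in> witt_filt n i" for A and f :: "nat \<Rightarrow> 'k witt"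
    using that by (induction A rule: infinite_finite_induct) (auto intro: witt_filt_add)
  have i': "-1 \<le> i"
    using i by auto
  show ?thesis
    using x i'
  proof (induction x rule: witt_filt_induct)
    case zero
    have "witt_pmap n (pm_scale 0 0) = pm_scale (0 ^ CHAR('k)) (witt_pmap n (0 :: 'k witt))"
      by (rule witt_pmap_facts(3)[OF p]) simp
    then show ?case
      using p by (simp add: power_0_left)
  next
    case (e j k)
    then show ?case
      using i by (auto simp: witt_pmap_e[OF p] intro: witt_e_in_filt)
  next
    case (scale c y)
    then have "y \<in> witt_filt n (-1)"
      using sub by blast
    then show ?case
      using scale by (simp add: witt_pmap_facts(3)[OF p] witt_filt_scale)
  next
    case (add y z)
    then have yz: "y \<in> witt_filt n (-1)" "z \<in> witt_filt n (-1)"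
      using sub by blast+
    have "(\<Sum>j=1..<CHAR('k). jacobson_s pm_scale (witt_bracket n) j y z) \<in> witt_filt n i"
      unfolding jacobson_s_def by (intro sum witt_filt_scale adc add)
    then show ?case
      using add yz by (simp add: witt_pmap_facts(4)[OF p] witt_filt_add)
  qed
qed

section \<open>A model of the Verma modules by differential operators\<close>

lemma ad_coeff_commuting: "x * y = y * x \<Longrightarrow> ad_coeff commutator x y (Suc m) j = (0 :: 'a::ring_1)"
proof (induction m arbitrary: j)
  case (Suc m)
  have zero: "commutator z 0 = 0" for z :: 'a
    by (simp add: commutator_def)
  show ?case
    unfolding ad_coeff.simps(2)[of _ _ _ "Suc m"] Suc.IH[OF Suc.prems] by (simp add: zero)
qed (simp add: commutator_def)

text \<open>Jacobson's correction terms are iterated commutators of f and g. The version for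
  commuting elements of a noncommutative ring is required for operators, for series and for the free
  algebra.\<close>

lemma freshmans_dream_commuting:
  fixes f g :: "'a::ring_1" and s :: "'k::field \<Rightarrow> 'a"
  assumes "prime CHAR('k)" "of_nat CHAR('k) = (0::'a)" and comm: "f * g = g * f"
    and s: "s 1 = 1" "\<And>a b. s (a + b) = s a + s b" "\<And>a b. s (a * b) = s a * s b"
  shows "(f + g) ^ CHAR('k) = f ^ CHAR('k) + g ^ CHAR('k)"
proof -
  obtain m where "CHAR('k) - 1 = Suc m"
    using prime_gt_1_nat[OF assms(1)] by (metis Suc_diff_Suc One_nat_def)
  then have "ad_coeff commutator f g (CHAR('k) - 1) i = 0" for i
    using ad_coeff_commuting[OF comm] by simp
  then show ?thesis
    using jacobson_formula[OF assms(1,2) refl s, of f g] by simp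
qed

lemma lookup_mult_nat:
  "lookup (f * g) j = (\<Sum>b\<le>j. lookup f b * lookup g (j - b))"
  for f g :: "nat \<Rightarrow>\<^sub>0 'a::ring_1"
proof (induction f rule: poly_mapping_sum_induct)
  case (single k a)
  have "(\<Sum>b\<le>j. lookup (single k a) b * lookup g (j - b)) =
      (\<Sum>b\<le>j. if b = k then a * lookup g (j - b) else 0)"
    by (intro sum.cong) (auto simp: lookup_single when_def)
  then show ?case
    by (simp add: lookup_single_mult)
qed (simp_all add: distrib_right lookup_add sum.distrib)

lemma single_central:
  "single k 1 * f = f * single k 1" for f :: "nat \<Rightarrow>\<^sub>0 'a::ring_1"
  by (rule poly_mapping_eqI) (simp add: lookup_single_mult lookup_mult_single)

lemma single_left_commute:
  "f * (single k 1 * g) = single k 1 * (f * g)" for f g :: "nat \<Rightarrow>\<^sub>0 'a::ring_1"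
proof -
  have "f * (single k 1 * g) = f * single k 1 * g"
    by (simp only: mult.assoc)
  then show ?thesis
    unfolding single_central[of k f, symmetric] by (simp only: mult.assoc)
qed

lemma of_nat_left_commute: "z * (of_nat m * u) = of_nat m * (z * u)" for u z :: "'a::ring_1"
  by (metis mult.assoc mult_of_nat_commute)

lemma lookup_of_nat_mult:
  "lookup (of_nat m * f) j = of_nat m * lookup f j" for f :: "nat \<Rightarrow>\<^sub>0 'a::ring_1"
  by (induction m) (simp_all add: distrib_right lookup_add)

lemma commutator_mult: "commutator a (f * g) = commutator a f * g + f * commutator a g"
  by (simp add: commutator_def algebra_simps)

text \<open>
  The coefficient of \<open>T\<^sup>j\<close> in \<open>X\<^bsup>m\<^esup>T\<^sup>k\<close>, where \<open>X = \<Sum>X\<^sub>jT\<^sup>j\<close> is the generic element of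
  \<open>k[t]/(t\<^bsup>n+1\<^esup>)\<close>, yields the vector field by which \<open>e\<^bsub>m-1\<^esub>t\<^sup>k\<close> moves \<open>X\<close>.  The operator \<open>current_op m k\<close>
  quantises it: \<open>y\<^sub>j\<close> acts as the derivative with respect to \<open>X\<^sub>j\<close>, and the second summand is a
  multiple of the divergence.
\<close>

locale weyl_relations = scalar_hom s for s :: "'k::field \<Rightarrow> 'a::ring_1" +
  fixes X y :: "nat \<Rightarrow> 'a" and lam :: "nat \<Rightarrow> 'k" and n :: nat
  assumes prime: "prime CHAR('k)" and char: "of_nat CHAR('k) = (0::'a)"
    and XX: "X i * X j = X j * X i"
    and yy: "y i * y j = y j * y i"
    and yX: "commutator (y i) (X j) = (if i = j then 1 else 0)"
    and X_power: "X j ^ CHAR('k) = 0"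
begin

lemma s_left_commute: "z * (s c * u) = s c * (z * u)"
  by (metis mult.assoc s_central)

definition X_series :: "nat \<Rightarrow>\<^sub>0 'a" where
  "X_series = (\<Sum>j\<le>n. single j (X j))"

definition mono_series :: "nat \<Rightarrow> nat \<Rightarrow> nat \<Rightarrow>\<^sub>0 'a" where
  "mono_series m k = single k 1 * X_series ^ m"

definition y_part :: "(nat \<Rightarrow>\<^sub>0 'a) \<Rightarrow> 'a" where
  "y_part f = (\<Sum>j\<le>n. y j * lookup f j)"

definition lam_part :: "(nat \<Rightarrow>\<^sub>0 'a) \<Rightarrow> 'a" where
  "lam_part f = (\<Sum>j\<le>n. s (lam j) * lookup f j)"

definition current_op :: "nat \<Rightarrow> nat \<Rightarrow> 'a" where
  "current_op m k = y_part (mono_series m k) + of_nat m * lam_part (mono_series (m - 1) k)"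

text \<open>The terms X_j T^j commute, so Frobenius gives the p-th power term by term, and each
  X_j^p is zero.\<close>

lemma X_series_power_CHAR: "X_series ^ CHAR('k) = 0"
proof -
  have comm: "single i (X i) * single j (X j) =
      single j (X j) * single i (X i)" for i j
    by (simp add: mult_single XX add.commute)
  have pow: "single j (X j) ^ m = single (m * j) (X j ^ m)" for j m
    by (induction m) (simp_all add: mult_single)
  have q: "of_nat CHAR('k) = (0 :: nat \<Rightarrow>\<^sub>0 'a)"
    using char by (metis single_of_nat single_zero)
  have dream: "(f + g) ^ CHAR('k) = f ^ CHAR('k) + g ^ CHAR('k)" if "f * g = g * f" for f g :: "nat \<Rightarrow>\<^sub>0 'a"
    by (rule freshmans_dream_commuting[OF prime q that, of "\<lambda>c. single 0 (s c)"])
      (simp_all add: s_one s_add s_mult single_add mult_single)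
  have "(\<Sum>j<m. single j (X j)) ^ CHAR('k) = 0" for m
  proof (induction m)
    case (Suc m)
    have "(\<Sum>j<m. single j (X j)) * single m (X m) =
        single m (X m) * (\<Sum>j<m. single j (X j))"
      unfolding sum_distrib_left sum_distrib_right by (intro sum.cong refl comm)
    then show ?case
      using Suc by (simp add: dream pow X_power)
  qed (use prime_gt_0_nat[OF prime] in \<open>simp add: power_0_left\<close>)
  then show ?thesis
    unfolding X_series_def by (metis lessThan_Suc_atMost)
qed

lemma mono_series_mult: "mono_series m k * mono_series m' k' = mono_series (m + m') (k + k')"
proof -
  have "mono_series m k * mono_series m' k' =
      single k 1 * (X_series ^ m * single k' 1) * X_series ^ m'"
    by (simp add: mono_series_def mult.assoc)
  also have "\<dots> = single k 1 * single k' 1 * (X_series ^ m * X_series ^ m')"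
    unfolding single_central[of k' "X_series ^ m", symmetric] by (simp only: mult.assoc)
  also have "single k 1 * single k' 1 = (single (k + k') 1 :: nat \<Rightarrow>\<^sub>0 'a)"
    by (simp add: mult_single)
  finally show ?thesis
    by (simp only: mono_series_def power_add)
qed

lemma mono_series_commute:
  "lookup (mono_series m k) i * lookup (mono_series m' k') j =
   lookup (mono_series m' k') j * lookup (mono_series m k) i"
proof -
  have power: "lookup (X_series ^ m) i * z = z * lookup (X_series ^ m) i"
    if z: "\<And>j. X j * z = z * X j" for z m i
  proof (induction m arbitrary: i)
    case 0
    then show ?case by (simp add: lookup_one when_def)
  next
    case (Suc m)
    have X: "lookup X_series b * z = z * lookup X_series b" for b
      unfolding X_series_def lookup_sum sum_distrib_left sum_distrib_right
      by (intro sum.cong) (auto simp: lookup_single when_def z)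
    have "lookup X_series b * lookup (X_series ^ m) c * z =
        z * (lookup X_series b * lookup (X_series ^ m) c)" for b c
      using X Suc by (metis mult.assoc)
    then show ?case
      by (simp add: lookup_mult_nat sum_distrib_left sum_distrib_right)
  qed
  have "lookup (X_series ^ m) a * lookup (X_series ^ m') b =
      lookup (X_series ^ m') b * lookup (X_series ^ m) a" for a b
    by (rule power) (rule power[OF XX, symmetric])
  then show ?thesis
    by (simp add: mono_series_def lookup_single_mult)
qed

text \<open>As y_i acts by d/dX_i and the derivative of X(T) in X_i is T^i, the series T^k X^m has
  derivative m T^(k+i) X^(m-1); the factor T^i shifts the coefficient index by i.\<close>

lemma commutator_y_mono_series:
  assumes "i \<le> n"
  shows "commutator (y i) (lookup (mono_series m k) j) =
    of_nat m * (if i \<le> j then lookup (mono_series (m - 1) k) (j - i) else 0)"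
proof -
  let ?y = "single 0 (y i)"
  have lookup: "lookup (commutator ?y f) j = commutator (y i) (lookup f j)" for f :: "nat \<Rightarrow>\<^sub>0 'a" and j
    by (simp add: commutator_def lookup_minus lookup_single_mult lookup_mult_single)
  have X: "commutator ?y X_series = single i 1"
  proof (rule poly_mapping_eqI)
    fix j
    have "lookup X_series j = (if j \<le> n then X j else 0)"
      by (simp add: X_series_def lookup_sum lookup_single when_def)
    then show "lookup (commutator ?y X_series) j = lookup (single i 1) j"
      using assms by (auto simp: lookup yX lookup_single when_def) (auto simp: commutator_def)
  qed
  have power: "commutator ?y (X_series ^ m) = of_nat m * (single i 1 * X_series ^ (m - 1))" for m
  proof (induction m)
    case 0
    then show ?case by (simp add: commutator_def)
  next
    case (Suc m)
    have "X_series * (of_nat m * (single i 1 * X_series ^ (m - 1))) =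
        of_nat m * (single i 1 * (X_series * X_series ^ (m - 1)))"
      by (simp only: of_nat_left_commute[of X_series] single_left_commute[of X_series])
    also have "\<dots> = of_nat m * (single i 1 * X_series ^ m)"
      by (cases m) simp_all
    finally show ?case
      by (simp add: commutator_mult X Suc algebra_simps)
  qed
  have "commutator ?y (single k 1) = 0"
    unfolding commutator_def single_central[of k] by simp
  then have "commutator ?y (mono_series m k) =
      single k 1 * (of_nat m * (single i 1 * X_series ^ (m - 1)))"
    by (simp add: mono_series_def commutator_mult power)
  also have "\<dots> = of_nat m * (single i 1 * mono_series (m - 1) k)"
    unfolding mono_series_def of_nat_left_commute[of "single k 1"]
      single_left_commute[of "single k 1" i] ..
  finally have "commutator (y i) (lookup (mono_series m k) j) =
      lookup (of_nat m * (single i 1 * mono_series (m - 1) k)) j"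
    by (simp flip: lookup)
  also have "\<dots> = of_nat m * lookup (single i 1 * mono_series (m - 1) k) j"
    by (rule lookup_of_nat_mult)
  finally show ?thesis
    by (simp add: lookup_single_mult)
qed

text \<open>For i up to n the convolution involves only indices j up to i, so cutting the sum at n
  loses nothing. This is why working modulo t^(n+1) causes no error terms.\<close>

lemma convolution_mono_series:
  assumes "i \<le> n"
  shows "(\<Sum>j\<le>n. (if j \<le> i then lookup (mono_series m k) (i - j) else 0) *
      lookup (mono_series m' k') j) = lookup (mono_series (m + m') (k + k')) i"
proof -
  have "(\<Sum>j\<le>n. (if j \<le> i then lookup (mono_series m k) (i - j) else 0) *
      lookup (mono_series m' k') j) =
      (\<Sum>j\<le>i. lookup (mono_series m k) (i - j) * lookup (mono_series m' k') j)"
    using assms by (intro sum.mono_neutral_cong_right) auto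
  also have "\<dots> = lookup (mono_series m' k' * mono_series m k) i"
    unfolding lookup_mult_nat by (intro sum.cong refl mono_series_commute)
  finally show ?thesis
    by (simp add: mono_series_mult add.commute)
qed

text \<open>The bracket of two vector fields: the terms of second order in the y's cancel, because
  the y's commute with each other and so do the coefficients. The first-order terms are
  convolutions.\<close>

lemma commutator_y_parts:
  "commutator (y_part (mono_series m k)) (y_part (mono_series m' k')) =
    of_nat m' * y_part (mono_series (m + m' - 1) (k + k')) -
    of_nat m * y_part (mono_series (m + m' - 1) (k + k'))"
proof -
  define f g where "f = lookup (mono_series m k)" and "g = lookup (mono_series m' k')"
  define F G where "F i j = (if j \<le> i then lookup (mono_series (m - 1) k) (i - j) else 0)"
    and "G i j = (if j \<le> i then lookup (mono_series (m' - 1) k') (i - j) else 0)" for i j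
  have tm: "commutator (y i * f i) (y j * g j) =
      of_nat m' * (y j * (G j i * f i)) - of_nat m * (y i * (F i j * g j))" if "i \<le> n" "j \<le> n" for i j
  proof -
    have "commutator (y i) (g j) = of_nat m' * G j i" "commutator (y j) (f i) = of_nat m * F i j"
      unfolding f_def g_def F_def G_def by (rule commutator_y_mono_series; fact)+
    then have gy: "g j * y i = y i * g j - of_nat m' * G j i" and fy: "f i * y j = y j * f i - of_nat m * F i j"
      by (simp_all add: commutator_def algebra_simps)
    have fg: "f i * g j = g j * f i"
      unfolding f_def g_def by (rule mono_series_commute)
    have "commutator (y i * f i) (y j * g j) = y i * (f i * y j) * g j - y j * (g j * y i) * f i"
      by (simp add: commutator_def mult.assoc)
    also have "\<dots> = y i * (y j * f i) * g j - y i * (of_nat m * F i j) * g j -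
        (y j * (y i * g j) * f i - y j * (of_nat m' * G j i) * f i)"
      unfolding gy fy by (simp add: algebra_simps)
    also have "y i * (y j * f i) * g j = y j * (y i * g j) * f i"
      using yy[of i j] fg by (metis mult.assoc)
    also have "y i * (of_nat m * F i j) * g j = of_nat m * (y i * (F i j * g j))"
      by (simp only: of_nat_left_commute[of "y i"] mult.assoc)
    also have "y j * (of_nat m' * G j i) * f i = of_nat m' * (y j * (G j i * f i))"
      by (simp only: of_nat_left_commute[of "y j"] mult.assoc)
    finally show ?thesis
      by simp
  qed
  have "commutator (y_part (mono_series m k)) (y_part (mono_series m' k')) =
      (\<Sum>i\<le>n. \<Sum>j\<le>n. commutator (y i * f i) (y j * g j))"
    by (simp add: y_part_def commutator_sum_left commutator_sum_right f_def g_def) (rule sum.swap)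
  also have "\<dots> = (\<Sum>i\<le>n. \<Sum>j\<le>n. of_nat m' * (y j * (G j i * f i)) - of_nat m * (y i * (F i j * g j)))"
    by (intro sum.cong refl tm) auto
  also have "\<dots> = of_nat m' * (\<Sum>i\<le>n. \<Sum>j\<le>n. y j * (G j i * f i)) -
      of_nat m * (\<Sum>i\<le>n. \<Sum>j\<le>n. y i * (F i j * g j))"
    by (simp add: sum_subtractf sum_distrib_left)
  also have "(\<Sum>i\<le>n. \<Sum>j\<le>n. y j * (G j i * f i)) = (\<Sum>j\<le>n. \<Sum>i\<le>n. y j * (G j i * f i))"
    by (rule sum.swap)
  also have "of_nat m' * \<dots> = of_nat m' * y_part (mono_series (m + m' - 1) (k + k'))"
  \<comment> \<open>For m' = 0 the exponent m' - 1 is truncated to 0, and the factor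
    \<open>of_nat m'\<close> removes the term.\<close>
  proof (cases m')
    case (Suc c)
    have "(\<Sum>i\<le>n. G j i * f i) = lookup (mono_series (m + m' - 1) (k + k')) j" if "j \<le> n" for j
      using convolution_mono_series[OF that, of c k' m k] unfolding G_def f_def Suc diff_Suc_1 by (simp add: add.commute)
    then show ?thesis
      by (simp add: y_part_def flip: sum_distrib_left)
  qed simp
  also have "of_nat m * (\<Sum>i\<le>n. \<Sum>j\<le>n. y i * (F i j * g j)) = of_nat m * y_part (mono_series (m + m' - 1) (k + k'))"
  proof (cases m)
    case (Suc c)
    have "(\<Sum>j\<le>n. F i j * g j) = lookup (mono_series (m + m' - 1) (k + k')) i" if "i \<le> n" for i
      using convolution_mono_series[OF that, of c k m' k'] unfolding F_def g_def Suc diff_Suc_1 by simp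
    then show ?thesis
      by (simp add: y_part_def flip: sum_distrib_left)
  qed simp
  finally show ?thesis .
qed

text \<open>A vector field acts on a function by derivation: the coefficients of the field commute
  with the function, so only the derivative of the function remains.\<close>

lemma commutator_y_lam_part:
  "commutator (y_part (mono_series m k)) (lam_part (mono_series m' k')) =
    of_nat m' * lam_part (mono_series (m + m' - 1) (k + k'))"
proof -
  define f g where "f = lookup (mono_series m k)" and "g = lookup (mono_series m' k')"
  define G where "G i j = (if j \<le> i then lookup (mono_series (m' - 1) k') (i - j) else 0)" for i j
  have tm: "commutator (y i * f i) (s (lam j) * g j) = of_nat m' * (s (lam j) * (G j i * f i))"
    if "i \<le> n" "j \<le> n" for i j
  proof -
    have "commutator (y i) (g j) = of_nat m' * G j i"
      unfolding g_def G_def by (rule commutator_y_mono_series; fact)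
    moreover have "f i * g j = g j * f i"
      unfolding f_def g_def by (rule mono_series_commute)
    then have "y i * f i * g j = y i * g j * f i"
      by (simp only: mult.assoc)
    ultimately have "commutator (y i * f i) (g j) = of_nat m' * (G j i * f i)"
      by (simp add: commutator_def flip: mult.assoc left_diff_distrib)
    moreover have "commutator (y i * f i) (s (lam j) * g j) = s (lam j) * commutator (y i * f i) (g j)"
      by (simp add: commutator_def right_diff_distrib s_left_commute[of "y i"] s_left_commute[of "f i"] mult.assoc)
    ultimately show ?thesis
      by (simp add: of_nat_left_commute)
  qed
  have "commutator (y_part (mono_series m k)) (lam_part (mono_series m' k')) =
      (\<Sum>i\<le>n. \<Sum>j\<le>n. commutator (y i * f i) (s (lam j) * g j))"
    by (simp add: y_part_def lam_part_def commutator_sum_left commutator_sum_right f_def g_def) (rule sum.swap)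
  also have "\<dots> = (\<Sum>i\<le>n. \<Sum>j\<le>n. of_nat m' * (s (lam j) * (G j i * f i)))"
    by (intro sum.cong refl tm) auto
  also have "\<dots> = of_nat m' * (\<Sum>j\<le>n. \<Sum>i\<le>n. s (lam j) * (G j i * f i))"
    by (subst sum.swap) (simp add: sum_distrib_left)
  also have "\<dots> = of_nat m' * lam_part (mono_series (m + m' - 1) (k + k'))"
  proof (cases m')
    case (Suc c)
    have "(\<Sum>i\<le>n. G j i * f i) = lookup (mono_series (m + m' - 1) (k + k')) j" if "j \<le> n" for j
      using convolution_mono_series[OF that, of c k' m k] unfolding G_def f_def Suc diff_Suc_1 by (simp add: add.commute)
    then show ?thesis
      by (simp add: lam_part_def flip: sum_distrib_left)
  qed simp
  finally show ?thesis .
qed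

lemma commutator_lam_parts:
  "commutator (lam_part (mono_series m k)) (lam_part (mono_series m' k')) = 0"
proof -
  have "commutator (s c * lookup (mono_series m k) i) (s d * lookup (mono_series m' k') j) = 0"
    for c d i j
    using mono_series_commute[of m k i m' k' j] s_central unfolding commutator_def
    by (metis (no_types, lifting) diff_self mult.assoc)
  then show ?thesis
    by (simp add: lam_part_def commutator_sum_left commutator_sum_right)
qed

lemma commutator_of_nat_mult:
  "commutator (of_nat a * u) v = of_nat a * commutator u v"
  "commutator u (of_nat a * v) = of_nat a * commutator u (v :: 'a)"
  unfolding commutator_def right_diff_distrib
  by (metis mult.assoc mult_of_nat_commute)+

text \<open>The twisting terms contribute m'(m'-1) - m(m-1) = (m'-m)(m+m'-1). The factor m+m'-1 is
  the one that \<open>current_op\<close> of the bracket carries in front of its own twisting term,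
  so the twist is compatible with brackets.\<close>

theorem commutator_current_op:
  "commutator (current_op m k) (current_op m' k') =
    of_int (int m' - int m) * current_op (m + m' - 1) (k + k')"
proof -
  define M K where "M = m + m' - 1" and "K = k + k'"
  define A B where "A = y_part (mono_series M K)" and "B = lam_part (mono_series (M - 1) K)"
  have add: "commutator (u + v) w = commutator u w + commutator v w"
    "commutator w (u + v) = commutator w u + commutator w v"
    and anti: "commutator u v = - commutator v u" for u v w :: 'a
    by (simp_all add: commutator_def algebra_simps)
  have 1: "of_nat m' * commutator (y_part (mono_series m k)) (lam_part (mono_series (m' - 1) k')) =
      of_nat (m' * (m' - 1)) * B"
    unfolding commutator_y_lam_part B_def M_def K_def of_nat_mult mult.assoc
    by (cases "m' = 0") simp_all
  have "of_nat m * commutator (y_part (mono_series m' k')) (lam_part (mono_series (m - 1) k)) =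
      of_nat (m * (m - 1)) * B"
    unfolding commutator_y_lam_part B_def M_def K_def of_nat_mult mult.assoc
    by (cases "m = 0") (simp_all add: add.commute)
  then have 2: "of_nat m * commutator (lam_part (mono_series (m - 1) k)) (y_part (mono_series m' k')) =
      - (of_nat (m * (m - 1)) * B)"
    by (subst anti) simp
  have "commutator (current_op m k) (current_op m' k') =
      of_nat m' * A - of_nat m * A + of_nat (m' * (m' - 1)) * B - of_nat (m * (m - 1)) * B"
    unfolding current_op_def add unfolding commutator_of_nat_mult 1 2 commutator_lam_parts commutator_y_parts
    by (simp add: A_def M_def K_def)
  also have "\<dots> = of_int (int m' - int m) * A +
      of_int (int (m' * (m' - 1)) - int (m * (m - 1))) * B"
    by (simp add: algebra_simps del: of_nat_mult)
  also have "int (m' * (m' - 1)) - int (m * (m - 1)) = (int m' - int m) * int M"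
  proof -
    have "int (c * (c - 1)) = int c * int c - int c" for c
      by (cases c) (simp_all add: algebra_simps)
    moreover have "(int m' - int m) * int M = (int m' - int m) * (int m' + int m - 1)"
      by (cases "m = 0 \<and> m' = 0") (auto simp: M_def of_nat_diff)
    ultimately show ?thesis
      by (simp add: algebra_simps)
  qed
  finally show ?thesis
    by (simp add: current_op_def A_def B_def M_def K_def distrib_left mult.assoc)
qed

text \<open>From m = p on, the first summand contains X(T)^p; the second does so for m > p. For m =
  p the second contains only X(T)^(p-1), which need not vanish, but its factor m = p is
  zero.\<close>

lemma current_op_zero:
  assumes "CHAR('k) \<le> m \<or> n < k"
  shows "current_op m k = 0"
  using assms
proof
  assume m: "CHAR('k) \<le> m"
  have zero: "X_series ^ c = 0" if "CHAR('k) \<le> c" for c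
    using that X_series_power_CHAR by (metis le_add_diff_inverse mult_zero_left power_add)
  have "of_nat m * lam_part (mono_series (m - 1) k) = 0"
  proof (cases "m = CHAR('k)")
    case False
    then show ?thesis
      using m zero[of "m - 1"] by (simp add: mono_series_def lam_part_def)
  qed (simp add: char)
  then show ?thesis
    using zero[OF m] by (simp add: current_op_def mono_series_def y_part_def)
next
  assume "n < k"
  then show ?thesis
    by (simp add: current_op_def y_part_def lam_part_def mono_series_def lookup_single_mult)
qed

lemma current_op_0: "k \<le> n \<Longrightarrow> current_op 0 k = y k"
  by (simp add: current_op_def y_part_def mono_series_def lookup_single when_def
      sum.delta if_distrib[of "\<lambda>z. y _ * z"] cong: if_cong)

end

context weyl_relations
begin

text \<open>The shift by one records that e_i is the vector field with coefficient x^(i+1).\<close>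

definition current_rep :: "'k witt \<Rightarrow> 'a" where
  "current_rep x = (\<Sum>b\<in>keys x. s (lookup x b) * current_op (nat (fst b + 1)) (snd b))"

lemma current_rep_superset:
  assumes "finite S" "keys x \<subseteq> S"
  shows "current_rep x = (\<Sum>b\<in>S. s (lookup x b) * current_op (nat (fst b + 1)) (snd b))"
  unfolding current_rep_def using assms
  by (intro sum.mono_neutral_left) (auto simp: in_keys_iff s_zero)

lemma current_rep_add: "current_rep (x + x') = current_rep x + current_rep x'"
proof -
  let ?S = "keys x \<union> keys x'"
  have "finite ?S" "keys (x + x') \<subseteq> ?S"
    using Poly_Mapping.keys_add[of x x'] by auto
  then show ?thesis
    by (simp add: current_rep_superset[of ?S] lookup_add s_add sum.distrib distrib_right)
qed

lemma current_rep_zero [simp]: "current_rep 0 = 0"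
  by (simp add: current_rep_def)

lemma current_rep_scale: "current_rep (pm_scale c x) = s c * current_rep x"
  by (subst current_rep_superset[OF finite_keys keys_pm_scale])
    (simp add: current_rep_def sum_distrib_left s_mult mult.assoc)

lemma current_rep_e:
  "in_range TYPE('k) n i k \<Longrightarrow> current_rep (witt_e n i k) = current_op (nat (i + 1)) k"
  by (simp add: witt_e_eq current_rep_def s_one)

lemma s_of_nat: "s (of_nat m) = of_nat m"
  by (induction m) (simp_all add: s_add s_zero s_one)

lemma s_minus: "s (- c) = - s c"
  using s_add[of c "- c"] by (simp add: s_zero eq_neg_iff_add_eq_0 add.commute)

lemma s_of_int: "s (of_int i) = of_int i"
  by (cases i rule: int_cases2) (simp_all add: s_of_nat s_minus)

lemma current_rep_bracket:
  assumes "x \<in> witt_filt n (-1)" "x' \<in> witt_filt n (-1)"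
  shows "current_rep (witt_bracket n x x') = commutator (current_rep x) (current_rep x')"
proof -
  have add: "commutator (u + v) w = commutator u w + commutator v w"
    "commutator w (u + v) = commutator w u + commutator w v" for u v w :: 'a
    by (simp_all add: commutator_def algebra_simps)
  have scale: "commutator (s c * u) w = s c * commutator u w" "commutator w (s c * u) = s c * commutator w u"
    for c and u w :: 'a
    by (simp_all add: commutator_def right_diff_distrib s_left_commute[of w] mult.assoc)
  have zero: "commutator 0 w = 0" "commutator w 0 = 0" for w :: 'a
    by (simp_all add: commutator_def)
  show ?thesis
    using assms(1)
  proof (induction x rule: witt_space_induct)
    case (e i k)
    note ik = e
    show ?case
      using assms(2)
    proof (induction x' rule: witt_space_induct)
      case (e j l)
      have "commutator (current_rep (witt_e n i k)) (current_rep (witt_e n j l)) =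
          of_int (j - i) * current_op (nat (i + 1) + nat (j + 1) - 1) (k + l)"
        using ik e by (simp add: current_rep_e commutator_current_op)
      moreover have "current_rep (witt_bracket n (witt_e n i k) (witt_e n j l)) =
          of_int (j - i) * current_rep (witt_e n (i + j) (k + l))"
        using ik e by (simp only: witt_bracket_e current_rep_scale s_of_int)
      moreover have "of_int (j - i) * current_rep (witt_e n (i + j) (k + l)) =
          of_int (j - i) * current_op (nat (i + 1) + nat (j + 1) - 1) (k + l)"
      proof (cases "in_range TYPE('k) n (i + j) (k + l)")
        case True
        then have "nat (i + 1) + nat (j + 1) - 1 = nat (i + j + 1)"
          using ik e by (auto simp: in_range_def)
        then show ?thesis
          using True by (simp add: current_rep_e)
      next
        case False
        \<comment> \<open>A bracket leaves the range in three ways: i = j = -1, where the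
          coefficient is zero, i + j > p - 2, or k + l > n. In the last two cases the operator
          vanishes as well, by X(T)^p = 0 or by degree.\<close>
        then have "j - i = 0 \<or> CHAR('k) \<le> nat (i + 1) + nat (j + 1) - 1 \<or> n < k + l"
          using ik e unfolding in_range_def by arith
        then show ?thesis
        proof
          assume "CHAR('k) \<le> nat (i + 1) + nat (j + 1) - 1 \<or> n < k + l"
          then show ?thesis
            using False by (simp add: current_op_zero witt_e_eq)
        qed simp
      qed
      ultimately show ?case by simp
    qed (simp_all add: witt_bracket_bilinear current_rep_add current_rep_scale add scale zero)
  qed (simp_all add: witt_bracket_bilinear current_rep_add current_rep_scale add scale zero)
qed

end

section \<open>The Weyl operators on truncated polynomials\<close>

type_synonym multi_exp = "nat \<Rightarrow> nat"

text \<open>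
  Truncated polynomials in variables \<open>z\<^sub>0, z\<^sub>1, \<dots>\<close>.  Sending \<open>z\<^sub>j\<close> times a monomial to \<open>0\<close> whenever
  \<open>p\<close> divides the new exponent keeps the Weyl relation valid on all exponents.
\<close>

definition z_op :: "nat \<Rightarrow> (multi_exp, 'k::field) endo" where
  "z_op j = basis_endo (\<lambda>a. if CHAR('k) dvd Suc (a j) then 0 else single (a(j := Suc (a j))) 1)"

definition d_op :: "nat \<Rightarrow> (multi_exp, 'k::field) endo" where
  "d_op j = basis_endo (\<lambda>a. single (a(j := a j - 1)) (of_nat (a j)))"

lemma z_op_commute: "z_op i * z_op j = (z_op j * z_op i :: (multi_exp, 'k::field) endo)"
  by (rule endo_eqI) (auto simp: z_op_def fun_upd_twist)

lemma d_op_commute: "d_op i * d_op j = (d_op j * d_op i :: (multi_exp, 'k::field) endo)"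
  by (rule endo_eqI) (auto simp: d_op_def fun_upd_twist mult.commute)

text \<open>At an exponent with p | a_j + 1 the product d z is cut to zero, and -z d alone
  contributes the coefficient -a_j, which is 1 modulo p.\<close>

lemma commutator_d_op_z_op:
  "commutator (d_op i) (z_op j) = (if i = j then 1 else 0 :: (multi_exp, 'k::field) endo)"
proof (rule endo_eqI)
  fix a :: multi_exp
  have zero: "of_nat (Suc m) = (0 :: 'k) \<longleftrightarrow> CHAR('k) dvd Suc m" for m
    by (rule of_nat_eq_0_iff_char_dvd)
  have zero': "CHAR('k) dvd a j \<Longrightarrow> of_nat (a j) = (0 :: 'k)"
    by (simp add: of_nat_eq_0_iff_char_dvd)
  show "app (commutator (d_op i) (z_op j)) (single a 1) =
      app (if i = j then 1 else 0 :: (multi_exp, 'k) endo) (single a 1)"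
  proof (cases "i = j")
    case True
    have "single a (1 + of_nat (a j) :: 'k) = single a 1 + single a (of_nat (a j))"
      by (simp add: single_add)
    then show ?thesis
      using True zero[of "a j"] zero'
      by (cases "a j") (auto simp: app_commutator z_op_def d_op_def fun_upd_idem neg_eq_iff_add_eq_0 add.commute)
  next
    case False
    then show ?thesis
      by (auto simp: app_commutator z_op_def d_op_def fun_upd_twist)
  qed
qed

text \<open>Of the p successive factors a_j, a_j - 1, ... one is a multiple of p, namely the one at
  i = a_j mod p.\<close>

lemma d_op_power_CHAR:
  assumes "prime CHAR('k::field)"
  shows "d_op j ^ CHAR('k) = (0 :: (multi_exp, 'k) endo)"
proof (rule endo_eqI)
  fix a :: multi_exp
  have power: "app (d_op j ^ m) (single a 1) =
      single (a(j := a j - m)) (\<Prod>i<m. of_nat (a j - i) :: 'k)" for m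
  proof (induction m)
    case (Suc m)
    have d: "app (d_op j) (single b c) = single (b(j := b j - 1)) (c * of_nat (b j) :: 'k)" for b c
      by (simp add: d_op_def)
    have "app (d_op j ^ Suc m) (single a 1) =
        app (d_op j) (single (a(j := a j - m)) (\<Prod>i<m. of_nat (a j - i) :: 'k))"
      by (simp only: power_Suc app_simps Suc.IH)
    also have "\<dots> = single (a(j := a j - Suc m)) ((\<Prod>i<m. of_nat (a j - i)) * of_nat (a j - m))"
      unfolding d by (simp only: fun_upd_upd fun_upd_same diff_diff_left add.commute plus_1_eq_Suc)
    finally show ?case
      by (simp only: prod.lessThan_Suc)
  qed simp
  have "of_nat (a j - a j mod CHAR('k)) = (0 :: 'k)"
    unfolding of_nat_eq_0_iff_char_dvd by (rule dvd_minus_mod)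
  then have "(\<Prod>i<CHAR('k). of_nat (a j - i)) = (0 :: 'k)"
    using prime_gt_0_nat[OF assms] by (intro prod_zero) (auto intro!: bexI[of _ "a j mod CHAR('k)"])
  then show "app (d_op j ^ CHAR('k)) (single a 1) = app 0 (single a 1 :: multi_exp \<Rightarrow>\<^sub>0 'k)"
    by (simp only: power single_zero app_simps)
qed

definition box :: "nat \<Rightarrow> nat \<Rightarrow> multi_exp set" where
  "box p n = {a. \<forall>j. (j \<le> n \<longrightarrow> a j < p) \<and> (n < j \<longrightarrow> a j = 0)}"

text \<open>The finite-dimensional space of the model. The operators live on all exponents of the
  type, among them those from p on and those of variables beyond z_n; the Weyl relations are proved
  for all of them, the p-relations on this subspace.\<close>

definition box_space :: "nat \<Rightarrow> (multi_exp \<Rightarrow>\<^sub>0 'k::field) set" where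
  "box_space n = {f. keys f \<subseteq> box CHAR('k) n}"

lemma box_outside: "a \<in> box p n \<Longrightarrow> n < j \<Longrightarrow> a j = 0"
  by (simp add: box_def)

lemma finite_box: "finite (box p n)"
proof -
  have "box p n \<subseteq> {f. \<forall>x. (x \<in> {..n} \<longrightarrow> f x \<in> {..<p}) \<and> (x \<notin> {..n} \<longrightarrow> f x = 0)}"
    by (auto simp: box_def)
  then show ?thesis
    by (rule finite_subset) (intro finite_set_of_finite_funs; simp)
qed

lemma box_space_add: "f \<in> box_space n \<Longrightarrow> g \<in> box_space n \<Longrightarrow> f + g \<in> box_space n"
  unfolding box_space_def using Poly_Mapping.keys_add[of f g] by blast

lemma box_space_zero [simp]: "0 \<in> box_space n"
  by (simp add: box_space_def)

lemma box_space_scale: "f \<in> box_space n \<Longrightarrow> pm_scale c f \<in> box_space n"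
  unfolding box_space_def using keys_pm_scale[of c f] by blast

lemma box_space_uminus: "f \<in> box_space n \<Longrightarrow> - f \<in> box_space n"
  by (auto simp: box_space_def in_keys_iff)

lemma box_space_sum: "(\<And>i. i \<in> A \<Longrightarrow> f i \<in> box_space n) \<Longrightarrow> (\<Sum>i\<in>A. f i) \<in> box_space n"
  by (induction A rule: infinite_finite_induct) (auto intro: box_space_add)

lemma box_space_single: "a \<in> box CHAR('k) n \<Longrightarrow> single a c \<in> (box_space n :: (multi_exp \<Rightarrow>\<^sub>0 'k::field) set)"
  by (simp add: box_space_def)

lemma app_box_space:
  assumes "\<And>a. a \<in> box CHAR('k) n \<Longrightarrow> app \<phi> (single a 1) \<in> box_space n"
    and "f \<in> box_space n"
  shows "app \<phi> f \<in> (box_space n :: (multi_exp \<Rightarrow>\<^sub>0 'k::field) set)"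
proof -
  have "app \<phi> f = (\<Sum>b\<in>keys f. pm_scale (lookup f b) (app \<phi> (single b 1)))"
    by (subst poly_mapping_expansion[of f]) (simp only: app_sum app_scale)
  moreover have "b \<in> box CHAR('k) n" if "b \<in> keys f" for b
    using that assms(2) by (auto simp: box_space_def)
  ultimately show ?thesis
    using assms(1) by (auto intro!: box_space_sum box_space_scale)
qed

lemma z_op_box_space: "j \<le> n \<Longrightarrow> f \<in> box_space n \<Longrightarrow> app (z_op j) f \<in> (box_space n :: (multi_exp \<Rightarrow>\<^sub>0 'k::field) set)"
proof (rule app_box_space)
  fix a assume j: "j \<le> n" and a: "a \<in> box CHAR('k) n"
  then have "Suc (a j) < CHAR('k)" if "\<not> CHAR('k) dvd Suc (a j)"
  proof -
    have "a j < CHAR('k)"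
      using j a by (auto simp: box_def)
    moreover have "Suc (a j) \<noteq> CHAR('k)"
      using that by (metis dvd_refl)
    ultimately show ?thesis by linarith
  qed
  then show "app (z_op j) (single a 1) \<in> (box_space n :: (multi_exp \<Rightarrow>\<^sub>0 'k::field) set)"
    using a j by (auto simp: z_op_def box_def intro!: box_space_single)
qed

lemma d_op_box_space: "f \<in> box_space n \<Longrightarrow> app (d_op j) f \<in> (box_space n :: (multi_exp \<Rightarrow>\<^sub>0 'k::field) set)"
  by (rule app_box_space) (auto simp: d_op_def box_def less_imp_diff_less intro!: box_space_single)

text \<open>A nonconstant monomial of the box has some exponent between 1 and p - 1, which is
  invertible in the field. Without this bound the p-th powers of the variables would be killed
  too.\<close>

lemma d_ops_kernel:
  fixes f :: "multi_exp \<Rightarrow>\<^sub>0 'k::field"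
  assumes p: "prime CHAR('k)" and f: "f \<in> box_space n" and d: "\<And>j. j \<le> n \<Longrightarrow> app (d_op j) f = 0"
  shows "f = single (\<lambda>_. 0) (lookup f (\<lambda>_. 0))"
proof -
  have lookup: "lookup (app (d_op j) g) a = of_nat (Suc (a j)) * lookup g (a(j := Suc (a j)))"
    for g :: "multi_exp \<Rightarrow>\<^sub>0 'k" and a j
  proof (induction g rule: poly_mapping_sum_induct)
    case (single b c)
    show ?case
    proof (cases "b j = 0")
      case True
      then show ?thesis
        by (auto simp: d_op_def lookup_single when_def)
    next
      case False
      then have "b(j := b j - 1) = a \<longleftrightarrow> b = a(j := Suc (a j))"
        by (auto simp: fun_eq_iff)
      then show ?thesis
        using False by (auto simp: d_op_def lookup_single when_def mult.commute)
    qed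
  qed (simp_all add: app_add lookup_add distrib_left)
  have "lookup f a = 0" if a: "a \<noteq> (\<lambda>_. 0)" for a
  proof (cases "a \<in> box CHAR('k) n")
    case True
    then obtain j where j: "a j \<noteq> 0"
      using a by (auto simp: fun_eq_iff)
    then have jn: "j \<le> n"
      using box_outside[OF True, of j] by (cases "n < j") auto
    then have ap: "a j < CHAR('k)"
      using True by (simp add: box_def)
    have "of_nat (a j) * lookup f a = 0"
      using lookup[of j f "a(j := a j - 1)"] d[OF jn] j by simp
    moreover have "of_nat (a j) \<noteq> (0 :: 'k)"
      using j ap by (auto simp: of_nat_eq_0_iff_char_dvd dest: dvd_imp_le)
    ultimately show ?thesis by simp
  next
    case False
    then show ?thesis
      using f by (auto simp: box_space_def in_keys_iff subset_iff)
  qed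
  then show ?thesis
    by (intro poly_mapping_eqI) (auto simp: lookup_single when_def)
qed

lemma app_z_op_power:
  assumes "a j + m < CHAR('k::field)"
  shows "app (z_op j ^ m) (single a 1) = (single (a(j := a j + m)) 1 :: multi_exp \<Rightarrow>\<^sub>0 'k)"
  using assms
proof (induction m)
  case (Suc m)
  have IH: "app (z_op j ^ m) (single a 1) = (single (a(j := a j + m)) 1 :: multi_exp \<Rightarrow>\<^sub>0 'k)"
    by (rule Suc.IH) (use Suc.prems in linarith)
  have "\<not> CHAR('k) dvd Suc (a j + m)"
    using Suc.prems by (auto dest!: dvd_imp_le)
  then have "app (z_op j) (single (a(j := a j + m)) 1) =
      (single (a(j := Suc (a j + m))) 1 :: multi_exp \<Rightarrow>\<^sub>0 'k)"
    by (simp only: z_op_def app_basis_endo_single fun_upd_same fun_upd_upd if_False pm_scale_simps mult_1)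
  then show ?case
    by (simp only: power_Suc app_simps IH add_Suc_right)
qed simp

definition z_monomial :: "nat \<Rightarrow> multi_exp \<Rightarrow> (multi_exp, 'k::field) endo" where
  "z_monomial n a = prod_list (map (\<lambda>j. z_op j ^ a j) [0..<Suc n])"

text \<open>Exponents below p never meet the truncation in \<open>z_op\<close>, so the constant 1
  generates every basis vector of the box under the z_j.\<close>

lemma app_z_monomial:
  assumes "a \<in> box CHAR('k::field) n"
  shows "app (z_monomial n a) (single (\<lambda>_. 0) 1) = (single a 1 :: multi_exp \<Rightarrow>\<^sub>0 'k)"
proof -
  have *: "app (prod_list (map (\<lambda>j. z_op j ^ a j) [0..<N])) (single b 1) =
      (single (\<lambda>i. if i < N then a i else b i) 1 :: multi_exp \<Rightarrow>\<^sub>0 'k)"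
    if "\<And>j. j < N \<Longrightarrow> b j = 0" "N \<le> Suc n" for N b
    using that
  proof (induction N arbitrary: b)
    case (Suc N)
    have aN: "b N + a N < CHAR('k)"
      using Suc.prems assms by (simp add: box_def)
    have "app (prod_list (map (\<lambda>j. z_op j ^ a j) [0..<Suc N])) (single b 1) =
        app (prod_list (map (\<lambda>j. z_op j ^ a j) [0..<N])) (app (z_op N ^ a N) (single b 1) :: multi_exp \<Rightarrow>\<^sub>0 'k)"
      by simp
    also have "\<dots> = app (prod_list (map (\<lambda>j. z_op j ^ a j) [0..<N])) (single (b(N := b N + a N)) 1)"
      by (simp only: app_z_op_power[of b N "a N", OF aN])
    also have "\<dots> = single (\<lambda>i. if i < N then a i else (b(N := b N + a N)) i) 1"
      using Suc.prems by (intro Suc.IH) auto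
    also have "(\<lambda>i. if i < N then a i else (b(N := b N + a N)) i) = (\<lambda>i. if i < Suc N then a i else b i)"
      using Suc.prems by (auto simp: fun_eq_iff less_Suc_eq)
    finally show ?case .
  qed simp
  have "(\<lambda>i. if i < Suc n then a i else 0) = a"
    using assms by (auto simp: fun_eq_iff box_def)
  then show ?thesis
    unfolding z_monomial_def by (subst *) auto
qed

lemma commuting_prod_list_power:
  fixes c :: "'a::monoid_mult"
  assumes "\<And>j. j \<in> set js \<Longrightarrow> c * x j = x j * c"
  shows "c * prod_list (map (\<lambda>j. x j ^ a j) js) = prod_list (map (\<lambda>j. x j ^ a j) js) * c"
  using assms
proof (induction js)
  case (Cons j js)
  have "x j * c = c * x j"
    using Cons.prems by simp
  then have "c * x j ^ a j = x j ^ a j * c"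
    by (rule power_commuting_commutes[symmetric])
  moreover have "c * prod_list (map (\<lambda>j. x j ^ a j) js) = prod_list (map (\<lambda>j. x j ^ a j) js) * c"
    using Cons by simp
  ultimately show ?case
    by (simp only: list.map prod_list.Cons) (metis mult.assoc)
qed simp

lemma endo_zero_on_box_space:
  fixes \<phi> :: "(multi_exp, 'k::field) endo"
  assumes comm: "\<And>j. j \<le> n \<Longrightarrow> \<phi> * z_op j = z_op j * \<phi>"
    and vac: "app \<phi> (single (\<lambda>_. 0) 1) = 0" and f: "f \<in> box_space n"
  shows "app \<phi> f = 0"
proof -
  have "app \<phi> (single a 1) = 0" if "a \<in> box CHAR('k) n" for a
  proof -
    have "\<phi> * z_monomial n a = z_monomial n a * \<phi>"
      unfolding z_monomial_def using comm by (intro commuting_prod_list_power) auto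
    then have "app \<phi> (app (z_monomial n a) (single (\<lambda>_. 0) 1)) =
        app (z_monomial n a) (app \<phi> (single (\<lambda>_. 0) 1))"
      by (metis app_simps(6))
    then show ?thesis
      using that by (simp add: app_z_monomial vac)
  qed
  moreover have "a \<in> box CHAR('k) n" if "a \<in> keys f" for a
    using that f by (auto simp: box_space_def)
  moreover have "app \<phi> f = (\<Sum>a\<in>keys f. pm_scale (lookup f a) (app \<phi> (single a 1)))"
    by (subst poly_mapping_expansion[of f]) (simp only: app_sum app_scale)
  ultimately show ?thesis
    by simp
qed

section \<open>The linear form chi and the scalars chi_i\<close>

locale witt_character =
  fixes \<chi> :: "'k::alg_closed_field witt \<Rightarrow> 'k" and n :: nat
  assumes p_gt_3: "CHAR('k) > 3" and n_pos: "n \<ge> 1"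
    and \<chi>_linear: "linear_form (witt_space n) witt_scale \<chi>"
    and height: "witt_height n \<chi> = 1"
    and \<chi>_top: "\<chi> (witt_e n 0 n) \<noteq> 0"
begin

lemma prime: "prime CHAR('k)"
  using p_gt_3 by (intro prime_CHAR_semidom) simp

lemma p_gt_2: "CHAR('k) > 2"
  using p_gt_3 by simp

lemma \<chi>_add: "x \<in> witt_filt n (-1) \<Longrightarrow> y \<in> witt_filt n (-1) \<Longrightarrow> \<chi> (x + y) = \<chi> x + \<chi> y"
  and \<chi>_scale: "x \<in> witt_filt n (-1) \<Longrightarrow> \<chi> (pm_scale c x) = c * \<chi> x"
  using \<chi>_linear by (simp_all add: linear_form_def witt_space_def witt_scale_eq)

lemma \<chi>_zero: "\<chi> 0 = 0"
  using \<chi>_scale[of 0 0] by simp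

text \<open>A \<open>LEAST\<close> over the integers need not be attained. Substituting i = m - 1
  turns it into one over the natural numbers, and \<open>witt_filt n p\<close> = 0 provides the
  witness.\<close>

lemma \<chi>_filt_1:
  assumes "x \<in> witt_filt n 1"
  shows "\<chi> x = 0"
proof -
  define Q where "Q i \<longleftrightarrow> -1 \<le> i \<and> (\<forall>x\<in>witt_filt n i. \<chi> x = 0)" for i
  have "witt_filt n (int CHAR('k)) = ({0} :: 'k witt set)"
    by (auto simp: witt_filt_def)
  then have "Q (int (Suc CHAR('k)) - 1)"
    by (simp add: Q_def \<chi>_zero)
  then have ex: "Q (int (LEAST m. Q (int m - 1)) - 1)"
    by (rule LeastI)
  have "(LEAST i. Q i) = int (LEAST m. Q (int m - 1)) - 1"
  proof (rule Least_equality)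
    show "Q (int (LEAST m. Q (int m - 1)) - 1)"
      by (rule ex)
    fix i assume i: "Q i"
    then have "i = int (nat (i + 1)) - 1"
      by (simp add: Q_def)
    with i have "Q (int (nat (i + 1)) - 1)"
      by simp
    then have "(LEAST m. Q (int m - 1)) \<le> nat (i + 1)"
      by (rule Least_le)
    moreover have "int (nat (i + 1)) = i + 1"
      using i by (simp add: Q_def)
    ultimately show "int (LEAST m. Q (int m - 1)) - 1 \<le> i"
      by linarith
  qed
  then have "Q (LEAST i. Q i)"
    using ex by simp
  then have "Q 1"
    using height unfolding witt_height_def Q_def by simp
  then show ?thesis
    using assms by (simp add: Q_def)
qed

lemma frobenius_inj: "x ^ CHAR('k) = y ^ CHAR('k) \<Longrightarrow> x = (y :: 'k)"
proof -
  assume a: "x ^ CHAR('k) = y ^ CHAR('k)"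
  have "((x - y) + y) ^ CHAR('k) = (x - y) ^ CHAR('k) + y ^ CHAR('k)"
    by (rule freshmans_dream[OF prime refl])
  then show "x = y"
    using a by simp
qed

definition coeff_system :: "(nat \<Rightarrow> 'k) \<Rightarrow> bool" where
  "coeff_system c \<longleftrightarrow> c 0 = 0 \<and> (\<forall>m>n. c m = 0) \<and>
     (\<forall>i\<in>{1..n}. c i ^ CHAR('k) - c (i * CHAR('k)) = \<chi> (witt_e n 0 i) ^ CHAR('k))"

lemma less_times_p: "1 \<le> i \<Longrightarrow> i < i * CHAR('k)"
  using p_gt_3 by simp

text \<open>The system is triangular, because the equation for c_i involves c_(ip) with ip > i. It
  is solved from i = n downwards, each step taking a p-th root in the algebraically closed field; d
  counts the indices already treated.\<close>

lemma coeff_system_exists: "\<exists>c. coeff_system c"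
proof -
  have "\<exists>c. c 0 = 0 \<and> (\<forall>m>n. c m = 0) \<and>
      (\<forall>i\<in>{Suc (n - d)..n}. c i ^ CHAR('k) - c (i * CHAR('k)) = \<chi> (witt_e n 0 i) ^ CHAR('k))" if "d \<le> n" for d
    using that
  proof (induction d)
    case 0
    show ?case by (intro exI[of _ "\<lambda>_. 0"]) auto
  next
    case (Suc d)
    then obtain c where c: "c 0 = 0" "\<forall>m>n. c m = 0"
      "\<forall>i\<in>{Suc (n - d)..n}. c i ^ CHAR('k) - c (i * CHAR('k)) = \<chi> (witt_e n 0 i) ^ CHAR('k)"
      by auto
    define j where "j = n - d"
    have j: "1 \<le> j" "j \<le> n"
      using Suc.prems by (auto simp: j_def)
    obtain r where r: "r ^ CHAR('k) = c (j * CHAR('k)) + \<chi> (witt_e n 0 j) ^ CHAR('k)"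
      using nth_root_exists[of "CHAR('k)" "c (j * CHAR('k)) + \<chi> (witt_e n 0 j) ^ CHAR('k)"] p_gt_3 by auto
    \<comment> \<open>So changing c at j disturbs neither an equation already solved nor the term
      c_(jp) of the new one.\<close>
    have "i * CHAR('k) \<noteq> j" if "i \<ge> j" for i
      using less_times_p[of i] that j by auto
    then have "\<forall>i\<in>{j..n}. (c(j := r)) i ^ CHAR('k) - (c(j := r)) (i * CHAR('k)) = \<chi> (witt_e n 0 i) ^ CHAR('k)"
      using c(3) r by (auto simp: j_def)
    moreover have "Suc (n - Suc d) = j"
      using Suc.prems by (simp add: j_def)
    ultimately show ?case
      using c j by (intro exI[of _ "c(j := r)"]) auto
  qed
  from this[of n] show ?thesis
    by (auto simp: coeff_system_def)
qed

lemma coeff_systemD: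
  assumes "coeff_system c"
  shows "c 0 = 0" "n < m \<Longrightarrow> c m = 0"
    "1 \<le> i \<Longrightarrow> i \<le> n \<Longrightarrow> c i ^ CHAR('k) = c (i * CHAR('k)) + \<chi> (witt_e n 0 i) ^ CHAR('k)"
proof -
  show "c 0 = 0" "n < m \<Longrightarrow> c m = 0"
    using assms unfolding coeff_system_def by blast+
  assume "1 \<le> i" "i \<le> n"
  then have "c i ^ CHAR('k) - c (i * CHAR('k)) = \<chi> (witt_e n 0 i) ^ CHAR('k)"
    using assms unfolding coeff_system_def by (meson atLeastAtMost_iff)
  then show "c i ^ CHAR('k) = c (i * CHAR('k)) + \<chi> (witt_e n 0 i) ^ CHAR('k)"
    by (simp only: diff_eq_eq add.commute)
qed

text \<open>Downwards again, with n - i as measure: c_i^p is determined by a later entry, and p-th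
  roots are unique in characteristic p.\<close>

lemma coeff_system_unique:
  assumes "coeff_system c" "coeff_system c'"
  shows "c = c'"
proof
  fix i
  show "c i = c' i"
  proof (induction "n - i" arbitrary: i rule: less_induct)
    case less
    consider "i = 0" | "n < i" | "1 \<le> i" "i \<le> n"
      by linarith
    then show ?case
    proof cases
      case 3
      have "c (i * CHAR('k)) = c' (i * CHAR('k))"
      proof (cases "n < i * CHAR('k)")
        case True
        then show ?thesis
          by (simp only: coeff_systemD(2)[OF assms(1) True] coeff_systemD(2)[OF assms(2) True])
      next
        case False
        then have "n - i * CHAR('k) < n - i"
          using less_times_p[of i] 3 by linarith
        then show ?thesis
          by (rule less)
      qed
      then have "c i ^ CHAR('k) = c' i ^ CHAR('k)"
        by (simp only: coeff_systemD(3)[OF assms(1) 3] coeff_systemD(3)[OF assms(2) 3])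
      then show ?thesis
        by (rule frobenius_inj)
    next
      case 1
      then show ?thesis
        by (simp only: coeff_systemD(1)[OF assms(1)] coeff_systemD(1)[OF assms(2)])
    next
      case 2
      then show ?thesis
        by (simp only: coeff_systemD(2)[OF assms(1)] coeff_systemD(2)[OF assms(2)])
    qed
  qed
qed

lemma coeff_system_weight_coeffs: "coeff_system (weight_coeffs n \<chi>)"
proof -
  obtain c where c: "coeff_system c"
    using coeff_system_exists by blast
  have "weight_coeffs n \<chi> = (THE c. coeff_system c)"
    by (simp add: weight_coeffs_def coeff_system_def)
  also have "\<dots> = c"
    by (rule the_equality, rule c, rule coeff_system_unique[OF _ c])
  finally show ?thesis
    using c by simp
qed

lemmas weight_coeffs = coeff_systemD[OF coeff_system_weight_coeffs]

text \<open>Since np > n, the equation for i = n reads chi_n^p = chi(e_0 t^n)^p. This is where the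
  hypothesis on e_0 t^n enters.\<close>

lemma weight_coeffs_top: "weight_coeffs n \<chi> n \<noteq> 0"
proof
  assume "weight_coeffs n \<chi> n = 0"
  then have "\<chi> (witt_e n 0 n) ^ CHAR('k) = 0"
    using weight_coeffs(3)[OF n_pos order_refl] weight_coeffs(2)[OF less_times_p[OF n_pos]] p_gt_3
    by (simp add: power_0_left)
  then show False
    using \<chi>_top by simp
qed

end

lemma pm_scale_eq_zero:
  assumes "pm_scale c f = 0" "c \<noteq> 0"
  shows "f = 0"
proof -
  have "pm_scale (inverse c) (pm_scale c f) = 0"
    unfolding assms(1) by simp
  then show ?thesis
    using assms(2) by (simp add: pm_scale_scale)
qed

context witt_character
begin

lemma weight_form_e:
  assumes "in_range TYPE('k) n i k" "0 \<le> i"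
  shows "weight_form n \<chi> l (witt_e n i k) =
    (if i = 0 then if k = 0 then l else weight_coeffs n \<chi> k else 0)"
  using assms
  by (cases "k = 0") (auto simp: weight_form_def witt_e_eq lookup_single when_def in_range_def
      if_distrib[of "\<lambda>z. z * _"] cong: if_cong)

lemma weight_form_add: "weight_form n \<chi> l (x + y) = weight_form n \<chi> l x + weight_form n \<chi> l y"
  by (simp add: weight_form_def lookup_add algebra_simps sum.distrib)

lemma weight_form_scale: "weight_form n \<chi> l (pm_scale c x) = c * weight_form n \<chi> l x"
  by (simp add: weight_form_def algebra_simps sum_distrib_left)

end

section \<open>The action of W_n on the model\<close>

locale witt_weight = witt_character \<chi> n
  for \<chi> :: "'k::alg_closed_field witt \<Rightarrow> 'k" and n :: nat +
  fixes l :: 'k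
  assumes l: "l \<in> weights n \<chi>"
begin

text \<open>The weight lambda fills the free place 0, so that e_0 t^j acts on the constant 1 by
  \<open>lam j\<close> for all j up to n.\<close>

definition lam :: "nat \<Rightarrow> 'k" where
  "lam j = (if j = 0 then l else weight_coeffs n \<chi> j)"

text \<open>The scalar makes the p-th power of e_(-1) t^j equal to chi(e_(-1) t^j)^p on the model,
  because z_j^p vanishes there.\<close>

definition y_op :: "nat \<Rightarrow> (multi_exp, 'k) endo" where
  "y_op j = z_op j + scalar_endo (\<chi> (witt_e n (-1) j))"

abbreviation vac :: "multi_exp \<Rightarrow>\<^sub>0 'k" where
  "vac \<equiv> single (\<lambda>_. 0) 1"

lemma scalar_endo_commute: "scalar_endo c * \<phi> = \<phi> * (scalar_endo c :: ('b, 'k) endo)"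
  by (rule endo_scalar.s_central)

text \<open>The Fourier transform: X_j is -d/dz_j, with the sign that makes the commutator of y_j
  and X_j equal to 1. The condition X_j^p = 0 holds because p-th powers of derivatives vanish in
  characteristic p.\<close>

sublocale W: weyl_relations scalar_endo "\<lambda>j. - d_op j" y_op lam n
proof
  fix i j
  show "of_nat CHAR('k) = (0 :: (multi_exp, 'k) endo)"
    by (rule of_nat_CHAR_endo)
  show "- d_op i * - d_op j = - d_op j * - (d_op i :: (multi_exp, 'k) endo)"
    by (simp add: d_op_commute)
  show "y_op i * y_op j = y_op j * y_op i"
    unfolding y_op_def distrib_left distrib_right z_op_commute[of i j]
      scalar_endo_commute[of _ "z_op i"] scalar_endo_commute[of _ "z_op j"]
      scalar_endo_commute[of "\<chi> (witt_e n (-1) i)" "scalar_endo (\<chi> (witt_e n (-1) j))"]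
    by (simp only: add.assoc add.left_commute)
  have "commutator (z_op i) (- d_op j) = commutator (d_op j) (z_op i :: (multi_exp, 'k) endo)"
    by (simp add: commutator_def)
  moreover have "commutator (y_op i) (- d_op j) = commutator (z_op i) (- d_op j)"
    unfolding commutator_def y_op_def distrib_left distrib_right scalar_endo_commute[of _ "- d_op j"]
    by (simp only: add_diff_cancel_right)
  ultimately show "commutator (y_op i) (- d_op j) = (if i = j then 1 else 0)"
    by (simp add: commutator_d_op_z_op)
  show "(- d_op j) ^ CHAR('k) = (0 :: (multi_exp, 'k) endo)"
    by (subst power_minus) (simp add: d_op_power_CHAR[OF prime])
qed (rule prime)

abbreviation \<rho> :: "'k witt \<Rightarrow> (multi_exp, 'k) endo" where
  "\<rho> \<equiv> W.current_rep"

abbreviation V :: "(multi_exp \<Rightarrow>\<^sub>0 'k) set" where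
  "V \<equiv> box_space n"

lemma app_y_op: "app (y_op j) f = app (z_op j) f + pm_scale (\<chi> (witt_e n (-1) j)) f"
  by (simp add: y_op_def)

lemma vac_V: "vac \<in> V"
  using prime_gt_0_nat[OF prime] by (intro box_space_single) (simp add: box_def)

lemma lookup_X_series: "lookup W.X_series j = (if j \<le> n then - d_op j else 0)"
  by (simp add: W.X_series_def lookup_sum lookup_single when_def)

lemma lookup_power_V:
  "f \<in> V \<Longrightarrow> app (lookup (W.X_series ^ m) j) f \<in> V"
proof (induction m arbitrary: j f)
  case 0
  then show ?case by (simp add: lookup_one when_def)
next
  case (Suc m)
  then show ?case
    by (auto simp: lookup_mult_nat app_sum_left lookup_X_series
        intro!: box_space_sum box_space_uminus d_op_box_space)
qed

lemma lookup_mono_series: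
  "lookup (W.mono_series m k) j = (if k \<le> j then lookup (W.X_series ^ m) (j - k) else 0)"
  by (simp add: W.mono_series_def lookup_single_mult)

lemma current_op_V:
  assumes "f \<in> V"
  shows "app (W.current_op m k) f \<in> V"
proof -
  have "app (lookup (W.mono_series m' k) j) f \<in> V" for m' j
    using lookup_power_V[OF assms] by (simp add: lookup_mono_series)
  then have "app (W.y_part (W.mono_series m k)) f \<in> V" "app (W.lam_part (W.mono_series (m - 1) k)) f \<in> V"
    by (auto simp: W.y_part_def W.lam_part_def app_sum_left app_y_op
        intro!: box_space_sum box_space_add box_space_scale z_op_box_space)
  then show ?thesis
    by (simp add: W.current_op_def of_nat_endo box_space_add box_space_scale)
qed

lemma \<rho>_V: "f \<in> V \<Longrightarrow> app (\<rho> x) f \<in> V"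
  by (auto simp: W.current_rep_def app_sum_left intro!: box_space_sum box_space_scale current_op_V)

lemma app_d_op_vac: "app (d_op j) vac = 0"
  by (simp add: d_op_def)

lemma app_lookup_X_series_vac: "app (lookup (W.X_series ^ m) j) vac = (if m = 0 \<and> j = 0 then vac else 0)"
proof (cases m)
  case (Suc c)
  have "W.X_series ^ m = W.X_series ^ c * W.X_series"
    by (simp only: Suc power_Suc2)
  then show ?thesis
    using Suc by (simp add: lookup_mult_nat app_sum_left lookup_X_series app_d_op_vac sum.neutral)
qed (simp add: lookup_one when_def)

text \<open>Every X_j kills the constant 1, so a power of X(T) contributes only if its exponent is
  0. The exponent is m in the first summand, positive here, and m - 1 in the twisting term.\<close>

lemma current_op_vac:
  assumes "k \<le> n" "m \<ge> 1"
  shows "app (W.current_op m k) vac = (if m = 1 then pm_scale (lam k) vac else 0)"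
proof -
  have "app (W.y_part (W.mono_series m k)) vac = 0"
    using assms by (simp add: W.y_part_def app_sum_left lookup_mono_series app_lookup_X_series_vac if_distribR
        if_distrib[of "\<lambda>z. app z vac"] sum.neutral del: power_Suc)
  moreover have "app (W.lam_part (W.mono_series (m - 1) k)) vac = (if m = 1 then pm_scale (lam k) vac else 0)"
  proof -
    have "app (W.lam_part (W.mono_series (m - 1) k)) vac = (\<Sum>j\<le>n. if j = k \<and> m = 1 then pm_scale (lam j) vac else 0)"
      unfolding W.lam_part_def app_sum_left
      using assms by (intro sum.cong) (auto simp: lookup_mono_series app_lookup_X_series_vac)
    then show ?thesis
      using assms(1) by (auto simp: sum.neutral)
  qed
  ultimately show ?thesis
    by (simp add: W.current_op_def of_nat_endo)
qed

lemma weight_form_lam: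
  "in_range TYPE('k) n i k \<Longrightarrow> 0 \<le> i \<Longrightarrow> weight_form n \<chi> l (witt_e n i k) = (if i = 0 then lam k else 0)"
  by (simp add: weight_form_e lam_def)

lemma \<rho>_vac_e:
  assumes "in_range TYPE('k) n i k" "0 \<le> i"
  shows "app (\<rho> (witt_e n i k)) vac = pm_scale (if i = 0 then lam k else 0) vac"
proof -
  have "k \<le> n" "1 \<le> nat (i + 1)"
    using assms by (auto simp: in_range_def)
  moreover have "nat (i + 1) = 1 \<longleftrightarrow> i = 0"
    by arith
  ultimately show ?thesis
    using current_op_vac[of k "nat (i + 1)"] by (simp add: W.current_rep_e[OF assms(1)])
qed

lemma \<rho>_vac:
  assumes "x \<in> witt_filt n 0"
  shows "app (\<rho> x) vac = pm_scale (weight_form n \<chi> l x) vac"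
proof -
  have "-1 \<le> (0::int)" by simp
  with assms show ?thesis
  proof (induction x rule: witt_filt_induct)
    case zero
    then show ?case by (simp add: weight_form_def)
  next
    case (e i k)
    then show ?case
      by (simp only: \<rho>_vac_e weight_form_lam)
  next
    case (scale c y)
    then show ?case
      by (simp only: W.current_rep_scale weight_form_scale app_simps app_scalar_endo pm_scale_scale)
  next
    case (add y z)
    then show ?case
      by (simp only: W.current_rep_add weight_form_add app_simps pm_scale_distribs)
  qed
qed

lemma lie_rep_on_\<rho>: "lie_rep_on (witt_filt n (-1)) pm_scale (witt_bracket n) \<rho> V"
  by unfold_locales
    (auto intro!: witt_filt_add witt_filt_scale witt_bracket_space \<rho>_V prime
      simp: W.current_rep_add W.current_rep_scale W.current_rep_bracket)

lemma lam_relation: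
  assumes "k \<le> n"
  shows "lam k ^ CHAR('k) = (if k * CHAR('k) \<le> n then lam (k * CHAR('k)) else 0) + \<chi> (witt_e n 0 k) ^ CHAR('k)"
proof (cases "k = 0")
  case True
  have "l ^ CHAR('k) - l = \<chi> (witt_e n 0 0) ^ CHAR('k)"
    using l by (simp add: weights_def)
  then show ?thesis
    using True by (simp add: lam_def diff_eq_eq add.commute)
next
  case False
  then show ?thesis
    using weight_coeffs(2)[of "k * CHAR('k)"] weight_coeffs(3)[of k] assms p_gt_3
    by (auto simp: lam_def)
qed

lemma \<rho>_pmap_e:
  assumes r: "in_range TYPE('k) n i k" and f: "f \<in> V"
  defines "x \<equiv> witt_e n i k"
  shows "app (\<rho> x ^ CHAR('k)) f = app (\<rho> (witt_pmap n x)) f + pm_scale (\<chi> x ^ CHAR('k)) f"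
proof -
  define C where "C = \<rho> x ^ CHAR('k) - \<rho> (witt_pmap n x) - scalar_endo (\<chi> x ^ CHAR('k))"
  have x: "x \<in> witt_filt n (-1)"
    unfolding x_def by (rule witt_e_in_space)
  have Px: "witt_pmap n x = (if i = 0 then witt_e n 0 (k * CHAR('k)) else 0)"
    unfolding x_def by (rule witt_pmap_e[OF p_gt_2 r])
  have "app C f = 0"
  proof (rule endo_zero_on_box_space[OF _ _ f])
    fix j assume j: "j \<le> n"
    let ?e = "witt_e n (-1) j :: 'k witt"
    have e: "?e \<in> witt_filt n (-1)"
      by (rule witt_e_in_space)
    have "in_range TYPE('k) n (-1) j"
      using j p_gt_3 by (simp add: in_range_def)
    then have ye: "\<rho> ?e = y_op j"
      using j by (simp add: W.current_rep_e W.current_op_0)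
    have ad: "(commutator (\<rho> x) ^^ m) (\<rho> ?e) = \<rho> ((witt_bracket n x ^^ m) ?e) \<and>
        (witt_bracket n x ^^ m) ?e \<in> witt_filt n (-1)" for m
      by (induction m) (auto simp: W.current_rep_bracket x e intro: witt_bracket_space)
    \<comment> \<open>The p-th power and the p-map have the same commutator with y_j: both give
      \<rho> of (ad x)^p applied to e_(-1) t^j. The remaining scalar in C is central.\<close>
    have "commutator (\<rho> x ^ CHAR('k)) (y_op j) = \<rho> ((witt_bracket n x ^^ CHAR('k)) ?e)"
      using ad[of "CHAR('k)"] ad_prime_power[OF prime of_nat_CHAR_endo, of "\<rho> x" "\<rho> ?e"] by (simp add: ye)
    also have "(witt_bracket n x ^^ CHAR('k)) ?e = witt_bracket n (witt_pmap n x) ?e"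
      by (rule witt_pmap_facts(2)[OF p_gt_2 x e, symmetric])
    also have "\<rho> \<dots> = commutator (\<rho> (witt_pmap n x)) (y_op j)"
      using W.current_rep_bracket[OF witt_pmap_facts(1)[OF p_gt_2 x] e] by (simp add: ye)
    finally have "C * y_op j = y_op j * C"
      by (simp add: C_def commutator_def left_diff_distrib right_diff_distrib scalar_endo_commute[of _ "y_op j"]
          algebra_simps)
    moreover have "z_op j = y_op j - scalar_endo (\<chi> ?e)"
      by (simp add: y_op_def)
    ultimately show "C * z_op j = z_op j * C"
      by (simp add: left_diff_distrib right_diff_distrib scalar_endo_commute[of _ C])
  next
    have pow: "app \<phi> vac = pm_scale c vac \<Longrightarrow> app (\<phi> ^ m) vac = pm_scale (c ^ m) vac"
      for \<phi> :: "(multi_exp, 'k) endo" and c m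
      by (induction m) (simp_all add: app_scale pm_scale_scale mult.commute del: pm_scale_simps(4))
    consider "i = -1" | "i = 0" | "1 \<le> i"
      using r unfolding in_range_def by linarith
    then show "app C vac = 0"
    proof cases
      case 1
      have k: "k \<le> n"
        using r by (simp add: in_range_def)
      have "\<rho> x = y_op k"
        using r 1 k by (simp add: x_def W.current_rep_e W.current_op_0)
      moreover have "y_op k ^ CHAR('k) = z_op k ^ CHAR('k) + scalar_endo (\<chi> x) ^ CHAR('k)"
        unfolding y_op_def x_def 1
        by (rule freshmans_dream_commuting[OF prime of_nat_CHAR_endo scalar_endo_commute[symmetric]])
          (rule endo_scalar.s_one endo_scalar.s_add endo_scalar.s_mult)+
      \<comment> \<open>The first p - 1 factors raise the exponent to p - 1, and the last one meets
        the truncation.\<close>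
      moreover have "app (z_op k ^ CHAR('k)) vac = 0"
      proof -
        obtain m where m: "CHAR('k) = Suc m"
          using p_gt_3 by (cases "CHAR('k)") auto
        have "app (z_op k ^ CHAR('k)) vac = app (z_op k) (app (z_op k ^ m) vac)"
          by (simp only: m power_Suc app_simps)
        also have "app (z_op k ^ m) vac = single ((\<lambda>_. 0)(k := 0 + m)) 1"
          by (rule app_z_op_power) (simp add: m)
        finally show ?thesis
          by (simp add: z_op_def m)
      qed
      moreover have "app (scalar_endo (\<chi> x) ^ CHAR('k)) vac = pm_scale (\<chi> x ^ CHAR('k)) vac"
        by (rule pow) simp
      ultimately show ?thesis
        using 1 by (simp add: C_def Px)
    next
      case 2
      have k: "k \<le> n"
        using r by (simp add: in_range_def)
      have "app (\<rho> x) vac = pm_scale (lam k) vac"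
        using \<rho>_vac_e[OF r] 2 by (simp add: x_def del: pm_scale_simps(4))
      then have "app (\<rho> x ^ CHAR('k)) vac = pm_scale (lam k ^ CHAR('k)) vac"
        by (rule pow)
      moreover have "app (\<rho> (witt_pmap n x)) vac = pm_scale (if k * CHAR('k) \<le> n then lam (k * CHAR('k)) else 0) vac"
      proof (cases "k * CHAR('k) \<le> n")
        case True
        then have r': "in_range TYPE('k) n 0 (k * CHAR('k))"
          using p_gt_3 by (simp add: in_range_def)
        show ?thesis
          using True 2 \<rho>_vac_e[OF r'] by (simp add: Px)
      next
        case False
        then show ?thesis
          using 2 by (simp add: Px witt_e_eq in_range_def)
      qed
      ultimately show ?thesis
        using lam_relation[OF k] 2
        by (simp add: C_def x_def pm_scale_distribs del: pm_scale_simps(4))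
    next
      case 3
      have "app (\<rho> x) vac = pm_scale 0 vac"
        using \<rho>_vac_e[OF r] 3 by (simp add: x_def)
      from pow[OF this, of "CHAR('k)"] have "app (\<rho> x ^ CHAR('k)) vac = 0"
        using p_gt_3 by (simp add: power_0_left)
      \<comment> \<open>The height of chi is used here: x kills the constant 1 and x^[p] = 0, so the
        relation requires chi(x) = 0 for i at least 1.\<close>
      moreover have "\<chi> x = 0"
        unfolding x_def using 3 by (intro \<chi>_filt_1 witt_e_in_filt)
      ultimately show ?thesis
        using 3 p_gt_3 by (simp add: C_def Px power_0_left)
    qed
  qed
  then show ?thesis
    by (simp add: C_def diff_diff_eq)
qed

text \<open>Both sides are p-semilinear and, on sums, acquire the same correction from Jacobson's
  formula, once in the operator ring and once in the p-map; the term with chi is additive by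
  Frobenius. So basis vectors decide.\<close>

lemma \<rho>_pmap:
  assumes x: "x \<in> witt_filt n (-1)" and f: "f \<in> V"
  shows "app (\<rho> x ^ CHAR('k)) f = app (\<rho> (witt_pmap n x)) f + pm_scale (\<chi> x ^ CHAR('k)) f"
proof -
  interpret lie_rep_on "witt_filt n (-1)" pm_scale "witt_bracket n" \<rho> V
    by (rule lie_rep_on_\<rho>)
  have scale_power: "app ((scalar_endo c * \<phi>) ^ m) g = pm_scale (c ^ m) (app (\<phi> ^ m) g)" for c \<phi> m and g :: "multi_exp \<Rightarrow>\<^sub>0 'k"
    by (induction m arbitrary: g) (simp_all add: app_scale pm_scale_scale mult.commute)
  show ?thesis
    using x
  proof (induction x rule: witt_space_induct)
    case zero
    have "witt_pmap n (pm_scale 0 0) = pm_scale (0 ^ CHAR('k)) (witt_pmap n (0 :: 'k witt))"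
      by (rule witt_pmap_facts(3)[OF p_gt_2]) simp
    then show ?case
      using p_gt_3 by (simp add: power_0_left \<chi>_zero)
  next
    case (e j k)
    show ?case
      by (rule \<rho>_pmap_e[OF e(2) f])
  next
    case (scale c y)
    then show ?case
      by (simp add: scale_power W.current_rep_scale witt_pmap_facts(3)[OF p_gt_2] \<chi>_scale pm_scale_distribs pm_scale_scale
          power_mult_distrib)
  next
    case (add y z)
    have "(\<Sum>i=1..<CHAR('k). jacobson_s pm_scale (witt_bracket n) i y z) \<in> witt_filt n (-1)"
      by (intro L_sum jacobson_s_closed add)
    then show ?case
      unfolding app_jacobson[OF add(1,2) f]
      using add by (simp add: witt_pmap_facts(4)[OF p_gt_2] W.current_rep_add
          \<chi>_add freshmans_dream[OF prime refl] pm_scale_distribs)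
  qed
qed

lemma e1_kernel:
  assumes f: "f \<in> V" and k: "\<And>k. k \<le> n \<Longrightarrow> app (\<rho> (witt_e n 1 k)) f = 0"
  shows "f = pm_scale (lookup f (\<lambda>_. 0)) vac"
proof -
  have two: "(2 :: 'k) \<noteq> 0"
    using p_gt_3 of_nat_eq_0_iff_char_dvd[of 2, where 'a = 'k] by (auto dest: dvd_imp_le)
  have current_op_2: "app (W.y_part (W.mono_series 2 k)) f + pm_scale 2 (app (W.lam_part (W.mono_series 1 k)) f) = 0"
    if "k \<le> n" for k
  proof -
    have "in_range TYPE('k) n 1 k"
      using p_gt_3 that by (simp add: in_range_def)
    then have "app (W.current_op 2 k) f = 0"
      using k[OF that] by (simp add: W.current_rep_e)
    then show ?thesis
      by (simp add: W.current_op_def of_nat_endo)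
  qed
  have "app (d_op r) f = 0" if "r \<le> n" for r
    using that
  proof (induction r rule: less_induct)
    case (less r)
    define g where "g = app (d_op r) f"
    have lam: "app (W.lam_part (W.mono_series 1 (n - r))) f = - pm_scale (lam n) g"
    proof -
      have "app (W.lam_part (W.mono_series 1 (n - r))) f = (\<Sum>j\<le>n. if j = n then - pm_scale (lam n) g else 0)"
        unfolding W.lam_part_def app_sum_left
      proof (intro sum.cong refl)
        fix j assume j: "j \<in> {..n}"
        show "app (scalar_endo (lam j) * lookup (W.mono_series 1 (n - r)) j) f =
            (if j = n then - pm_scale (lam n) g else 0)"
        proof (cases "j = n")
          case True
          then show ?thesis
            using less.prems by (simp add: lookup_mono_series lookup_X_series g_def pm_scale_distribs)
        next
          case False
          \<comment> \<open>For j < n the index j - (n - r) is below r, where the derivative of f is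
            already known to vanish; only the scalar at j = n is left.\<close>
          then have "n - r \<le> j \<Longrightarrow> app (d_op (j - (n - r))) f = 0"
            using j less by simp
          then show ?thesis
            using False by (simp add: lookup_mono_series lookup_X_series)
        qed
      qed
      then show ?thesis by simp
    qed
    have comm: "app (d_op i) (app (d_op j) f) = app (d_op j) (app (d_op i) f)" for i j
      by (metis app_simps(6) d_op_commute)
    have lam_n: "lam n \<noteq> 0"
      using weight_coeffs_top n_pos by (simp add: lam_def)
    show ?case
    proof (cases "r = 0")
      case False
      have "app (lookup (W.mono_series 2 (n - r)) j) f = 0" if "j \<le> n" for j
      proof -
        have "app (lookup W.X_series b) (app (lookup W.X_series c) f) = 0" if "b + c \<le> r" for b c
        proof -
          \<comment> \<open>As r > 0, one of b and c is below r whenever b + c is at most r. The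
            derivatives commute, so that one can be applied first, and the quadratic part kills
            f.\<close>
          have "b = 0 \<or> c = 0 \<or> b < r \<and> c < r" "0 < r"
            using that False by auto
          then have "app (d_op b) f = 0 \<or> app (d_op c) f = 0"
            using less by (metis le0 le_trans less_imp_le)
          then have "app (d_op b) (app (d_op c) f) = 0"
            using comm[of b c] by auto
          then show ?thesis
            by (simp add: lookup_X_series app_diff[of _ 0, simplified])
        qed
        then show ?thesis
          using that less.prems
          by (auto simp: lookup_mono_series power2_eq_square lookup_mult_nat app_sum_left intro!: sum.neutral)
      qed
      then have "app (W.y_part (W.mono_series 2 (n - r))) f = 0"
        by (simp add: W.y_part_def app_sum_left)
      then have "pm_scale (2 * lam n) g = 0"
        using current_op_2[of "n - r"] unfolding lam by (simp add: pm_scale_distribs pm_scale_scale)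
      then show ?thesis
        using two lam_n pm_scale_eq_zero[of "2 * lam n" g] by (simp add: g_def)
    next
      case True
      \<comment> \<open>For r = 0 the quadratic part retains the single term y_n d_0 d_0 f, so the
        equation becomes y_n d_0 g = 2 chi_n g for g = d_0 f.\<close>
      have yp: "app (W.y_part (W.mono_series 2 n)) f = app (y_op n) (app (d_op 0) g)"
      proof -
        have "app (W.y_part (W.mono_series 2 n)) f = (\<Sum>j\<le>n. if j = n then app (y_op n) (app (d_op 0) g) else 0)"
          unfolding W.y_part_def app_sum_left
          by (intro sum.cong) (auto simp: lookup_mono_series power2_eq_square lookup_mult_nat lookup_X_series g_def True)
        then show ?thesis by simp
      qed
      have "app (W.lam_part (W.mono_series 1 n)) f = - pm_scale (lam n) g"
        using lam by (simp only: True diff_zero)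
      then have "app (y_op n) (app (d_op 0) g) + - pm_scale (2 * lam n) g = 0"
        using current_op_2[OF order_refl] by (simp only: yp pm_scale_distribs(3) pm_scale_scale)
      then have yd: "app (y_op n) (app (d_op 0) g) = pm_scale (2 * lam n) g"
        by (simp only: eq_neg_iff_add_eq_0[symmetric] minus_minus)
      have "commutator (y_op n) (- d_op 0) = 0"
        using W.yX[of n 0] n_pos by simp
      then have c: "d_op 0 * y_op n = y_op n * d_op 0"
        by (simp add: commutator_def)
      \<comment> \<open>Here n > 0 matters: y_n and d_0 commute, so the p-th power of their product
        is y_n^p d_0^p = 0, whereas it multiplies g by (2 chi_n)^p.\<close>
      have pow: "app (y_op n ^ m) (app (d_op 0 ^ m) g) = pm_scale ((2 * lam n) ^ m) g" for m
      proof (induction m)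
        case (Suc m)
        have "d_op 0 * y_op n ^ m = y_op n ^ m * d_op 0"
          by (rule power_commuting_commutes[symmetric]) (rule c[symmetric])
        then have "y_op n ^ Suc m * d_op 0 ^ Suc m = y_op n * (d_op 0 * y_op n ^ m) * d_op 0 ^ m"
          by (simp only: power_Suc mult.assoc)
        then have "app (y_op n ^ Suc m * d_op 0 ^ Suc m) g =
            app (y_op n * (d_op 0 * y_op n ^ m) * d_op 0 ^ m) g"
          by (simp only:)
        then have "app (y_op n ^ Suc m) (app (d_op 0 ^ Suc m) g) =
            app (y_op n) (app (d_op 0) (app (y_op n ^ m) (app (d_op 0 ^ m) g)))"
          by (simp only: app_simps)
        also have "\<dots> = pm_scale ((2 * lam n) ^ m) (pm_scale (2 * lam n) g)"
          by (simp only: Suc.IH app_scale yd)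
        finally show ?case
          by (simp only: pm_scale_scale power_Suc mult.commute)
      qed simp
      have "pm_scale ((2 * lam n) ^ CHAR('k)) g = 0"
        using pow[of "CHAR('k)"] by (simp add: d_op_power_CHAR[OF prime])
      then show ?thesis
        using two lam_n pm_scale_eq_zero[of "(2 * lam n) ^ CHAR('k)" g] by (simp add: g_def True)
    qed
  qed
  then show ?thesis
    using d_ops_kernel[OF prime f] by simp
qed

end

section \<open>Highest weight vectors in modules\<close>

lemma free_scalar_central: "free_scalar c * f = f * free_scalar c"
proof (induction f rule: poly_mapping_sum_induct)
  case (single w a)
  have "0 + w = w + 0"
    by simp
  then show ?case
    by (simp add: free_scalar_def mult_single mult.commute)
qed (simp_all add: distrib_left distrib_right)

interpretation free_scalar: scalar_hom "free_scalar :: 'k::field \<Rightarrow> 'v free_word \<Rightarrow>\<^sub>0 'k"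
proof
  fix c d :: 'k and a :: "'v free_word \<Rightarrow>\<^sub>0 'k"
  show "free_scalar c * a = a * free_scalar c"
    by (rule free_scalar_central)
qed (simp_all add: free_scalar_def single_add mult_single)

context scalar_hom
begin

text \<open>Substitution of a ring element into a polynomial over the field. Its purpose is to split
  off linear factors and thereby find eigenvectors.\<close>

definition poly_eval :: "'a \<Rightarrow> 'k poly \<Rightarrow> 'a" where
  "poly_eval a q = (\<Sum>i\<le>degree q. s (coeff q i) * a ^ i)"

lemma poly_eval_bound: "degree q \<le> d \<Longrightarrow> poly_eval a q = (\<Sum>i\<le>d. s (coeff q i) * a ^ i)"
  unfolding poly_eval_def by (intro sum.mono_neutral_left) (auto simp: coeff_eq_0 s_zero)

lemma poly_eval_add: "poly_eval a (q + r) = poly_eval a q + poly_eval a r"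
proof -
  let ?d = "max (degree q) (degree r)"
  have "degree (q + r) \<le> ?d" "degree q \<le> ?d" "degree r \<le> ?d"
    by (auto intro: degree_add_le)
  then show ?thesis
    by (simp add: poly_eval_bound[of _ ?d] s_add distrib_right sum.distrib)
qed

lemma poly_eval_smult: "poly_eval a (Polynomial.smult c q) = s c * poly_eval a q"
  by (subst poly_eval_bound[OF degree_smult_le]) (simp add: poly_eval_def s_mult sum_distrib_left mult.assoc)

lemma poly_eval_pCons: "poly_eval a (pCons c q) = s c + a * poly_eval a q"
proof -
  have "poly_eval a (pCons c q) = (\<Sum>i\<le>Suc (degree q). s (coeff (pCons c q) i) * a ^ i)"
    by (rule poly_eval_bound) (rule degree_pCons_le)
  also have "\<dots> = s c + (\<Sum>i\<le>degree q. s (coeff q i) * a ^ Suc i)"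
    by (subst sum.atMost_Suc_shift) simp
  also have "(\<Sum>i\<le>degree q. s (coeff q i) * a ^ Suc i) = a * poly_eval a q"
    unfolding poly_eval_def sum_distrib_left
    by (intro sum.cong refl) (simp only: power_Suc mult.assoc[symmetric] s_central[of _ a])
  finally show ?thesis .
qed

lemma poly_eval_monom: "poly_eval a (monom 1 m) = a ^ m"
  by (induction m) (simp_all add: monom_Suc poly_eval_pCons s_zero, simp add: poly_eval_def s_one)

lemma poly_eval_linear_factor: "poly_eval a ([:- c, 1:] * q) = (a - s c) * poly_eval a q"
proof -
  have "s (- c) = - s c"
    using s_add[of c "- c"] by (simp add: s_zero eq_neg_iff_add_eq_0 add.commute)
  moreover have "[:- c, 1:] * q = Polynomial.smult (- c) q + pCons 0 q"
    by simp
  ultimately show ?thesis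
    by (simp only: poly_eval_add poly_eval_smult poly_eval_pCons s_zero) (simp add: left_diff_distrib)
qed

end

section \<open>Modules over U_chi(L), acted on by free-algebra representatives\<close>

locale u_module = closed_lie L \<chi> + N: left_module U N
  for L :: "('k::field, 'v::ab_group_add) restricted_lie" and \<chi> :: "'v \<Rightarrow> 'k"
    and N :: "(('v free_word \<Rightarrow>\<^sub>0 'k) set set, 'm) module"
begin

text \<open>The modules come without a separate vector space structure: scalars act as the elements
  \<open>free_scalar c\<close>, so that scalars, generators and their products are treated
  alike.\<close>

definition act :: "('v free_word \<Rightarrow>\<^sub>0 'k) \<Rightarrow> 'm \<Rightarrow> 'm" where
  "act f x = uq L \<chi> f \<odot>\<^bsub>N\<^esub> x"

lemma act_closed [simp]: "f \<in> carrier F \<Longrightarrow> x \<in> carrier N \<Longrightarrow> act f x \<in> carrier N"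
  by (simp add: act_def N.smult_closed)

lemma act_add: "f \<in> carrier F \<Longrightarrow> g \<in> carrier F \<Longrightarrow> x \<in> carrier N \<Longrightarrow> act (f + g) x = act f x \<oplus>\<^bsub>N\<^esub> act g x"
  using uq.hom_add[of f g] by (simp add: act_def N.smult_l_distr)

lemma act_mult: "f \<in> carrier F \<Longrightarrow> g \<in> carrier F \<Longrightarrow> x \<in> carrier N \<Longrightarrow> act (f * g) x = act f (act g x)"
  using uq.hom_mult[of f g] by (simp add: act_def N.smult_assoc)

lemma act_one [simp]: "x \<in> carrier N \<Longrightarrow> act 1 x = x"
  using uq.hom_one by (simp add: act_def N.smult_one)

lemma act_zero [simp]: "x \<in> carrier N \<Longrightarrow> act 0 x = \<zero>\<^bsub>N\<^esub>"
  using uq.hom_zero by (simp add: act_def)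

lemma act_add_right:
  "f \<in> carrier F \<Longrightarrow> x \<in> carrier N \<Longrightarrow> y \<in> carrier N \<Longrightarrow> act f (x \<oplus>\<^bsub>N\<^esub> y) = act f x \<oplus>\<^bsub>N\<^esub> act f y"
  by (simp add: act_def N.smult_r_distr)

lemma act_zero_right [simp]: "f \<in> carrier F \<Longrightarrow> act f \<zero>\<^bsub>N\<^esub> = \<zero>\<^bsub>N\<^esub>"
  by (simp add: act_def)

lemma act_diff_eq_zero_iff:
  assumes "f \<in> carrier F" "g \<in> carrier F" "x \<in> carrier N"
  shows "act (f - g) x = \<zero>\<^bsub>N\<^esub> \<longleftrightarrow> act f x = act g x"
proof -
  have "act f x = act (f - g) x \<oplus>\<^bsub>N\<^esub> act g x"
    using assms act_add[of "f - g" g x] free_algebra_closed by simp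
  then show ?thesis
    using assms free_algebra_closed(2)[OF assms(1,2)] by (metis N.M.add.r_cancel_one act_closed)
qed

lemma act_scalar_add:
  "x \<in> carrier N \<Longrightarrow> act (free_scalar c) x \<oplus>\<^bsub>N\<^esub> act (free_scalar d) x = act (free_scalar (c + d)) x"
  using act_add[of "free_scalar c" "free_scalar d" x] by (simp add: free_scalar.s_add)

lemma act_scalar_mult:
  "x \<in> carrier N \<Longrightarrow> act (free_scalar c) (act (free_scalar d) x) = act (free_scalar (c * d)) x"
  using act_mult[of "free_scalar c" "free_scalar d" x] by (simp flip: free_scalar.s_mult)

lemma act_scalar_one [simp]: "x \<in> carrier N \<Longrightarrow> act (free_scalar 1) x = x"
  by (simp add: free_scalar.s_one)

lemma act_scalar_zero [simp]: "x \<in> carrier N \<Longrightarrow> act (free_scalar 0) x = \<zero>\<^bsub>N\<^esub>"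
  by (simp add: free_scalar.s_zero)

lemma act_scalar_eq_zero:
  assumes "x \<in> carrier N" "act (free_scalar c) x = \<zero>\<^bsub>N\<^esub>" "c \<noteq> 0"
  shows "x = \<zero>\<^bsub>N\<^esub>"
proof -
  have "act (free_scalar (inverse c * c)) x = \<zero>\<^bsub>N\<^esub>"
    using assms act_scalar_mult[of x "inverse c" c] by simp
  then show ?thesis
    using assms by simp
qed

lemma act_scalar_commute:
  "f \<in> carrier F \<Longrightarrow> x \<in> carrier N \<Longrightarrow> act f (act (free_scalar c) x) = act (free_scalar c) (act f x)"
  using act_mult[of f "free_scalar c" x] act_mult[of "free_scalar c" f x] by (simp add: free_scalar_central[of c f])

lemma act_gen_add:
  assumes "x \<in> lie_space L" "y \<in> lie_space L" "v \<in> carrier N"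
  shows "act (free_gen (x + y)) v = act (free_gen x) v \<oplus>\<^bsub>N\<^esub> act (free_gen y) v"
  using uq_add[OF assms(1,2)] assms act_add[of "free_gen x" "free_gen y" v] by (simp add: act_def)

lemma act_gen_scale:
  assumes "x \<in> lie_space L" "v \<in> carrier N"
  shows "act (free_gen (lie_scale L c x)) v = act (free_scalar c) (act (free_gen x) v)"
  using uq_scale[OF assms(1)] assms act_mult[of "free_scalar c" "free_gen x" v] by (simp add: act_def)

lemma act_gen_bracket:
  assumes "x \<in> lie_space L" "y \<in> lie_space L" "v \<in> carrier N"
  shows "act (free_gen x) (act (free_gen y) v) =
    act (free_gen y) (act (free_gen x) v) \<oplus>\<^bsub>N\<^esub> act (free_gen (lie_bracket L x y)) v"
proof -
  have xy: "free_gen x \<in> carrier F" "free_gen y \<in> carrier F" "free_gen (lie_bracket L x y) \<in> carrier F"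
    using assms bracket_closed by auto
  have "act (free_gen x * free_gen y) v = act (free_gen y * free_gen x + free_gen (lie_bracket L x y)) v"
    using uq_bracket[OF assms(1,2)] by (simp add: act_def)
  then show ?thesis
    using xy assms(3) free_algebra_closed(4)[OF xy(2,1)] by (simp add: act_mult act_add)
qed

lemma act_gen_pmap:
  assumes "x \<in> lie_space L" "v \<in> carrier N"
  shows "act (free_gen x ^ CHAR('k)) v =
    act (free_gen (lie_pmap L x)) v \<oplus>\<^bsub>N\<^esub> act (free_scalar (\<chi> x ^ CHAR('k))) v"
proof -
  have "act (free_gen x ^ CHAR('k)) v = act (free_gen (lie_pmap L x) + free_scalar (\<chi> x ^ CHAR('k))) v"
    using uq_pmap[OF assms(1)] by (simp add: act_def)
  then show ?thesis
    using assms pmap_closed[OF assms(1)] by (simp add: act_add)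
qed

text \<open>Stability under generators gives stability under words, letter by letter; additive
  inverses come from the scalar -1.\<close>

lemma submodule_criterion:
  assumes H: "H \<subseteq> carrier N" "\<zero>\<^bsub>N\<^esub> \<in> H"
    and add: "\<And>x y. x \<in> H \<Longrightarrow> y \<in> H \<Longrightarrow> x \<oplus>\<^bsub>N\<^esub> y \<in> H"
    and scalar: "\<And>c x. x \<in> H \<Longrightarrow> act (free_scalar c) x \<in> H"
    and gen: "\<And>y x. y \<in> lie_space L \<Longrightarrow> x \<in> H \<Longrightarrow> act (free_gen y) x \<in> H"
  shows "submodule H U N"
proof -
  have act_H: "act f x \<in> H" if "f \<in> carrier F" "x \<in> H" for f x
    using that
  proof (induction f rule: free_algebra_induct)
    case (gen_mult y g)
    then have "act (free_gen y * g) x = act (free_gen y) (act g x)"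
      using H(1) by (intro act_mult) auto
    then show ?case
      using gen_mult gen by simp
  next
    case (add g h)
    then have "act (g + h) x = act g x \<oplus>\<^bsub>N\<^esub> act h x"
      using H(1) by (intro act_add) auto
    then show ?case
      using add assms(3) by simp
  qed (rule scalar)
  show ?thesis
  proof (intro submodule.intro subgroup.intro submodule_axioms.intro)
    fix x assume x: "x \<in> H"
    then have xN: "x \<in> carrier N"
      using H(1) by auto
    have "act (free_scalar (- 1)) x \<oplus>\<^bsub>N\<^esub> act (free_scalar 1) x = act (free_scalar (- 1) + free_scalar 1) x"
      using xN by (subst act_add) auto
    also have "free_scalar (- 1) + free_scalar 1 = (0 :: 'v free_word \<Rightarrow>\<^sub>0 'k)"
      using free_scalar.s_add[of "- 1" 1] by (simp add: free_scalar.s_zero)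
    finally have "act (free_scalar (- 1)) x \<oplus>\<^bsub>N\<^esub> x = \<zero>\<^bsub>N\<^esub>"
      using xN by simp
    then have "\<ominus>\<^bsub>N\<^esub> x = act (free_scalar (- 1)) x"
      using xN by (intro N.M.minus_equality) auto
    then show "inv\<^bsub>add_monoid N\<^esub> x \<in> H"
      using scalar[OF x] by (simp add: a_inv_def)
  next
    fix a x assume "a \<in> carrier U" "x \<in> H"
    then show "a \<odot>\<^bsub>N\<^esub> x \<in> H"
      using act_H by (auto simp: uq_surj act_def)
  qed (use H add in auto)
qed

lemma submodule_act:
  "submodule H U N \<Longrightarrow> f \<in> carrier F \<Longrightarrow> x \<in> H \<Longrightarrow> act f x \<in> H"
  unfolding act_def by (rule submodule.smult_closed) auto

lemma submodule_subset: "submodule H U N \<Longrightarrow> H \<subseteq> carrier N"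
  using subgroup.subset[OF submodule.axioms(1)] by fastforce

lemma submodule_zero: "submodule H U N \<Longrightarrow> \<zero>\<^bsub>N\<^esub> \<in> H"
  using subgroup.one_closed[OF submodule.axioms(1)] by fastforce

lemma nilpotent_kernel:
  assumes "f \<in> carrier F" "x \<in> carrier N" "x \<noteq> \<zero>\<^bsub>N\<^esub>" "act (f ^ m) x = \<zero>\<^bsub>N\<^esub>"
  obtains k where "act (f ^ k) x \<noteq> \<zero>\<^bsub>N\<^esub>" "act f (act (f ^ k) x) = \<zero>\<^bsub>N\<^esub>"
proof -
  have "\<exists>k. act (f ^ k) x \<noteq> \<zero>\<^bsub>N\<^esub> \<and> act (f ^ Suc k) x = \<zero>\<^bsub>N\<^esub>"
    using assms(3,4)
  proof (induction m)
    case (Suc m)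
    then show ?case
      by (cases "act (f ^ m) x = \<zero>\<^bsub>N\<^esub>") auto
  qed (use assms(2) in simp)
  then obtain k where k: "act (f ^ k) x \<noteq> \<zero>\<^bsub>N\<^esub>" "act (f ^ Suc k) x = \<zero>\<^bsub>N\<^esub>"
    by blast
  moreover have "act (f ^ Suc k) x = act f (act (f ^ k) x)"
    using assms(1,2) act_mult[of f "f ^ k" x] by simp
  ultimately show ?thesis
    using that by simp
qed

text \<open>
  An Engel-type argument: each \<open>f t\<close> acts nilpotently on the common kernel of the \<open>f u\<close> with
  \<open>t < u\<close> and preserves it.
\<close>

lemma common_kernel:
  fixes f :: "nat \<Rightarrow> 'v free_word \<Rightarrow>\<^sub>0 'k" and T m :: nat
  assumes H: "submodule H U N" "H \<noteq> {\<zero>\<^bsub>N\<^esub>}"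
    and f: "\<And>t. f t \<in> carrier F"
    and step: "\<And>t x u. 0 < t \<Longrightarrow> t < T \<Longrightarrow> x \<in> carrier N \<Longrightarrow> (\<And>u. t < u \<Longrightarrow> u < T \<Longrightarrow> act (f u) x = \<zero>\<^bsub>N\<^esub>) \<Longrightarrow>
      t < u \<Longrightarrow> u < T \<Longrightarrow> act (f u) (act (f t) x) = \<zero>\<^bsub>N\<^esub>"
    and nilp: "\<And>t x. 0 < t \<Longrightarrow> t < T \<Longrightarrow> x \<in> carrier N \<Longrightarrow> (\<And>u. t < u \<Longrightarrow> u < T \<Longrightarrow> act (f u) x = \<zero>\<^bsub>N\<^esub>) \<Longrightarrow>
      act (f t ^ m) x = \<zero>\<^bsub>N\<^esub>"
  obtains x where "x \<in> H" "x \<noteq> \<zero>\<^bsub>N\<^esub>" "\<And>t. 0 < t \<Longrightarrow> t < T \<Longrightarrow> act (f t) x = \<zero>\<^bsub>N\<^esub>"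
proof -
  have "\<exists>x\<in>H. x \<noteq> \<zero>\<^bsub>N\<^esub> \<and> (\<forall>t. T - d \<le> t \<and> 0 < t \<and> t < T \<longrightarrow> act (f t) x = \<zero>\<^bsub>N\<^esub>)" for d
  proof (induction d)
    case 0
    obtain x where "x \<in> H" "x \<noteq> \<zero>\<^bsub>N\<^esub>"
      using H submodule_zero by blast
    then show ?case by auto
  next
    case (Suc d)
    then obtain x where x: "x \<in> H" "x \<noteq> \<zero>\<^bsub>N\<^esub>" "\<And>t. T - d \<le> t \<Longrightarrow> 0 < t \<Longrightarrow> t < T \<Longrightarrow> act (f t) x = \<zero>\<^bsub>N\<^esub>"
      by blast
    define t where "t = T - Suc d"
    show ?case
    proof (cases "0 < t")
      case False
      then have "T - d \<le> u" if "0 < u" for u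
        using that by (simp add: t_def)
      then show ?thesis
        using x by blast
    next
      case True
      then have t: "0 < t" "t < T" "T - d = Suc t"
        by (auto simp: t_def)
      have xN: "x \<in> carrier N"
        using x(1) submodule_subset[OF H(1)] by blast
      have x3: "act (f u) x = \<zero>\<^bsub>N\<^esub>" if "t < u" "u < T" for u
        using x(3)[of u] that t by simp
      obtain k where k: "act (f t ^ k) x \<noteq> \<zero>\<^bsub>N\<^esub>" "act (f t) (act (f t ^ k) x) = \<zero>\<^bsub>N\<^esub>"
        by (rule nilpotent_kernel[OF f xN x(2) nilp[OF t(1,2) xN x3]])
      have "act (f u) (act (f t ^ j) x) = \<zero>\<^bsub>N\<^esub>" if "t < u" "u < T" for u j
        using that
      proof (induction j arbitrary: u)
        case 0
        then show ?case using x3 xN by simp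
      next
        case (Suc j)
        have "act (f t ^ Suc j) x = act (f t) (act (f t ^ j) x)"
          using act_mult[of "f t" "f t ^ j" x] f xN by simp
        moreover have "act (f t ^ j) x \<in> carrier N"
          using f xN by simp
        ultimately show ?case
          using step[OF t(1,2), of "act (f t ^ j) x" u] Suc by simp
      qed
      moreover have "act (f t ^ k) x \<in> H"
        using submodule_act[OF H(1) _ x(1)] f by simp
      moreover have "u = t \<or> t < u" if "T - Suc d \<le> u" for u
        using that by (auto simp: t_def)
      ultimately show ?thesis
        using k by blast
    qed
  qed
  from this[of T] show ?thesis
    using that by auto
qed

text \<open>The module is not known to be finite-dimensional, so an annihilating polynomial replaces
  the dimension argument: roots are split off one at a time, and the last vector before zero is an
  eigenvector.\<close>

lemma eigenvector_exists:
  fixes q :: "'k poly"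
  assumes roots: "\<And>q :: 'k poly. degree q > 0 \<Longrightarrow> \<exists>c. poly q c = 0"
    and a: "a \<in> carrier F" and q: "q \<noteq> 0"
    and K: "K \<subseteq> carrier N" "\<And>y. y \<in> K \<Longrightarrow> act a y \<in> K" "\<And>y z. y \<in> K \<Longrightarrow> z \<in> K \<Longrightarrow> y \<oplus>\<^bsub>N\<^esub> z \<in> K"
      "\<And>c y. y \<in> K \<Longrightarrow> act (free_scalar c) y \<in> K"
    and x: "x \<in> K" "x \<noteq> \<zero>\<^bsub>N\<^esub>" "act (free_scalar.poly_eval a q) x = \<zero>\<^bsub>N\<^esub>"
  shows "\<exists>c. \<exists>y\<in>K. y \<noteq> \<zero>\<^bsub>N\<^esub> \<and> act a y = act (free_scalar c) y"
  using q x(3)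
proof (induction "degree q" arbitrary: q)
  case 0
  then obtain c where c: "q = [:c:]" "c \<noteq> 0"
    by (metis degree_eq_zeroE pCons_0_0)
  then have "act (free_scalar c) x = \<zero>\<^bsub>N\<^esub>"
    using 0 by (simp add: free_scalar.poly_eval_def)
  then have "x = \<zero>\<^bsub>N\<^esub>"
    using act_scalar_eq_zero[of x c] x(1) K(1) c by blast
  then show ?case
    using x(2) by simp
next
  case (Suc d)
  then obtain c where "poly q c = 0"
    using roots[of q] by auto
  then obtain r where r: "q = [:- c, 1:] * r"
    by (metis dvdE poly_eq_0_iff_dvd)
  have r0: "r \<noteq> 0"
    using r Suc.prems by auto
  then have d: "d = degree r"
    using r Suc.hyps(2) by (simp add: degree_mult_eq del: mult_pCons_left)
  have xN: "x \<in> carrier N"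
    using x(1) K(1) by blast
  have poly_closed: "free_scalar.poly_eval a r \<in> carrier F"
    unfolding free_scalar.poly_eval_def using a by (intro free_algebra_closed_sum) auto
  define y where "y = act (free_scalar.poly_eval a r) x"
  \<comment> \<open>K is stable only under a, sums and scalars, so the value of the polynomial at x
    is built up inside K term by term.\<close>
  have yK: "act (\<Sum>i\<in>A. free_scalar (coeff r i) * a ^ i) x \<in> K" if "finite A" for A
    using that
  proof (induction A)
    case empty
    have "act (free_scalar 0) x \<in> K"
      by (rule K(4)[OF x(1)])
    then show ?case
      using xN by simp
  next
    case (insert i A)
    have pow: "act (a ^ j) x \<in> K" for j
    proof (induction j)
      case (Suc j)
      have "act (a ^ Suc j) x = act a (act (a ^ j) x)"
        using act_mult[of a "a ^ j" x] a xN by simp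
      then show ?case
        using Suc K(2) by simp
    qed (use x(1) xN in simp)
    have "act (free_scalar (coeff r i) * a ^ i) x \<in> K"
      using K(4)[OF pow] act_mult[of "free_scalar (coeff r i)" "a ^ i" x] a xN by simp
    moreover have "(\<Sum>j\<in>A. free_scalar (coeff r j) * a ^ j) \<in> carrier F"
      using a by (intro free_algebra_closed_sum) auto
    ultimately show ?case
      using insert K(3) a xN by (simp add: act_add)
  qed
  show ?case
  proof (cases "y = \<zero>\<^bsub>N\<^esub>")
    case True
    then show ?thesis
      using Suc.hyps(1)[OF d r0] by (simp add: y_def)
  next
    case False
    have "y \<in> K"
      using yK[of "{..degree r}"] by (simp add: y_def free_scalar.poly_eval_def)
    moreover have "act (a - free_scalar c) y = \<zero>\<^bsub>N\<^esub>"
    proof -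
      have "act ((a - free_scalar c) * free_scalar.poly_eval a r) x = \<zero>\<^bsub>N\<^esub>"
        using Suc.prems(2) unfolding r free_scalar.poly_eval_linear_factor .
      then show ?thesis
        unfolding y_def using act_mult[OF _ poly_closed xN] a free_algebra_closed(2) by simp
    qed
    ultimately show ?thesis
      using False act_diff_eq_zero_iff[of a "free_scalar c" y] a K(1) by auto
  qed
qed

end

lemma witt_lie_simps [simp]:
  "lie_space (witt_lie n i) = witt_filt n i" "lie_scale (witt_lie n i) = pm_scale"
  "lie_bracket (witt_lie n i) = witt_bracket n" "lie_pmap (witt_lie n i) = witt_pmap n"
  by (simp_all add: witt_lie_def witt_scale_eq)

lemma closed_lie_witt:
  assumes "CHAR('k::field) > 2" "i \<in> {-1, 0}"
  shows "closed_lie (witt_lie n i :: ('k, 'k witt) restricted_lie)"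
  using assms by unfold_locales (simp_all add: witt_filt_add witt_filt_scale witt_bracket_filt witt_pmap_filt)

context u_module
begin

text \<open>The commutation is assumed at the vector x alone, because in the application the bracket
  of g and h is only known to act as zero on that vector.\<close>

lemma act_shift_commute:
  assumes g: "g \<in> carrier F" and h: "h \<in> carrier F" and x: "x \<in> carrier N"
    and comm: "act g (act h x) = act h (act g x)"
  shows "act (g - free_scalar a) (act (h - free_scalar b) x) = act (h - free_scalar b) (act (g - free_scalar a) x)"
proof -
  have "act (g * h) x = act (h * g) x"
    using comm by (simp only: act_mult[OF g h x] act_mult[OF h g x])
  moreover have "(g - free_scalar a) * (h - free_scalar b) - (h - free_scalar b) * (g - free_scalar a) = g * h - h * g"
    unfolding left_diff_distrib right_diff_distrib free_scalar_central[of a] free_scalar_central[of b g]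
    by (simp add: free_scalar_central[of b "free_scalar a"])
  moreover have closed: "(g - free_scalar a) * (h - free_scalar b) \<in> carrier F"
      "(h - free_scalar b) * (g - free_scalar a) \<in> carrier F" "g * h \<in> carrier F" "h * g \<in> carrier F"
    using g h by (auto intro!: free_algebra_closed)
  ultimately have "act ((g - free_scalar a) * (h - free_scalar b)) x = act ((h - free_scalar b) * (g - free_scalar a)) x"
    using act_diff_eq_zero_iff[OF closed(1,2) x] act_diff_eq_zero_iff[OF closed(3,4) x] by simp
  then show ?thesis
    using g h by (simp only: act_mult[OF _ _ x] free_algebra_closed(2) free_algebra_closed_basic(3))
qed

text \<open>Scalars are central, so Frobenius applies. The term (-c)^p is left as it stands; later
  it combines with c^p into the p-th power of c - c, without regard to the parity of p.\<close>

lemma act_shift_power_CHAR: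
  assumes prime: "prime CHAR('k)" and g: "g \<in> carrier F" and x: "x \<in> carrier N"
  shows "act ((g - free_scalar c) ^ CHAR('k)) x =
    act (g ^ CHAR('k)) x \<oplus>\<^bsub>N\<^esub> act (free_scalar ((- c) ^ CHAR('k))) x"
proof -
  have neg: "free_scalar (- c) = - (free_scalar c :: 'v free_word \<Rightarrow>\<^sub>0 'k)"
    by (simp add: free_scalar_def single_uminus)
  have pow: "free_scalar d ^ m = (free_scalar (d ^ m) :: 'v free_word \<Rightarrow>\<^sub>0 'k)" for d m
    by (induction m) (simp_all add: free_scalar.s_one free_scalar.s_mult)
  have char: "of_nat CHAR('k) = (0 :: 'v free_word \<Rightarrow>\<^sub>0 'k)"
  proof -
    have "of_nat CHAR('k) = (single 0 (of_nat CHAR('k)) :: 'v free_word \<Rightarrow>\<^sub>0 'k)"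
      by (rule single_of_nat[symmetric])
    then show ?thesis
      by (simp only: of_nat_CHAR single_zero)
  qed
  have eq: "g - free_scalar c = g + free_scalar (- c)"
    by (simp add: neg)
  have "(g - free_scalar c) ^ CHAR('k) = g ^ CHAR('k) + free_scalar (- c) ^ CHAR('k)"
    unfolding eq
    by (rule freshmans_dream_commuting[OF prime char free_scalar_central[symmetric]])
      (rule free_scalar.s_one free_scalar.s_add free_scalar.s_mult)+
  then show ?thesis
    using g x by (simp add: act_add pow)
qed

end

section \<open>Weight vectors in modules over U_chi(W_n)\<close>

locale witt_module = witt_character \<chi> n + u_module "witt_lie n (-1)" \<chi> N
  for \<chi> :: "'k::alg_closed_field witt \<Rightarrow> 'k" and n :: nat
    and N :: "(('k witt free_word \<Rightarrow>\<^sub>0 'k) set set, 'm) module"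
begin

definition weight_vector :: "'k \<Rightarrow> 'm \<Rightarrow> bool" where
  "weight_vector l v \<longleftrightarrow> v \<in> carrier N \<and>
     (\<forall>x\<in>witt_filt n 0. act (free_gen x) v = act (free_scalar (weight_form n \<chi> l x)) v)"

text \<open>The basis vectors of \<open>W\<^bsub>n,(0)\<^esub>\<close>, numbered so that brackets add the numbers.\<close>

definition ebase :: "nat \<Rightarrow> 'k witt" where
  "ebase t = witt_e n (int (t div Suc n)) (t mod Suc n)"

definition nbase :: nat where
  "nbase = (CHAR('k) - 1) * Suc n"

text \<open>The number t serves directly as index of \<open>weight_coeffs\<close>: these scalars
  vanish at 0 and beyond n, so exactly the e_0 t^k with 0 < k are shifted, by the scalar with which
  they should act, while the e_i t^k with i > 0 stay unshifted.\<close>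

definition shifted :: "nat \<Rightarrow> 'k witt free_word \<Rightarrow>\<^sub>0 'k" where
  "shifted t = free_gen (ebase t) - free_scalar (weight_coeffs n \<chi> t)"

lemma ebase_space [simp]: "ebase t \<in> witt_filt n (-1)"
  by (simp add: ebase_def witt_e_in_space)

lemma shifted_closed [simp]: "shifted t \<in> carrier (free_algebra (witt_filt n (-1)))"
  by (simp add: shifted_def free_algebra_closed)

lemma n_less_nbase: "n < nbase"
proof -
  have "1 * Suc n \<le> nbase"
    unfolding nbase_def using p_gt_3 by (intro mult_right_mono) auto
  then show ?thesis by simp
qed

lemma shifted_kernel_iff:
  "x \<in> carrier N \<Longrightarrow> act (shifted t) x = \<zero>\<^bsub>N\<^esub> \<longleftrightarrow>
    act (free_gen (ebase t)) x = act (free_scalar (weight_coeffs n \<chi> t)) x"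
  unfolding shifted_def by (intro act_diff_eq_zero_iff) simp_all

lemma ebase_range:
  assumes "t < nbase"
  shows "in_range TYPE('k) n (int (t div Suc n)) (t mod Suc n)"
proof -
  have "t div Suc n < CHAR('k) - 1"
    using assms unfolding nbase_def by (rule less_mult_imp_div_less)
  moreover have "t mod Suc n \<le> n"
    by (simp add: less_Suc_eq_le[symmetric])
  ultimately show ?thesis
    using p_gt_3 by (auto simp: in_range_def)
qed

text \<open>A nonzero bracket requires different i and j, hence i + j > 0 and u + t > n. So brackets
  fall among the unshifted vectors. The numbers add without carry because k + m is at most
  n.\<close>

lemma ebase_bracket:
  assumes "u < nbase" "t < nbase"
  shows "witt_bracket n (ebase u) (ebase t) = 0 \<or>
    (n < u + t \<and> u + t < nbase \<and> (\<exists>c. witt_bracket n (ebase u) (ebase t) = pm_scale c (ebase (u + t))))"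
proof -
  define i k where "i = u div Suc n" and "k = u mod Suc n"
  define j m where "j = t div Suc n" and "m = t mod Suc n"
  have u: "u = i * Suc n + k" and t: "t = j * Suc n + m"
    by (simp_all only: i_def k_def j_def m_def div_mult_mod_eq)
  have br: "witt_bracket n (ebase u) (ebase t) = pm_scale (of_int (int j - int i)) (witt_e n (int i + int j) (k + m))"
    using witt_bracket_e[OF ebase_range[OF assms(1)] ebase_range[OF assms(2)]]
    by (simp only: ebase_def i_def k_def j_def m_def)
  show ?thesis
  proof (cases "i = j \<or> \<not> in_range TYPE('k) n (int i + int j) (k + m)")
    case True
    then show ?thesis
      unfolding br by (auto simp: witt_e_eq)
  next
    case False
    then have r: "k + m < Suc n" "i + j < CHAR('k) - 1" "i \<noteq> j"
      by (auto simp: in_range_def)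
    have ut: "u + t = (i + j) * Suc n + (k + m)"
      by (simp only: u t) (simp add: algebra_simps)
    have "(u + t) div Suc n = i + j" "(u + t) mod Suc n = k + m"
      unfolding ut using r(1) by (simp_all only: div_mult_self3 mod_mult_self3 div_less mod_less add_0_right nat.simps not_False_eq_True)
    then have "ebase (u + t) = witt_e n (int i + int j) (k + m)"
      by (simp only: ebase_def of_nat_add)
    moreover have "u + t < nbase"
    proof -
      have "Suc (i + j) * Suc n \<le> nbase"
        unfolding nbase_def using r(2) by (intro mult_right_mono) auto
      then show ?thesis
        using r(1) unfolding ut by simp
    qed
    moreover have "n < u + t"
    proof -
      have "1 * Suc n \<le> (i + j) * Suc n"
        using r(3) by (intro mult_right_mono) auto
      then show ?thesis
        unfolding ut by simp
    qed
    ultimately show ?thesis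
      unfolding br by metis
  qed
qed

lemma act_gen_zero [simp]: "x \<in> carrier N \<Longrightarrow> act (free_gen 0) x = \<zero>\<^bsub>N\<^esub>"
  using act_gen_scale[of 0 x 0] by simp

text \<open>The bracket is a multiple of the vector numbered u + t, which is unshifted, so on the
  kernel of \<open>shifted (u + t)\<close> it acts as zero.\<close>

lemma shifted_commute:
  assumes x: "x \<in> carrier N" and ut: "u < nbase" "t < nbase"
    and ker: "n < u + t \<Longrightarrow> u + t < nbase \<Longrightarrow> act (shifted (u + t)) x = \<zero>\<^bsub>N\<^esub>"
  shows "act (shifted u) (act (shifted t) x) = act (shifted t) (act (shifted u) x)"
proof -
  let ?u = "free_gen (ebase u) :: 'k witt free_word \<Rightarrow>\<^sub>0 'k" and ?t = "free_gen (ebase t) :: 'k witt free_word \<Rightarrow>\<^sub>0 'k"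
  have bracket: "act (free_gen (witt_bracket n (ebase u) (ebase t))) x = \<zero>\<^bsub>N\<^esub>"
    using ebase_bracket[OF ut]
  proof (elim disjE conjE exE)
    fix c assume c: "n < u + t" "u + t < nbase" "witt_bracket n (ebase u) (ebase t) = pm_scale c (ebase (u + t))"
    have "act (free_gen (ebase (u + t))) x = \<zero>\<^bsub>N\<^esub>"
      using ker[OF c(1,2)] x weight_coeffs(2)[OF c(1)] by (simp add: shifted_kernel_iff)
    then show ?thesis
      using act_gen_scale[of "ebase (u + t)" x c] x by (simp add: c(3))
  qed (use x in simp)
  have "act ?u (act ?t x) = act ?t (act ?u x)"
    using act_gen_bracket[of "ebase u" "ebase t" x] x bracket by simp
  then show ?thesis
    unfolding shifted_def using x by (intro act_shift_commute) simp_all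
qed

text \<open>On x the p-th power of the shifted vector is chi_(tp) + chi(e)^p - chi_t^p, because tp >
  t and x is already an eigenvector for the number tp. The equation that defines chi_t makes this
  zero; with chi_m = 0 for m > n it covers all t.\<close>

lemma shifted_power_CHAR:
  assumes t: "0 < t" "t < nbase" and x: "x \<in> carrier N"
    and ker: "\<And>u. t < u \<Longrightarrow> u < nbase \<Longrightarrow> act (shifted u) x = \<zero>\<^bsub>N\<^esub>"
  shows "act (shifted t ^ CHAR('k)) x = \<zero>\<^bsub>N\<^esub>"
proof -
  let ?c = "weight_coeffs n \<chi>"
  have "act (shifted t ^ CHAR('k)) x =
      act (free_gen (ebase t) ^ CHAR('k)) x \<oplus>\<^bsub>N\<^esub> act (free_scalar ((- ?c t) ^ CHAR('k))) x"
    unfolding shifted_def using x by (intro act_shift_power_CHAR prime) simp_all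
  also have "act (free_gen (ebase t) ^ CHAR('k)) x =
      act (free_gen (witt_pmap n (ebase t))) x \<oplus>\<^bsub>N\<^esub> act (free_scalar (\<chi> (ebase t) ^ CHAR('k))) x"
    using act_gen_pmap[of "ebase t" x] x by simp
  also have "act (free_gen (witt_pmap n (ebase t))) x = act (free_scalar (?c (t * CHAR('k)))) x"
  proof (cases "t \<le> n")
    case True
    then have e: "ebase t = witt_e n 0 t" and r: "in_range TYPE('k) n 0 t"
      using ebase_range[OF t(2)] by (simp_all add: ebase_def)
    have P: "witt_pmap n (ebase t) = witt_e n 0 (t * CHAR('k))"
      unfolding e witt_pmap_e[OF p_gt_2 r] by simp
    show ?thesis
    proof (cases "t * CHAR('k) \<le> n")
      case True
      then have "witt_pmap n (ebase t) = ebase (t * CHAR('k))"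
        unfolding P by (simp add: ebase_def)
      moreover have "act (shifted (t * CHAR('k))) x = \<zero>\<^bsub>N\<^esub>"
        using less_times_p[of t] t True n_less_nbase by (intro ker) auto
      ultimately show ?thesis
        using x by (simp add: shifted_kernel_iff)
    next
      case False
      then have "witt_pmap n (ebase t) = 0"
        unfolding P by (simp add: witt_e_eq in_range_def)
      then show ?thesis
        using False x weight_coeffs(2)[of "t * CHAR('k)"] by simp
    qed
  next
    case False
    then have "int (t div Suc n) \<noteq> 0"
      by (simp add: div_eq_0_iff)
    then have "witt_pmap n (ebase t) = 0"
      unfolding ebase_def witt_pmap_e[OF p_gt_2 ebase_range[OF t(2)]] by simp
    moreover have "n < t * CHAR('k)"
      using False less_times_p[of t] t(1) by linarith
    ultimately show ?thesis
      using x by (simp add: weight_coeffs(2))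
  qed
  also have "\<dots> \<oplus>\<^bsub>N\<^esub> act (free_scalar (\<chi> (ebase t) ^ CHAR('k))) x = act (free_scalar (?c t ^ CHAR('k))) x"
  proof (cases "t \<le> n")
    case True
    then have e: "ebase t = witt_e n 0 t"
      by (simp add: ebase_def)
    have "1 \<le> t"
      using t(1) by simp
    from weight_coeffs(3)[OF this True] show ?thesis
      by (simp only: e act_scalar_add[OF x])
  next
    case False
    then have "1 \<le> int (t div Suc n)"
      by (simp add: Suc_le_eq div_greater_zero_iff)
    then have "\<chi> (ebase t) = 0"
      unfolding ebase_def by (intro \<chi>_filt_1 witt_e_in_filt)
    moreover have "n < t * CHAR('k)"
      using False less_times_p[of t] t(1) by linarith
    moreover have "n < t"
      using False by simp
    ultimately show ?thesis
      using p_gt_3 by (simp only: weight_coeffs(2) act_scalar_add[OF x]) (simp add: power_0_left)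
  qed
  also have "\<dots> \<oplus>\<^bsub>N\<^esub> act (free_scalar ((- ?c t) ^ CHAR('k))) x =
      act (free_scalar ((?c t + - ?c t) ^ CHAR('k))) x"
    unfolding freshmans_dream[OF prime refl] using x by (rule act_scalar_add)
  finally show ?thesis
    using x p_gt_3 by (simp add: power_0_left)
qed

lemma act_eigen_power:
  assumes "f \<in> carrier F" "x \<in> carrier N" "act f x = act (free_scalar c) x"
  shows "act (f ^ m) x = act (free_scalar (c ^ m)) x"
proof (induction m)
  case (Suc m)
  have "act (f ^ Suc m) x = act f (act (f ^ m) x)"
    using assms act_mult[of f "f ^ m" x] by simp
  also have "\<dots> = act (free_scalar (c ^ m)) (act (free_scalar c) x)"
    unfolding Suc act_scalar_commute[OF assms(1,2)] assms(3) ..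
  finally show ?case
    unfolding act_scalar_mult[OF assms(2)] by (simp only: power_Suc mult.commute)
qed (use assms in simp)

lemma weight_vectorI:
  assumes y: "y \<in> carrier N"
    and y0: "act (free_gen (witt_e n 0 0)) y = act (free_scalar l) y"
    and ker: "\<And>t. 0 < t \<Longrightarrow> t < nbase \<Longrightarrow> act (shifted t) y = \<zero>\<^bsub>N\<^esub>"
  shows "weight_vector l y"
proof -
  have "-1 \<le> (0::int)" by simp
  have "act (free_gen x) y = act (free_scalar (weight_form n \<chi> l x)) y" if "x \<in> witt_filt n 0" for x
    using that \<open>-1 \<le> (0::int)\<close>
  proof (induction x rule: witt_filt_induct)
    case zero
    then show ?case
      using y by (simp add: weight_form_def)
  next
    case (e i k)
    have k: "k < Suc n" and i: "nat i < CHAR('k) - 1"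
      using e by (auto simp: in_range_def)
    define t where "t = nat i * Suc n + k"
    have dm: "t div Suc n = nat i" "t mod Suc n = k"
      unfolding t_def using k by (simp_all only: div_mult_self3 mod_mult_self3 div_less mod_less add_0_right nat.simps not_False_eq_True)
    have et: "ebase t = witt_e n i k"
      unfolding ebase_def dm using e(1) by simp
    have "Suc (nat i) * Suc n \<le> nbase"
      unfolding nbase_def using i by (intro mult_right_mono) auto
    then have t: "t < nbase"
      using k unfolding t_def by simp
    show ?case
    proof (cases "t = 0")
      case True
      then have "i = 0" "k = 0"
        using dm e(1) by auto
      then show ?thesis
        using y0 e by (simp add: weight_form_e)
    next
      case False
      have "act (free_gen (witt_e n i k)) y = act (free_scalar (weight_coeffs n \<chi> t)) y"
        using ker[OF _ t] False y by (simp add: shifted_kernel_iff et)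
      moreover have "weight_coeffs n \<chi> t = weight_form n \<chi> l (witt_e n i k)"
      proof (cases "i = 0")
        case True
        then show ?thesis
          using False e by (simp add: weight_form_e t_def)
      next
        case False
        then have "1 * Suc n \<le> nat i * Suc n"
          using e(1) by (intro mult_right_mono) auto
        then have "n < t"
          by (simp add: t_def)
        then show ?thesis
          using False e by (simp add: weight_form_e weight_coeffs(2))
      qed
      ultimately show ?thesis by simp
    qed
  next
    case (scale c z)
    then have "z \<in> witt_filt n (-1)"
      using witt_filt_mono[of "-1" 0 n] by auto
    then show ?case
      using act_gen_scale[of z y c] scale y by (simp add: weight_form_scale act_scalar_mult)
  next
    case (add z w)
    then have "z \<in> witt_filt n (-1)" "w \<in> witt_filt n (-1)"
      using witt_filt_mono[of "-1" 0 n] by auto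
    then show ?case
      using act_gen_add[of z w y] add y by (simp add: weight_form_add act_scalar_add)
  qed
  then show ?thesis
    using y by (simp add: weight_vector_def)
qed

text \<open>The Engel step covers the numbers t > 0. The vector e_0 is left out because T^p - T =
  chi(e_0)^p has several roots, so no single shift makes it nilpotent. It preserves the common
  kernel of the others, and an eigenvector is found inside that kernel.\<close>

theorem weight_vector_exists:
  assumes H: "submodule H U N" "H \<noteq> {\<zero>\<^bsub>N\<^esub>}"
  obtains l v where "l \<in> weights n \<chi>" "v \<in> H" "v \<noteq> \<zero>\<^bsub>N\<^esub>" "weight_vector l v"
proof -
  have HN: "H \<subseteq> carrier N"
    by (rule submodule_subset[OF H(1)])
  obtain x where x: "x \<in> H" "x \<noteq> \<zero>\<^bsub>N\<^esub>" "\<And>t. 0 < t \<Longrightarrow> t < nbase \<Longrightarrow> act (shifted t) x = \<zero>\<^bsub>N\<^esub>"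
  proof (rule common_kernel[OF H, of shifted nbase "CHAR('k)"])
    fix t x u
    assume t: "0 < t" "t < nbase" "x \<in> carrier N" and u: "t < u" "u < nbase"
      and ker: "\<And>u. t < u \<Longrightarrow> u < nbase \<Longrightarrow> act (shifted u) x = \<zero>\<^bsub>N\<^esub>"
    have "act (shifted u) (act (shifted t) x) = act (shifted t) (act (shifted u) x)"
      using t u by (intro shifted_commute ker) auto
    then show "act (shifted u) (act (shifted t) x) = \<zero>\<^bsub>N\<^esub>"
      using ker[OF u] by simp
  next
    fix t x
    assume "0 < t" "t < nbase" "x \<in> carrier N"
      "\<And>u. t < u \<Longrightarrow> u < nbase \<Longrightarrow> act (shifted u) x = \<zero>\<^bsub>N\<^esub>"
    then show "act (shifted t ^ CHAR('k)) x = \<zero>\<^bsub>N\<^esub>"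
      by (rule shifted_power_CHAR)
  qed (auto intro: that)
  define K where "K = {y \<in> H. \<forall>t. 0 < t \<and> t < nbase \<longrightarrow> act (shifted t) y = \<zero>\<^bsub>N\<^esub>}"
  define a where "a = (free_gen (witt_e n 0 0) :: 'k witt free_word \<Rightarrow>\<^sub>0 'k)"
  define c where "c = \<chi> (witt_e n 0 0) ^ CHAR('k)"
  \<comment> \<open>T^p - T - chi(e_0)^p annihilates e_0 by the p-relation, since e_0^[p] =
    e_0.\<close>
  define q where "q = monom 1 (CHAR('k)) + (Polynomial.smult (-1) (monom 1 1) + [:- c:])"
  have a: "a \<in> carrier F"
    by (simp add: a_def witt_e_in_space)
  have a0: "a = shifted 0"
    by (simp add: a_def shifted_def ebase_def weight_coeffs(1) free_scalar.s_zero)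
  have r0: "in_range TYPE('k) n 0 0"
    using p_gt_3 by (simp add: in_range_def)
  have ap: "act (a ^ CHAR('k)) y = act a y \<oplus>\<^bsub>N\<^esub> act (free_scalar c) y" if "y \<in> carrier N" for y
    using act_gen_pmap[of "witt_e n 0 0" y] that witt_pmap_e[OF p_gt_2 r0]
    by (simp add: a_def c_def witt_e_in_space)
  have "\<exists>l. \<exists>y\<in>K. y \<noteq> \<zero>\<^bsub>N\<^esub> \<and> act a y = act (free_scalar l) y"
  proof (rule eigenvector_exists[OF alg_closed_imp_poly_has_root a, of q])
    have "coeff q (CHAR('k)) = 1"
      using p_gt_3 by (simp add: q_def coeff_pCons split: nat.split)
    then show "q \<noteq> 0" by auto
    show "K \<subseteq> carrier N"
      using HN by (auto simp: K_def)
    show "x \<in> K" "x \<noteq> \<zero>\<^bsub>N\<^esub>"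
      using x by (auto simp: K_def)
    show "act (free_scalar d) y \<in> K" if "y \<in> K" for d y
      using that HN submodule_act[OF H(1), of "free_scalar d" y]
      by (auto simp: K_def act_scalar_commute subset_iff)
    show "y \<oplus>\<^bsub>N\<^esub> z \<in> K" if "y \<in> K" "z \<in> K" for y z
      using that HN subgroup.m_closed[OF submodule.axioms(1)[OF H(1)], of y z]
      by (auto simp: K_def act_add_right subset_iff)
    show "act a y \<in> K" if y: "y \<in> K" for y
    proof -
      have yN: "y \<in> carrier N"
        using y HN by (auto simp: K_def)
      have "act (shifted t) (act a y) = \<zero>\<^bsub>N\<^esub>" if t: "0 < t" "t < nbase" for t
      proof -
        have ker: "act (shifted t) y = \<zero>\<^bsub>N\<^esub>"
          using y t by (simp add: K_def)
        have "act (shifted t) (act (shifted 0) y) = act (shifted 0) (act (shifted t) y)"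
          using t ker by (intro shifted_commute yN) auto
        then show ?thesis
          using ker by (simp add: a0)
      qed
      then show ?thesis
        using y submodule_act[OF H(1) a, of y] by (auto simp: K_def)
    qed
    have xN: "x \<in> carrier N"
      using x(1) HN by auto
    have pe: "free_scalar.poly_eval a q = a ^ CHAR('k) + (free_scalar (- 1) * a + free_scalar (- c))"
      unfolding q_def free_scalar.poly_eval_add free_scalar.poly_eval_smult free_scalar.poly_eval_monom
      by (simp add: free_scalar.poly_eval_def)
    have "act (free_scalar.poly_eval a q) x =
        act (a ^ CHAR('k)) x \<oplus>\<^bsub>N\<^esub> (act (free_scalar (- 1)) (act a x) \<oplus>\<^bsub>N\<^esub> act (free_scalar (- c)) x)"
      unfolding pe using a xN free_algebra_closed(4)[of "free_scalar (- 1)" _ a]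
      by (simp add: act_add act_mult free_algebra_closed)
    also have "\<dots> = (act a x \<oplus>\<^bsub>N\<^esub> act (free_scalar (- 1)) (act a x)) \<oplus>\<^bsub>N\<^esub>
        (act (free_scalar c) x \<oplus>\<^bsub>N\<^esub> act (free_scalar (- c)) x)"
      using a xN by (simp add: ap N.M.a_ac)
    also have "act a x \<oplus>\<^bsub>N\<^esub> act (free_scalar (- 1)) (act a x) = \<zero>\<^bsub>N\<^esub>"
      using act_scalar_add[of "act a x" 1 "- 1"] a xN by simp
    also have "act (free_scalar c) x \<oplus>\<^bsub>N\<^esub> act (free_scalar (- c)) x = \<zero>\<^bsub>N\<^esub>"
      using xN by (simp add: act_scalar_add)
    finally show "act (free_scalar.poly_eval a q) x = \<zero>\<^bsub>N\<^esub>"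
      by simp
  qed
  then obtain l y where y: "y \<in> K" "y \<noteq> \<zero>\<^bsub>N\<^esub>" "act a y = act (free_scalar l) y"
    by blast
  have yN: "y \<in> carrier N"
    using y(1) HN by (auto simp: K_def)
  \<comment> \<open>On a nonzero eigenvector the p-relation of e_0 turns into the equation that
    defines the set of weights.\<close>
  have "act (free_scalar (l ^ CHAR('k))) y = act (free_scalar (l + c)) y"
    using act_eigen_power[OF a yN y(3), of "CHAR('k)"] ap[OF yN] yN y(3) by (simp add: act_scalar_add)
  then have "act (free_scalar (l ^ CHAR('k)) - free_scalar (l + c)) y = \<zero>\<^bsub>N\<^esub>"
    using yN by (subst act_diff_eq_zero_iff) simp_all
  then have "act (free_scalar (l ^ CHAR('k) - (l + c))) y = \<zero>\<^bsub>N\<^esub>"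
    by (simp add: free_scalar_def single_diff)
  then have "l ^ CHAR('k) - (l + c) = 0"
    using act_scalar_eq_zero[OF yN] y(2) by blast
  then have l: "l \<in> weights n \<chi>"
    by (simp add: weights_def c_def algebra_simps)
  show ?thesis
  proof (rule that[OF l _ y(2)])
    show "y \<in> H"
      using y(1) by (simp add: K_def)
    show "weight_vector l y"
      using y yN by (intro weight_vectorI) (auto simp: K_def a_def)
  qed
qed

end

section \<open>The reduced Verma modules\<close>

context scalar_hom
begin

lemma alg_eval_prod_list: "alg_eval r (prod_list fs) = prod_list (map (alg_eval r) fs)"
  by (induction fs) (simp_all add: alg_eval_mult)

lemma alg_eval_sum: "alg_eval r (\<Sum>i\<in>A. f i) = (\<Sum>i\<in>A. alg_eval r (f i))"
  by (induction A rule: infinite_finite_induct) (simp_all add: alg_eval_add)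

end

context closed_lie
begin

lemma uq_diff_eq_zero_iff:
  assumes "f \<in> carrier F" "g \<in> carrier F"
  shows "uq L \<chi> (f - g) = \<zero>\<^bsub>U\<^esub> \<longleftrightarrow> uq L \<chi> f = uq L \<chi> g"
proof -
  have d: "f - g \<in> carrier F"
    using assms by (rule free_algebra_closed(2))
  have "uq L \<chi> f = uq L \<chi> (f - g) \<oplus>\<^bsub>U\<^esub> uq L \<chi> g"
    using uq.hom_add[OF d assms(2)] by simp
  then show ?thesis
    using uq_closed[OF d] uq_closed[OF assms(2)] U.add.r_cancel_one[of "uq L \<chi> g" "uq L \<chi> (f - g)"]
    by (metis U.l_zero)
qed

end

context u_module
begin

lemma act_commute_power:
  assumes "f \<in> carrier F" "g \<in> carrier F" "\<And>y. y \<in> carrier N \<Longrightarrow> act f (act g y) = act g (act f y)" "x \<in> carrier N"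
  shows "act f (act (g ^ m) x) = act (g ^ m) (act f x)"
proof (induction m)
  case (Suc m)
  have "act (g ^ Suc m) y = act g (act (g ^ m) y)" if "y \<in> carrier N" for y
    using act_mult[of g "g ^ m" y] assms(2) that by simp
  then show ?case
    using Suc assms by simp
qed (use assms in simp)

lemma act_commute_prod_list:
  assumes "f \<in> carrier F" "\<And>g. g \<in> set gs \<Longrightarrow> g \<in> carrier F"
    "\<And>g y. g \<in> set gs \<Longrightarrow> y \<in> carrier N \<Longrightarrow> act f (act g y) = act g (act f y)" "x \<in> carrier N"
  shows "prod_list gs \<in> carrier F" "act f (act (prod_list gs) x) = act (prod_list gs) (act f x)"
proof -
  have "prod_list gs \<in> carrier F \<and> act f (act (prod_list gs) x) = act (prod_list gs) (act f x)"
    using assms(2,3)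
  proof (induction gs)
    case (Cons g gs)
    then have IH: "prod_list gs \<in> carrier F" "act f (act (prod_list gs) x) = act (prod_list gs) (act f x)"
      and g: "g \<in> carrier F"
      by simp_all
    have "act (prod_list (g # gs)) y = act g (act (prod_list gs) y)" if "y \<in> carrier N" for y
      using act_mult[OF g IH(1) that] by simp
    then show ?case
      using Cons.prems(2)[of g "act (prod_list gs) x"] IH g assms(1,4) by (simp add: free_algebra_closed)
  qed (use assms(1,4) in simp)
  then show "prod_list gs \<in> carrier F" "act f (act (prod_list gs) x) = act (prod_list gs) (act f x)"
    by simp_all
qed

end

context witt_module
begin

text \<open>Links weight vectors to the one-dimensional module: it yields both the well-definedness
  of that module and the linearity required by the universal property of the Verma module.\<close>

lemma weight_vector_free_eval:
  assumes w: "weight_vector l w" and g: "g \<in> carrier (free_algebra (witt_filt n 0))"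
  shows "act g w = act (free_scalar (free_eval (weight_form n \<chi> l) g)) w"
proof -
  have sub: "witt_filt n 0 \<subseteq> (witt_filt n (-1) :: 'k witt set)"
    by (rule witt_filt_mono) simp
  have wN: "w \<in> carrier N"
    using w by (simp add: weight_vector_def)
  show ?thesis
    using g unfolding free_eval_eq_alg_eval
  proof (induction g rule: free_algebra_induct)
    case (gen_mult x g)
    have x: "free_gen x \<in> carrier F" and g: "g \<in> carrier F"
      using gen_mult sub free_algebra_mono[OF sub gen_mult(2)] by auto
    have "act (free_gen x * g) w = act (free_gen x) (act (free_scalar (id_scalar.alg_eval (weight_form n \<chi> l) g)) w)"
      using act_mult[OF x g wN] gen_mult(3) by simp
    also have "\<dots> = act (free_scalar (id_scalar.alg_eval (weight_form n \<chi> l) g)) (act (free_gen x) w)"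
      by (rule act_scalar_commute[OF x wN])
    also have "act (free_gen x) w = act (free_scalar (weight_form n \<chi> l x)) w"
      using w gen_mult(1) by (simp add: weight_vector_def)
    finally show ?case
      by (simp only: act_scalar_mult[OF wN] id_scalar.alg_eval_mult id_scalar.alg_eval_gen mult.commute)
  next
    case (add g h)
    have "g \<in> carrier F" "h \<in> carrier F"
      using free_algebra_mono[OF sub add(1)] free_algebra_mono[OF sub add(2)] by simp_all
    then show ?case
      using add wN by (simp add: act_add act_scalar_add id_scalar.alg_eval_add)
  qed simp
qed

section \<open>Spanning by ordered monomials in the z_j\<close>

definition zgen :: "nat \<Rightarrow> 'k witt free_word \<Rightarrow>\<^sub>0 'k" where
  "zgen j = free_gen (witt_e n (-1) j) - free_scalar (\<chi> (witt_e n (-1) j))"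

definition zprod :: "nat \<Rightarrow> multi_exp \<Rightarrow> 'k witt free_word \<Rightarrow>\<^sub>0 'k" where
  "zprod m a = prod_list (map (\<lambda>j. zgen j ^ a j) [0..<m])"

lemma zgen_closed [simp]: "zgen j \<in> carrier (free_algebra (witt_filt n (-1)))"
  by (simp add: zgen_def witt_e_in_space free_algebra_closed)

lemma zprod_Suc: "zprod (Suc m) a = zprod m a * zgen m ^ a m"
  by (simp add: zprod_def)

lemma zprod_closed [simp]: "zprod m a \<in> carrier (free_algebra (witt_filt n (-1)))"
  by (induction m) (simp_all add: zprod_Suc free_algebra_closed, simp add: zprod_def)

lemma zgen_commute:
  assumes x: "x \<in> carrier N"
  shows "act (zgen i) (act (zgen j) x) = act (zgen j) (act (zgen i) x)"
proof -
  have "witt_bracket n (witt_e n (-1) i) (witt_e n (-1) j) = (0 :: 'k witt)"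
    by (cases "in_range TYPE('k) n (-1) i \<and> in_range TYPE('k) n (-1) j")
      (auto simp: witt_bracket_e, auto simp: witt_e_eq)
  then have "act (free_gen (witt_e n (-1) i)) (act (free_gen (witt_e n (-1) j)) x) =
      act (free_gen (witt_e n (-1) j)) (act (free_gen (witt_e n (-1) i)) x)"
    using act_gen_bracket[of "witt_e n (-1) i" "witt_e n (-1) j" x] x by (simp add: witt_e_in_space)
  then show ?thesis
    unfolding zgen_def using x by (intro act_shift_commute) (simp_all add: witt_e_in_space)
qed

lemma zgen_power_CHAR:
  assumes x: "x \<in> carrier N" and j: "j \<le> n"
  shows "act (zgen j ^ CHAR('k)) x = \<zero>\<^bsub>N\<^esub>"
proof -
  let ?e = "witt_e n (-1) j :: 'k witt"
  have "in_range TYPE('k) n (-1) j"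
    using j p_gt_3 by (simp add: in_range_def)
  then have P: "witt_pmap n ?e = 0"
    by (simp add: witt_pmap_e[OF p_gt_2])
  have "act (zgen j ^ CHAR('k)) x = act (free_gen ?e ^ CHAR('k)) x \<oplus>\<^bsub>N\<^esub> act (free_scalar ((- \<chi> ?e) ^ CHAR('k))) x"
    unfolding zgen_def using x by (intro act_shift_power_CHAR prime) (simp_all add: witt_e_in_space)
  also have "act (free_gen ?e ^ CHAR('k)) x = act (free_scalar (\<chi> ?e ^ CHAR('k))) x"
    using act_gen_pmap[of ?e x] x by (simp add: P witt_e_in_space)
  also have "\<dots> \<oplus>\<^bsub>N\<^esub> act (free_scalar ((- \<chi> ?e) ^ CHAR('k))) x =
      act (free_scalar ((\<chi> ?e + - \<chi> ?e) ^ CHAR('k))) x"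
    unfolding freshmans_dream[OF prime refl] using x by (rule act_scalar_add)
  finally show ?thesis
    using x p_gt_3 by (simp add: power_0_left)
qed

lemma act_zprod_Suc:
  "x \<in> carrier N \<Longrightarrow> act (zprod (Suc m) a) x = act (zprod m a) (act (zgen m ^ a m) x)"
  unfolding zprod_Suc by (rule act_mult) simp_all

text \<open>The z_j commute on the module, so a new factor can be moved to its place in the ordered
  product.\<close>

lemma act_zgen_zprod:
  assumes "x \<in> carrier N" "j < m"
  shows "act (zgen j) (act (zprod m a) x) = act (zprod m (a(j := Suc (a j)))) x"
  using assms
proof (induction m arbitrary: x)
  case (Suc m)
  have y: "act (zgen m ^ a m) x \<in> carrier N"
    using Suc.prems by simp
  show ?case
  proof (cases "j = m")
    case True
    have "zprod m (a(m := Suc (a m))) = zprod m a"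
      unfolding zprod_def by (intro arg_cong[of _ _ prod_list] map_cong) auto
    moreover have "act (zgen m) (act (zprod m a) (act (zgen m ^ a m) x)) =
        act (zprod m a) (act (zgen m) (act (zgen m ^ a m) x))"
      unfolding zprod_def
    proof (rule act_commute_prod_list(2)[OF _ _ _ y])
      fix g z assume g: "g \<in> set (map (\<lambda>j. zgen j ^ a j) [0..<m])" and z: "z \<in> carrier N"
      then obtain i where "g = zgen i ^ a i" by auto
      then show "act (zgen m) (act g z) = act g (act (zgen m) z)"
        using z by (auto intro!: act_commute_power zgen_commute)
    qed auto
    moreover have "act (zgen m ^ Suc (a m)) x = act (zgen m) (act (zgen m ^ a m) x)"
      using act_mult[of "zgen m" "zgen m ^ a m" x] Suc.prems by simp
    ultimately show ?thesis
      using act_zprod_Suc[OF Suc.prems(1), of m "a(m := Suc (a m))"]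
      by (simp only: True act_zprod_Suc[OF Suc.prems(1)] fun_upd_same)
  next
    case False
    then show ?thesis
      using Suc.IH[OF y] Suc.prems by (simp add: act_zprod_Suc)
  qed
qed simp

lemma act_zprod_eq_zero:
  assumes "x \<in> carrier N" "j < m" "m \<le> Suc n" "a j = CHAR('k)"
  shows "act (zprod m a) x = \<zero>\<^bsub>N\<^esub>"
  using assms(1-3)
proof (induction m arbitrary: x)
  case (Suc m)
  show ?case
  proof (cases "j = m")
    case True
    then show ?thesis
      using Suc.prems assms(4) by (simp add: act_zprod_Suc zgen_power_CHAR)
  next
    case False
    then show ?thesis
      using Suc by (simp add: act_zprod_Suc)
  qed
qed simp

text \<open>Normally ordered elements with coefficients \<open>c\<close>, in the variables \<open>z\<^sub>j = e\<^bsub>-1\<^esub>t\<^sup>j - \<chi>(e\<^bsub>-1\<^esub>t\<^sup>j)\<close>.\<close>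

definition zsum :: "(multi_exp \<Rightarrow> 'k) \<Rightarrow> 'k witt free_word \<Rightarrow>\<^sub>0 'k" where
  "zsum c = (\<Sum>a\<in>box CHAR('k) n. free_scalar (c a) * zprod (Suc n) a)"

lemma zsum_closed [simp]: "zsum c \<in> carrier (free_algebra (witt_filt n (-1)))"
  unfolding zsum_def by (intro free_algebra_closed_sum free_algebra_closed(4)) simp_all

definition zspan :: "'m \<Rightarrow> 'm set" where
  "zspan v = range (\<lambda>c. act (zsum c) v)"

lemma zspan_add:
  assumes "v \<in> carrier N" "x \<in> zspan v" "y \<in> zspan v"
  shows "x \<oplus>\<^bsub>N\<^esub> y \<in> zspan v"
proof -
  obtain c d where "x = act (zsum c) v" "y = act (zsum d) v"
    using assms(2,3) by (auto simp: zspan_def)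
  moreover have "zsum (\<lambda>a. c a + d a) = zsum c + zsum d"
    by (simp add: zsum_def free_scalar.s_add distrib_right sum.distrib)
  ultimately have "x \<oplus>\<^bsub>N\<^esub> y = act (zsum (\<lambda>a. c a + d a)) v"
    using assms(1) by (simp add: act_add)
  then show ?thesis
    by (auto simp: zspan_def)
qed

lemma zspan_scalar:
  assumes "v \<in> carrier N" "x \<in> zspan v"
  shows "act (free_scalar d) x \<in> zspan v"
proof -
  obtain c where "x = act (zsum c) v"
    using assms(2) by (auto simp: zspan_def)
  moreover have "zsum (\<lambda>a. d * c a) = free_scalar d * zsum c"
    by (simp add: zsum_def free_scalar.s_mult sum_distrib_left mult.assoc)
  ultimately have "act (free_scalar d) x = act (zsum (\<lambda>a. d * c a)) v"
    using assms(1) by (simp add: act_mult)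
  then show ?thesis
    by (auto simp: zspan_def)
qed

lemma zspan_zero: "v \<in> carrier N \<Longrightarrow> \<zero>\<^bsub>N\<^esub> \<in> zspan v"
  using zspan_scalar[of v "act (zsum (\<lambda>_. 0)) v" 0] by (auto simp: zspan_def)

lemma zspan_zprod:
  assumes "v \<in> carrier N" "a \<in> box CHAR('k) n"
  shows "act (zprod (Suc n) a) v \<in> zspan v"
proof -
  have "zsum (\<lambda>b. if b = a then 1 else 0) = (\<Sum>b\<in>box CHAR('k) n. if b = a then zprod (Suc n) b else 0)"
    unfolding zsum_def by (intro sum.cong) (auto simp: free_scalar.s_one free_scalar.s_zero)
  also have "\<dots> = zprod (Suc n) a"
    using assms(2) finite_box by simp
  finally show ?thesis
    unfolding zspan_def by (metis rangeI)
qed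

text \<open>Multiplication by z_j either keeps a monomial in the box or raises an exponent to p, and
  then the monomial acts as zero.\<close>

lemma zspan_zgen:
  assumes v: "v \<in> carrier N" and x: "x \<in> zspan v" and j: "j \<le> n"
  shows "act (zgen j) x \<in> zspan v"
proof -
  obtain c where c: "x = act (zsum c) v"
    using x by (auto simp: zspan_def)
  have "act (zgen j) (act (\<Sum>a\<in>A. free_scalar (c a) * zprod (Suc n) a) v) \<in> zspan v"
    if "A \<subseteq> box CHAR('k) n" "finite A" for A
    using that(2,1)
  proof (induction A)
    case empty
    then show ?case
      using v by (simp add: zspan_zero)
  next
    case (insert a A)
    have "act (zgen j) (act (zprod (Suc n) a) v) \<in> zspan v"
    proof (cases "Suc (a j) = CHAR('k)")
      case True
      then show ?thesis
        using v j act_zprod_eq_zero[of v j "Suc n" "a(j := Suc (a j))"]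
        by (simp add: act_zgen_zprod zspan_zero)
    next
      case False
      then have "Suc (a j) < CHAR('k)"
        using insert.prems j by (auto simp: box_def intro: Suc_lessI)
      then have "a(j := Suc (a j)) \<in> box CHAR('k) n"
        using insert.prems j by (auto simp: box_def)
      then show ?thesis
        using v j by (simp add: act_zgen_zprod zspan_zprod)
    qed
    then have "act (free_scalar (c a)) (act (zgen j) (act (zprod (Suc n) a) v)) \<in> zspan v"
      by (rule zspan_scalar[OF v])
    moreover have "act (zgen j) (act (free_scalar (c a) * zprod (Suc n) a) v) =
        act (free_scalar (c a)) (act (zgen j) (act (zprod (Suc n) a) v))"
      using v by (simp add: act_mult act_scalar_commute)
    moreover have "act (zgen j) (act (\<Sum>a\<in>insert a A. free_scalar (c a) * zprod (Suc n) a) v) =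
        act (zgen j) (act (free_scalar (c a) * zprod (Suc n) a) v) \<oplus>\<^bsub>N\<^esub>
        act (zgen j) (act (\<Sum>a\<in>A. free_scalar (c a) * zprod (Suc n) a) v)"
    proof -
      have "(\<Sum>a\<in>A. free_scalar (c a) * zprod (Suc n) a) \<in> carrier (free_algebra (witt_filt n (-1)))"
        by (intro free_algebra_closed_sum free_algebra_closed(4)) simp_all
      then show ?thesis
        using v insert(1,2) by (simp add: act_add act_add_right free_algebra_closed(4))
    qed
    ultimately show ?case
      using insert zspan_add[OF v] by simp
  qed
  from this[OF order_refl finite_box] show ?thesis
    by (simp add: c zsum_def)
qed

text \<open>Inductive, so that stability under W_n can be proved along the construction of an
  element by moving a Lie element inwards, before any normal form is chosen.\<close>

inductive_set yspan :: "'m \<Rightarrow> 'm set" for v :: 'm where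
  base: "v \<in> yspan v"
| gen: "x \<in> yspan v \<Longrightarrow> j \<le> n \<Longrightarrow> act (free_gen (witt_e n (-1) j)) x \<in> yspan v"
| add: "x \<in> yspan v \<Longrightarrow> y \<in> yspan v \<Longrightarrow> x \<oplus>\<^bsub>N\<^esub> y \<in> yspan v"
| scalar: "x \<in> yspan v \<Longrightarrow> act (free_scalar c) x \<in> yspan v"

lemma yspan_carrier: "v \<in> carrier N \<Longrightarrow> yspan v \<subseteq> carrier N"
proof
  fix x assume "x \<in> yspan v" "v \<in> carrier N"
  then show "x \<in> carrier N"
    by (induction rule: yspan.induct) (simp_all add: witt_e_in_space)
qed

lemma yspan_subset_zspan:
  assumes v: "v \<in> carrier N"
  shows "yspan v \<subseteq> zspan v"
proof
  fix x assume "x \<in> yspan v"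
  then show "x \<in> zspan v"
  proof (induction rule: yspan.induct)
    case base
    have "(\<lambda>_. 0) \<in> box CHAR('k) n"
      using p_gt_3 by (simp add: box_def)
    from zspan_zprod[OF v this] show ?case
      using v by (simp add: zprod_def map_replicate_const)
  next
    case (gen x j)
    have x: "x \<in> carrier N"
      using gen(1) yspan_carrier[OF v] by blast
    have "act (free_gen (witt_e n (-1) j)) x =
        act (zgen j) x \<oplus>\<^bsub>N\<^esub> act (free_scalar (\<chi> (witt_e n (-1) j))) x"
      using act_add[of "zgen j" "free_scalar (\<chi> (witt_e n (-1) j))" x] x by (simp add: zgen_def witt_e_in_space free_algebra_closed)
    then show ?case
      using zspan_add[OF v zspan_zgen[OF v gen(3,2)] zspan_scalar[OF v gen(3)]] by simp
  qed (simp_all add: v zspan_add zspan_scalar)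
qed

text \<open>Moving e_i t^k past e_(-1) t^j leaves a multiple of e_(i-1) t^(k+j). The induction
  hypothesis is stated for all i and k and covers this term too; at the innermost vector the weight
  condition takes over.\<close>

lemma yspan_submodule:
  assumes w: "weight_vector l v"
  shows "submodule (yspan v) U N"
proof -
  have v: "v \<in> carrier N"
    using w by (simp add: weight_vector_def)
  note carrier = subsetD[OF yspan_carrier[OF v]]
  have zero: "\<zero>\<^bsub>N\<^esub> \<in> yspan v"
    using yspan.scalar[OF yspan.base, of 0 v] v by simp
  have e: "act (free_gen (witt_e n i k)) x \<in> yspan v" if "x \<in> yspan v" for i k x
    using that
  proof (induction arbitrary: i k rule: yspan.induct)
    case base
    show ?case
    proof (cases "i = -1 \<and> k \<le> n")
      case True
      then show ?thesis
        using yspan.gen[OF yspan.base] by blast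
    next
      case False
      \<comment> \<open>The vector is out of range and hence zero, or i is at least 0.\<close>
      then have "witt_e n i k \<in> (witt_filt n 0 :: 'k witt set)"
        by (auto simp: witt_e_def witt_filt_def)
      then show ?thesis
        using w by (simp add: weight_vector_def yspan.scalar yspan.base)
    qed
  next
    case (gen x j)
    have x: "x \<in> carrier N"
      by (rule carrier[OF gen(1)])
    show ?case
    proof (cases "in_range TYPE('k) n i k")
      case False
      then show ?thesis
        using x zero by (simp add: witt_e_eq[of n i k] witt_e_in_space)
    next
      case True
      have "in_range TYPE('k) n (-1) j"
        using gen(2) p_gt_3 by (simp add: in_range_def)
      then have "act (free_gen (witt_e n i k)) (act (free_gen (witt_e n (-1) j)) x) =
          act (free_gen (witt_e n (-1) j)) (act (free_gen (witt_e n i k)) x) \<oplus>\<^bsub>N\<^esub>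
          act (free_scalar (of_int (-1 - i))) (act (free_gen (witt_e n (i + -1) (k + j))) x)"
        using act_gen_bracket[of "witt_e n i k" "witt_e n (-1) j" x]
          act_gen_scale[of "witt_e n (i + -1) (k + j)" x "of_int (-1 - i)"] x
        by (simp only: witt_bracket_e[OF True] witt_lie_simps witt_e_in_space)
      then show ?thesis
        using gen(2,3) by (simp only: yspan.intros)
    qed
  next
    case (add x y)
    then show ?case
      using carrier by (simp add: act_add_right yspan.add witt_e_in_space)
  next
    case (scalar x c)
    then show ?case
      using carrier by (simp add: act_scalar_commute yspan.scalar witt_e_in_space)
  qed
  have gens: "act (free_gen z) x \<in> yspan v" if z: "z \<in> witt_filt n (-1)" and x: "x \<in> yspan v" for z x
    using z
  proof (induction z rule: witt_space_induct)
    case zero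
    then show ?case
      using carrier[OF x] \<open>\<zero>\<^bsub>N\<^esub> \<in> yspan v\<close> by simp
  next
    case (e i k)
    show ?case by (rule \<open>\<And>x k i. x \<in> yspan v \<Longrightarrow> act (free_gen (witt_e n i k)) x \<in> yspan v\<close>[OF x])
  next
    case (scale c y)
    then show ?case
      using act_gen_scale[of y x c] carrier[OF x] by (simp add: yspan.scalar)
  next
    case (add y z)
    then show ?case
      using act_gen_add[of y z x] carrier[OF x] by (simp add: yspan.add)
  qed
  show ?thesis
    by (rule submodule_criterion) (use zero gens carrier in \<open>auto intro: yspan.intros\<close>)
qed

end

section \<open>The model and the Verma module as modules over U_chi(W_n)\<close>

context witt_weight
begin

lemma closed_full: "closed_lie (witt_lie n (-1) :: ('k, 'k witt) restricted_lie)"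
  by (rule closed_lie_witt[OF p_gt_2]) simp

lemma closed_zero: "closed_lie (witt_lie n 0 :: ('k, 'k witt) restricted_lie)"
  by (rule closed_lie_witt[OF p_gt_2]) simp

sublocale full: closed_lie "witt_lie n (-1)" \<chi>
  by (rule closed_full)

sublocale zero: closed_lie "witt_lie n 0" \<chi>
  by (rule closed_zero)

abbreviation FA :: "('k witt free_word \<Rightarrow>\<^sub>0 'k) ring" where
  "FA \<equiv> free_algebra (witt_filt n (-1))"

abbreviation FA0 :: "('k witt free_word \<Rightarrow>\<^sub>0 'k) ring" where
  "FA0 \<equiv> free_algebra (witt_filt n 0)"

abbreviation ev :: "('k witt free_word \<Rightarrow>\<^sub>0 'k) \<Rightarrow> (multi_exp, 'k) endo" where
  "ev \<equiv> endo_scalar.alg_eval \<rho>"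

lemma ev_V: "g \<in> carrier FA \<Longrightarrow> f \<in> V \<Longrightarrow> app (ev g) f \<in> V"
  by (induction g rule: free_algebra_induct)
    (simp_all add: box_space_scale endo_scalar.alg_eval_mult \<rho>_V endo_scalar.alg_eval_add box_space_add)

text \<open>Only the action on V counts, because that is where the p-relations are established.
  Stability under multiplication from the right uses that \<open>ev\<close> preserves V.\<close>

lemma ev_kernel_ideal: "ideal {g \<in> carrier FA. \<forall>f\<in>V. app (ev g) f = 0} FA"
proof (rule idealI[OF ring_free_algebra])
  show "subgroup {g \<in> carrier FA. \<forall>f\<in>V. app (ev g) f = 0} (add_monoid FA)"
  proof (rule subgroup.intro)
    fix x assume x: "x \<in> {g \<in> carrier FA. \<forall>f\<in>V. app (ev g) f = 0}"
    have "ev (- x) = - ev x"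
      using endo_scalar.alg_eval_diff[of \<rho> 0 x] by simp
    then show "inv\<^bsub>add_monoid FA\<^esub> x \<in> {g \<in> carrier FA. \<forall>f\<in>V. app (ev g) f = 0}"
      using x a_inv_free_algebra[of x "witt_filt n (-1)"] free_algebra_closed(3)[of x "witt_filt n (-1)" x]
      by (simp add: a_inv_def)
  qed (auto simp: endo_scalar.alg_eval_add)
qed (auto simp: endo_scalar.alg_eval_mult ev_V)

lemma ev_well_defined:
  assumes "f \<in> carrier FA" "g \<in> carrier FA" "uq (witt_lie n (-1)) \<chi> f = uq (witt_lie n (-1)) \<chi> g" "v \<in> V"
  shows "app (ev f) v = app (ev g) v"
proof -
  let ?K = "{g \<in> carrier FA. \<forall>f\<in>V. app (ev g) f = 0}"
  have "f - g \<in> ?K"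
  proof (rule full.uq_kernel_minimal)
    show "ideal ?K full.F"
      using ev_kernel_ideal by simp
    have "ev r = 0" if r: "r \<in> full.lie_relations" for r
    proof -
      from r consider
          (1) x y where "r = free_gen (x + y) - free_gen x - free_gen y" "x \<in> witt_filt n (-1)" "y \<in> witt_filt n (-1)"
        | (2) c x where "r = free_gen (pm_scale c x) - free_scalar c * free_gen x" "x \<in> witt_filt n (-1)"
        | (3) x y where "r = free_gen x * free_gen y - free_gen y * free_gen x - free_gen (witt_bracket n x y)"
            "x \<in> witt_filt n (-1)" "y \<in> witt_filt n (-1)"
        unfolding full.lie_relations_def witt_lie_simps by blast
      then show ?thesis
        by cases (simp_all add: endo_scalar.alg_eval_diff endo_scalar.alg_eval_mult W.current_rep_add
            W.current_rep_scale W.current_rep_bracket commutator_def)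
    qed
    then show "full.lie_relations \<subseteq> ?K"
      using full.lie_relations_closed by (auto simp: subset_iff)
    fix x :: "'k witt" assume "x \<in> lie_space (witt_lie n (-1))"
    then show "full.p_relation x \<in> ?K"
      using full.p_relation_closed[of x] \<rho>_pmap[of x]
      by (simp add: full.p_relation_def endo_scalar.alg_eval_diff endo_scalar.alg_eval_power)
  qed (use assms in simp_all)
  then show ?thesis
    using assms(4) by (simp add: endo_scalar.alg_eval_diff)
qed

definition model :: "(('k witt free_word \<Rightarrow>\<^sub>0 'k) set set, multi_exp \<Rightarrow>\<^sub>0 'k) module" where
  "model = \<lparr>carrier = V, monoid.mult = undefined, one = undefined, ring.zero = 0, add = (+),
     smult = (\<lambda>u f. on_cosets (on_cosets (\<lambda>g. app (ev g) f)) u)\<rparr>"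

lemma model_simps [simp]:
  "carrier model = V" "\<zero>\<^bsub>model\<^esub> = 0" "f \<oplus>\<^bsub>model\<^esub> g = f + g"
  by (simp_all add: model_def)

lemma smult_model:
  assumes "g \<in> carrier FA" "f \<in> V"
  shows "uq (witt_lie n (-1)) \<chi> g \<odot>\<^bsub>model\<^esub> f = app (ev g) f"
proof -
  have "on_cosets (on_cosets (\<lambda>g. app (ev g) f)) (uq (witt_lie n (-1)) \<chi> g) = app (ev g) f"
  proof (rule full.on_cosets_uq[where \<phi> = "\<lambda>g. app (ev g) f"])
    show "g \<in> carrier full.F"
      using assms(1) by simp
    fix g g' assume "g \<in> carrier full.F" "g' \<in> carrier full.F"
      "uq (witt_lie n (-1)) \<chi> g = uq (witt_lie n (-1)) \<chi> g'"
    then show "app (ev g) f = app (ev g') f"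
      by (intro ev_well_defined assms(2)) simp_all
  qed
  then show ?thesis
    by (simp add: model_def)
qed

lemma carrier_U: "u \<in> carrier full.U \<Longrightarrow> \<exists>g\<in>carrier FA. u = uq (witt_lie n (-1)) \<chi> g"
  using full.uq_surj by auto

lemma left_module_model: "left_module full.U model"
proof (intro left_module.intro left_module_axioms.intro full.U.ring_axioms)
  show "abelian_group model"
  proof (rule abelian_groupI)
    fix f assume "f \<in> carrier model"
    then show "\<exists>g\<in>carrier model. g \<oplus>\<^bsub>model\<^esub> f = \<zero>\<^bsub>model\<^esub>"
      by (intro bexI[of _ "- f"]) (auto simp: box_space_uminus)
  qed (auto simp: box_space_add add.assoc add.commute)
next
  fix u f assume "u \<in> carrier full.U" and f: "f \<in> carrier model"
  then obtain g where g: "g \<in> carrier FA" "u = uq (witt_lie n (-1)) \<chi> g"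
    using carrier_U by blast
  show "u \<odot>\<^bsub>model\<^esub> f \<in> carrier model"
    using g f by (simp add: smult_model ev_V)
  fix f' assume f': "f' \<in> carrier model"
  show "u \<odot>\<^bsub>model\<^esub> (f \<oplus>\<^bsub>model\<^esub> f') = u \<odot>\<^bsub>model\<^esub> f \<oplus>\<^bsub>model\<^esub> u \<odot>\<^bsub>model\<^esub> f'"
    using g f f' by (simp add: smult_model box_space_add app_add)
next
  fix u u' f assume "u \<in> carrier full.U" "u' \<in> carrier full.U" and f: "f \<in> carrier model"
  then obtain g g' where g: "g \<in> carrier FA" "u = uq (witt_lie n (-1)) \<chi> g"
    and g': "g' \<in> carrier FA" "u' = uq (witt_lie n (-1)) \<chi> g'"
    using carrier_U by blast
  have "u \<oplus>\<^bsub>full.U\<^esub> u' = uq (witt_lie n (-1)) \<chi> (g + g')"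
    "u \<otimes>\<^bsub>full.U\<^esub> u' = uq (witt_lie n (-1)) \<chi> (g * g')"
    using full.uq.hom_add[of g g'] full.uq.hom_mult[of g g'] g g' by simp_all
  then show "(u \<oplus>\<^bsub>full.U\<^esub> u') \<odot>\<^bsub>model\<^esub> f = u \<odot>\<^bsub>model\<^esub> f \<oplus>\<^bsub>model\<^esub> u' \<odot>\<^bsub>model\<^esub> f"
    "(u \<otimes>\<^bsub>full.U\<^esub> u') \<odot>\<^bsub>model\<^esub> f = u \<odot>\<^bsub>model\<^esub> (u' \<odot>\<^bsub>model\<^esub> f)"
    using g g' f
    by (simp_all add: smult_model free_algebra_closed ev_V endo_scalar.alg_eval_add endo_scalar.alg_eval_mult)
next
  fix f assume "f \<in> carrier model"
  then show "\<one>\<^bsub>full.U\<^esub> \<odot>\<^bsub>model\<^esub> f = f"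
    using smult_model[of 1 f] full.uq.hom_one by simp
qed

sublocale mdl: witt_module \<chi> n model
  by (intro witt_module.intro u_module.intro witt_character_axioms closed_full left_module_model)

lemma mdl_act: "g \<in> carrier FA \<Longrightarrow> f \<in> V \<Longrightarrow> mdl.act g f = app (ev g) f"
  by (simp add: mdl.act_def smult_model)

lemma filt_0_subset: "witt_filt n 0 \<subseteq> (witt_filt n (-1) :: 'k witt set)"
  by (rule witt_filt_mono) simp

lemma FA0_subset: "g \<in> carrier FA0 \<Longrightarrow> g \<in> carrier FA"
  by (rule free_algebra_mono[OF filt_0_subset])

lemma mdl_weight_vector: "mdl.weight_vector l vac"
  unfolding mdl.weight_vector_def
  using vac_V filt_0_subset by (auto simp: mdl_act \<rho>_vac subset_iff)

lemma lie_relations_incl: "zero.lie_relations \<subseteq> full.lie_relations"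
  unfolding zero.lie_relations_def full.lie_relations_def witt_lie_simps
  using filt_0_subset by (intro Un_mono) blast+

text \<open>\<open>reduced_uea_incl\<close> passes through cosets on two levels, so compatibility is
  needed for the unreduced enveloping algebras before the reduced ones.\<close>

lemma uea_class_incl:
  assumes "f \<in> carrier FA0" "g \<in> carrier FA0" "uea_class (witt_lie n 0) f = uea_class (witt_lie n 0) g"
  shows "uea_class (witt_lie n (-1)) f = uea_class (witt_lie n (-1)) g"
proof -
  have "uea_ideal (witt_lie n 0) \<subseteq> uea_ideal (witt_lie n (-1)) \<inter> carrier zero.F"
    unfolding zero.uea_ideal_eq
  proof (rule zero.F.genideal_minimal)
    show "ideal (uea_ideal (witt_lie n (-1)) \<inter> carrier zero.F) zero.F"
      by (rule ideal_free_algebra_restrict[OF full.I.is_ideal]) (simp add: filt_0_subset)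
    have "full.lie_relations \<subseteq> uea_ideal (witt_lie n (-1))"
      unfolding full.uea_ideal_eq by (rule full.F.genideal_self[OF full.lie_relations_closed])
    then show "zero.lie_relations \<subseteq> uea_ideal (witt_lie n (-1)) \<inter> carrier zero.F"
      using lie_relations_incl zero.lie_relations_closed by blast
  qed
  moreover have "f - g \<in> uea_ideal (witt_lie n 0)"
    using assms zero.uea_class_eq_iff[of f g] by simp
  ultimately have "f - g \<in> uea_ideal (witt_lie n (-1))"
    by blast
  then show ?thesis
    using full.uea_class_eq_iff[of f g] FA0_subset[OF assms(1)] FA0_subset[OF assms(2)] by simp
qed

lemma uq_incl:
  assumes "f \<in> carrier FA0" "g \<in> carrier FA0" "uq (witt_lie n 0) \<chi> f = uq (witt_lie n 0) \<chi> g"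
  shows "uq (witt_lie n (-1)) \<chi> f = uq (witt_lie n (-1)) \<chi> g"
proof -
  let ?K = "{g \<in> carrier full.F. uq (witt_lie n (-1)) \<chi> g = \<zero>\<^bsub>full.U\<^esub>}"
  have "f - g \<in> ?K \<inter> carrier zero.F"
  proof (rule zero.uq_kernel_minimal)
    show "ideal (?K \<inter> carrier zero.F) zero.F"
      by (rule ideal_free_algebra_restrict[OF full.uq_kernel_ideal]) (simp add: filt_0_subset)
    show "zero.lie_relations \<subseteq> ?K \<inter> carrier zero.F"
    proof
      fix r assume r: "r \<in> zero.lie_relations"
      then have rel: "r \<in> full.lie_relations"
        using lie_relations_incl by blast
      then have rF: "r \<in> carrier full.F"
        using full.lie_relations_closed by blast
      have "uq (witt_lie n (-1)) \<chi> r = uq (witt_lie n (-1)) \<chi> 0"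
        by (rule full.uq_eqI_lie[OF rF]) (simp_all add: rel)
      then show "r \<in> ?K \<inter> carrier zero.F"
        using rF r zero.lie_relations_closed full.uq.hom_zero by auto
    qed
    fix x :: "'k witt" assume x: "x \<in> lie_space (witt_lie n 0)"
    then have x': "x \<in> lie_space (witt_lie n (-1))"
      using filt_0_subset by auto
    have "zero.p_relation x = free_gen x ^ CHAR('k) - (free_gen (witt_pmap n x) + free_scalar (\<chi> x ^ CHAR('k)))"
      by (simp add: zero.p_relation_def diff_diff_eq)
    moreover have "free_gen x ^ CHAR('k) \<in> carrier full.F"
      "free_gen (witt_pmap n x) + free_scalar (\<chi> x ^ CHAR('k)) \<in> carrier full.F"
      using x' full.pmap_closed[OF x'] by (simp_all add: free_algebra_closed)
    ultimately have "uq (witt_lie n (-1)) \<chi> (zero.p_relation x) = \<zero>\<^bsub>full.U\<^esub>"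
      using full.uq_pmap[OF x'] by (simp only: full.uq_diff_eq_zero_iff witt_lie_simps)
    then show "zero.p_relation x \<in> ?K \<inter> carrier zero.F"
      using zero.p_relation_closed[OF x] FA0_subset by simp
  qed (use assms in simp_all)
  then have "uq (witt_lie n (-1)) \<chi> (f - g) = \<zero>\<^bsub>full.U\<^esub>"
    by blast
  then show ?thesis
    using full.uq_diff_eq_zero_iff[of f g] FA0_subset[OF assms(1)] FA0_subset[OF assms(2)] by simp
qed

abbreviation incl :: "('k witt free_word \<Rightarrow>\<^sub>0 'k) set set \<Rightarrow> ('k witt free_word \<Rightarrow>\<^sub>0 'k) set set" where
  "incl \<equiv> reduced_uea_incl (witt_lie n (-1)) \<chi>"

lemma incl_uq:
  assumes "g \<in> carrier FA0"
  shows "incl (uq (witt_lie n 0) \<chi> g) = uq (witt_lie n (-1)) \<chi> g"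
  unfolding reduced_uea_incl_def
proof (rule zero.on_cosets_uq_general[where \<phi> = "uq (witt_lie n (-1)) \<chi>"])
  show "g \<in> carrier zero.F"
    using assms by simp
  fix f g assume "f \<in> carrier zero.F" "g \<in> carrier zero.F" "uq (witt_lie n 0) \<chi> f = uq (witt_lie n 0) \<chi> g"
  then show "uq (witt_lie n (-1)) \<chi> f = uq (witt_lie n (-1)) \<chi> g"
    by (intro uq_incl) simp_all
next
  fix g assume g: "g \<in> carrier zero.F"
  have "on_cosets (uea_class (witt_lie n (-1))) (uea_class (witt_lie n 0) g) = uea_class (witt_lie n (-1)) g"
  proof (rule zero.on_cosets_uea_class[OF _ g])
    fix f g assume "f \<in> carrier zero.F" "g \<in> carrier zero.F" "uea_class (witt_lie n 0) f = uea_class (witt_lie n 0) g"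
    then show "uea_class (witt_lie n (-1)) f = uea_class (witt_lie n (-1)) g"
      by (intro uea_class_incl) simp_all
  qed
  then show "reduced_ideal (witt_lie n (-1)) \<chi> +>\<^bsub>uea (witt_lie n (-1))\<^esub>
      on_cosets (uea_class (witt_lie n (-1))) (uea_class (witt_lie n 0) g) = uq (witt_lie n (-1)) \<chi> g"
    by (simp add: uq_def)
qed

lemma carrier_U0: "u \<in> carrier zero.U \<Longrightarrow> \<exists>g\<in>carrier FA0. u = uq (witt_lie n 0) \<chi> g"
  using zero.uq_surj by auto

lemma incl_hom: "incl \<in> ring_hom zero.U full.U"
proof (rule ring_hom_memI)
  fix u assume "u \<in> carrier zero.U"
  then obtain g where g: "g \<in> carrier FA0" "u = uq (witt_lie n 0) \<chi> g"
    using carrier_U0 by blast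
  show "incl u \<in> carrier full.U"
    using full.uq_closed[of g] FA0_subset[OF g(1)] by (simp add: g incl_uq)
  fix u' assume "u' \<in> carrier zero.U"
  then obtain g' where g': "g' \<in> carrier FA0" "u' = uq (witt_lie n 0) \<chi> g'"
    using carrier_U0 by blast
  have "u \<otimes>\<^bsub>zero.U\<^esub> u' = uq (witt_lie n 0) \<chi> (g * g')" "u \<oplus>\<^bsub>zero.U\<^esub> u' = uq (witt_lie n 0) \<chi> (g + g')"
    using zero.uq.hom_mult[of g g'] zero.uq.hom_add[of g g'] g g' by simp_all
  then show "incl (u \<otimes>\<^bsub>zero.U\<^esub> u') = incl u \<otimes>\<^bsub>full.U\<^esub> incl u'" "incl (u \<oplus>\<^bsub>zero.U\<^esub> u') = incl u \<oplus>\<^bsub>full.U\<^esub> incl u'"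
    using full.uq.hom_mult[of g g'] full.uq.hom_add[of g g'] g g' FA0_subset[OF g(1)] FA0_subset[OF g'(1)]
    by (simp_all add: incl_uq free_algebra_closed)
next
  show "incl \<one>\<^bsub>zero.U\<^esub> = \<one>\<^bsub>full.U\<^esub>"
    using incl_uq[of 1] zero.uq.hom_one full.uq.hom_one by simp
qed

abbreviation \<theta> :: "'k witt \<Rightarrow> 'k" where
  "\<theta> \<equiv> weight_form n \<chi> l"

text \<open>Instead of checking the relations of U_chi(W_(0)) for the scalars \<theta>, read the
  scalar off the model: equal elements act equally on the constant 1, which is a weight
  vector.\<close>

lemma free_eval_well_defined:
  assumes "f \<in> carrier FA0" "g \<in> carrier FA0" "uq (witt_lie n 0) \<chi> f = uq (witt_lie n 0) \<chi> g"
  shows "free_eval \<theta> f = free_eval \<theta> g"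
proof -
  have *: "mdl.act g vac = pm_scale (free_eval \<theta> g) vac" if "g \<in> carrier FA0" for g
    using mdl.weight_vector_free_eval[OF mdl_weight_vector that] vac_V by (simp add: mdl_act)
  have "mdl.act f vac = mdl.act g vac"
    using uq_incl[OF assms] by (simp add: mdl.act_def)
  then have "lookup (pm_scale (free_eval \<theta> f) vac) (\<lambda>_. 0) =
      lookup (pm_scale (free_eval \<theta> g) vac) (\<lambda>_. 0)"
    using *[OF assms(1)] *[OF assms(2)] by simp
  then show ?thesis
    by simp
qed

lemma one_dim_simps [simp]:
  "carrier (one_dim_module \<theta>) = UNIV" "\<zero>\<^bsub>one_dim_module \<theta>\<^esub> = 0" "c \<oplus>\<^bsub>one_dim_module \<theta>\<^esub> d = c + d"
  by (simp_all add: one_dim_module_def)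

lemma smult_one_dim:
  assumes "g \<in> carrier FA0"
  shows "uq (witt_lie n 0) \<chi> g \<odot>\<^bsub>one_dim_module \<theta>\<^esub> c = free_eval \<theta> g * c"
proof -
  have "on_cosets (on_cosets (free_eval \<theta>)) (uq (witt_lie n 0) \<chi> g) = free_eval \<theta> g"
  proof (rule zero.on_cosets_uq[where \<phi> = "free_eval \<theta>"])
    show "g \<in> carrier zero.F"
      using assms(1) by simp
    fix g g' assume "g \<in> carrier zero.F" "g' \<in> carrier zero.F"
      "uq (witt_lie n 0) \<chi> g = uq (witt_lie n 0) \<chi> g'"
    then show "free_eval \<theta> g = free_eval \<theta> g'"
      by (intro free_eval_well_defined) simp_all
  qed
  then show ?thesis
    by (simp add: one_dim_module_def)
qed

lemma left_module_one_dim: "left_module zero.U (one_dim_module \<theta>)"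
proof (intro left_module.intro left_module_axioms.intro zero.U.ring_axioms)
  show "abelian_group (one_dim_module \<theta>)"
    by (rule abelian_groupI) (auto simp: add.assoc add.commute intro: exI[of _ "- _"])
next
  fix u c d assume "u \<in> carrier zero.U"
  then show "u \<odot>\<^bsub>one_dim_module \<theta>\<^esub> (c \<oplus>\<^bsub>one_dim_module \<theta>\<^esub> d) =
      u \<odot>\<^bsub>one_dim_module \<theta>\<^esub> c \<oplus>\<^bsub>one_dim_module \<theta>\<^esub> u \<odot>\<^bsub>one_dim_module \<theta>\<^esub> d"
    using carrier_U0[of u] by (auto simp: smult_one_dim distrib_left)
next
  fix u u' c assume "u \<in> carrier zero.U" "u' \<in> carrier zero.U"
  then obtain g g' where g: "g \<in> carrier FA0" "u = uq (witt_lie n 0) \<chi> g"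
    and g': "g' \<in> carrier FA0" "u' = uq (witt_lie n 0) \<chi> g'"
    using carrier_U0 by blast
  have "u \<oplus>\<^bsub>zero.U\<^esub> u' = uq (witt_lie n 0) \<chi> (g + g')" "u \<otimes>\<^bsub>zero.U\<^esub> u' = uq (witt_lie n 0) \<chi> (g * g')"
    using zero.uq.hom_add[of g g'] zero.uq.hom_mult[of g g'] g g' by simp_all
  then show "(u \<oplus>\<^bsub>zero.U\<^esub> u') \<odot>\<^bsub>one_dim_module \<theta>\<^esub> c =
      u \<odot>\<^bsub>one_dim_module \<theta>\<^esub> c \<oplus>\<^bsub>one_dim_module \<theta>\<^esub> u' \<odot>\<^bsub>one_dim_module \<theta>\<^esub> c"
    "(u \<otimes>\<^bsub>zero.U\<^esub> u') \<odot>\<^bsub>one_dim_module \<theta>\<^esub> c = u \<odot>\<^bsub>one_dim_module \<theta>\<^esub> (u' \<odot>\<^bsub>one_dim_module \<theta>\<^esub> c)"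
    using g g' by (simp_all add: smult_one_dim free_algebra_closed free_eval_eq_alg_eval
        id_scalar.alg_eval_add id_scalar.alg_eval_mult distrib_right mult.assoc)
next
  fix c show "\<one>\<^bsub>zero.U\<^esub> \<odot>\<^bsub>one_dim_module \<theta>\<^esub> c = c"
    using smult_one_dim[of 1 c] zero.uq.hom_one by (simp add: free_eval_eq_alg_eval)
qed simp

sublocale T: tensor_data full.U zero.U "one_dim_module \<theta>" incl
  by (intro tensor_data.intro tensor_data_axioms.intro full.U.ring_axioms zero.U.ring_axioms
      left_module_one_dim incl_hom)

abbreviation verma ::
  "(('k witt free_word \<Rightarrow>\<^sub>0 'k) set set, (('k witt free_word \<Rightarrow>\<^sub>0 'k) set set \<times> 'k \<Rightarrow>\<^sub>0 int) set) module" where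
  "verma \<equiv> reduced_verma n \<chi> l"

lemma verma_eq: "verma = T.I"
  by (simp add: reduced_verma_def)

sublocale Z: witt_module \<chi> n verma
  unfolding verma_eq by (intro witt_module.intro u_module.intro witt_character_axioms closed_full T.left_module_I)

definition vec :: "(('k witt free_word \<Rightarrow>\<^sub>0 'k) set set \<times> 'k \<Rightarrow>\<^sub>0 int) set" where
  "vec = T.tens \<one>\<^bsub>full.U\<^esub> 1"

lemma vec_closed: "vec \<in> carrier verma"
  unfolding vec_def verma_eq by (rule T.tens_closed) simp_all

lemma act_vec:
  assumes "g \<in> carrier FA"
  shows "Z.act g vec = T.tens (uq (witt_lie n (-1)) \<chi> g) 1"
proof -
  have u: "uq (witt_lie n (-1)) \<chi> g \<in> carrier full.U"
    using assms by simp
  show ?thesis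
    unfolding Z.act_def unfolding vec_def verma_eq using T.smult_tens[OF u full.U.one_closed, of 1] u by simp
qed

lemma tens_balanced:
  assumes "f \<in> carrier FA" "g \<in> carrier FA0"
  shows "T.tens (uq (witt_lie n (-1)) \<chi> f) (free_eval \<theta> g) = T.tens (uq (witt_lie n (-1)) \<chi> (f * g)) 1"
proof -
  have "uq (witt_lie n 0) \<chi> g \<in> carrier zero.U" "uq (witt_lie n (-1)) \<chi> f \<in> carrier full.U"
    using assms by simp_all
  from T.tens_balanced[OF this(2,1), of 1] show ?thesis
    using full.uq.hom_mult[of f g] assms FA0_subset by (simp add: incl_uq smult_one_dim)
qed

lemma vec_weight_vector: "Z.weight_vector l vec"
  unfolding Z.weight_vector_def
proof (intro conjI ballI)
  fix x :: "'k witt" assume x: "x \<in> witt_filt n 0"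
  have "Z.act g vec = T.tens (uq (witt_lie n (-1)) \<chi> 1) (free_eval \<theta> g)" if "g \<in> carrier FA0" for g
    using tens_balanced[of 1 g] act_vec[of g] FA0_subset[OF that] that by simp
  from this[of "free_gen x"] this[of "free_scalar (\<theta> x)"] x
  show "Z.act (free_gen x) vec = Z.act (free_scalar (\<theta> x)) vec"
    by (simp add: free_eval_eq_alg_eval)
qed (rule vec_closed)

lemma vec_generates:
  assumes H: "submodule H full.U verma" "vec \<in> H"
  shows "H = carrier verma"
  unfolding verma_eq
proof (rule T.submodule_eq_carrier)
  show "submodule H full.U T.I"
    using H(1) by (simp add: verma_eq)
  fix u c assume "u \<in> carrier full.U"
  then obtain g where g: "g \<in> carrier FA" "u = uq (witt_lie n (-1)) \<chi> g"
    using carrier_U by blast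
  have "T.tens u c = Z.act (g * free_scalar c) vec"
    using tens_balanced[OF g(1), of "free_scalar c"] act_vec[of "g * free_scalar c"] g
    by (simp add: free_eval_eq_alg_eval free_algebra_closed)
  then show "T.tens u c \<in> H"
    using Z.submodule_act[OF H(1) _ H(2), of "g * free_scalar c"] g by (simp add: free_algebra_closed)
qed

text \<open>Frobenius reciprocity: the map that sends c to c times w is linear over U_chi(W_(0))
  because w is a weight vector of weight l.\<close>

lemma verma_universal:
  assumes N: "witt_module \<chi> n N" and w: "witt_module.weight_vector \<chi> n N l w"
  obtains h where "\<And>x. x \<in> carrier verma \<Longrightarrow> h x \<in> carrier N"
    "\<And>x y. x \<in> carrier verma \<Longrightarrow> y \<in> carrier verma \<Longrightarrow> h (x \<oplus>\<^bsub>verma\<^esub> y) = h x \<oplus>\<^bsub>N\<^esub> h y"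
    "\<And>u x. u \<in> carrier full.U \<Longrightarrow> x \<in> carrier verma \<Longrightarrow> h (u \<odot>\<^bsub>verma\<^esub> x) = u \<odot>\<^bsub>N\<^esub> h x"
    "h vec = w"
proof -
  interpret N: witt_module \<chi> n N by (rule N)
  have wN: "w \<in> carrier N"
    using w by (simp add: N.weight_vector_def)
  define f where "f c = N.act (free_scalar c) w" for c
  obtain h where h: "\<And>x. x \<in> carrier T.I \<Longrightarrow> h x \<in> carrier N"
    "\<And>x y. x \<in> carrier T.I \<Longrightarrow> y \<in> carrier T.I \<Longrightarrow> h (x \<oplus>\<^bsub>T.I\<^esub> y) = h x \<oplus>\<^bsub>N\<^esub> h y"
    "\<And>u x. u \<in> carrier full.U \<Longrightarrow> x \<in> carrier T.I \<Longrightarrow> h (u \<odot>\<^bsub>T.I\<^esub> x) = u \<odot>\<^bsub>N\<^esub> h x"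
    "\<And>a m. a \<in> carrier full.U \<Longrightarrow> m \<in> carrier (one_dim_module \<theta>) \<Longrightarrow> h (T.tens a m) = a \<odot>\<^bsub>N\<^esub> f m"
  proof (rule T.induced_module_universal[OF N.N.left_module_axioms, of f])
    fix s m assume "s \<in> carrier zero.U"
    then obtain g where g: "g \<in> carrier FA0" "s = uq (witt_lie n 0) \<chi> g"
      using carrier_U0 by blast
    have "f (s \<odot>\<^bsub>one_dim_module \<theta>\<^esub> m) = N.act (free_scalar m) (N.act (free_scalar (free_eval \<theta> g)) w)"
      using wN by (simp add: f_def g smult_one_dim N.act_scalar_mult mult.commute)
    also have "\<dots> = N.act (free_scalar m) (N.act g w)"
      using N.weight_vector_free_eval[OF w g(1)] by simp
    also have "\<dots> = N.act g (f m)"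
      using N.act_scalar_commute[of g w m] FA0_subset[OF g(1)] wN by (simp add: f_def)
    finally show "f (s \<odot>\<^bsub>one_dim_module \<theta>\<^esub> m) = incl s \<odot>\<^bsub>N\<^esub> f m"
      by (simp add: g incl_uq N.act_def)
  qed (use wN in \<open>auto simp: f_def N.act_scalar_add\<close>)
  show ?thesis
  proof (rule that[of h])
    have "h vec = \<one>\<^bsub>full.U\<^esub> \<odot>\<^bsub>N\<^esub> f 1"
      unfolding vec_def by (rule h(4)) simp_all
    then show "h vec = w"
      using wN N.N.smult_one by (simp add: f_def)
  qed (use h in \<open>simp_all add: verma_eq\<close>)
qed

end

section \<open>Module isomorphisms and Schur's lemma\<close>

lemma (in left_module) submodule_carrier: "submodule (carrier M) R M"
  using group.subgroup_self[OF M.a_group] smult_closed by (intro submodule.intro submodule_axioms.intro) simp_all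

lemma module_iso_refl: "module_iso R M M"
proof -
  have "id \<in> module_isos R M M"
    by (simp add: module_isos_def)
  then show ?thesis
    by (auto simp: module_iso_def)
qed

lemma module_iso_sym:
  assumes M: "left_module R M" and iso: "module_iso R M N"
  shows "module_iso R N M"
proof -
  interpret M: left_module R M by (rule M)
  obtain f where f: "bij_betw f (carrier M) (carrier N)"
    "\<And>x y. x \<in> carrier M \<Longrightarrow> y \<in> carrier M \<Longrightarrow> f (x \<oplus>\<^bsub>M\<^esub> y) = f x \<oplus>\<^bsub>N\<^esub> f y"
    "\<And>a x. a \<in> carrier R \<Longrightarrow> x \<in> carrier M \<Longrightarrow> f (a \<odot>\<^bsub>M\<^esub> x) = a \<odot>\<^bsub>N\<^esub> f x"
    using iso unfolding module_iso_def module_isos_def by blast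
  define g where "g = inv_into (carrier M) f"
  have g: "g y \<in> carrier M" "f (g y) = y" if "y \<in> carrier N" for y
    using that f(1) by (auto simp: g_def bij_betw_def inv_into_into f_inv_into_f)
  have gf: "g (f x) = x" if "x \<in> carrier M" for x
    using that f(1) by (simp add: g_def bij_betw_inv_into_left)
  have "g \<in> module_isos R N M"
    unfolding module_isos_def
  proof (intro CollectI conjI ballI)
    show "bij_betw g (carrier N) (carrier M)"
      unfolding g_def by (rule bij_betw_inv_into[OF f(1)])
  next
    fix x y assume xy: "x \<in> carrier N" "y \<in> carrier N"
    have "g (f (g x \<oplus>\<^bsub>M\<^esub> g y)) = g x \<oplus>\<^bsub>M\<^esub> g y"
      by (intro gf M.M.a_closed g xy)
    then show "g (x \<oplus>\<^bsub>N\<^esub> y) = g x \<oplus>\<^bsub>M\<^esub> g y"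
      using g xy by (simp add: f(2))
  next
    fix a x assume ax: "a \<in> carrier R" "x \<in> carrier N"
    have "g (f (a \<odot>\<^bsub>M\<^esub> g x)) = a \<odot>\<^bsub>M\<^esub> g x"
      by (intro gf M.smult_closed g ax)
    then show "g (a \<odot>\<^bsub>N\<^esub> x) = a \<odot>\<^bsub>M\<^esub> g x"
      using g ax by (simp add: f(3))
  qed
  then show ?thesis
    by (auto simp: module_iso_def)
qed

lemma schur:
  assumes M: "simple_module R M" and N: "simple_module R N"
    and closed: "\<And>x. x \<in> carrier M \<Longrightarrow> h x \<in> carrier N"
    and add: "\<And>x y. x \<in> carrier M \<Longrightarrow> y \<in> carrier M \<Longrightarrow> h (x \<oplus>\<^bsub>M\<^esub> y) = h x \<oplus>\<^bsub>N\<^esub> h y"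
    and smult: "\<And>a x. a \<in> carrier R \<Longrightarrow> x \<in> carrier M \<Longrightarrow> h (a \<odot>\<^bsub>M\<^esub> x) = a \<odot>\<^bsub>N\<^esub> h x"
    and x: "x \<in> carrier M" "h x \<noteq> \<zero>\<^bsub>N\<^esub>"
  shows "module_iso R M N"
proof -
  interpret M: left_module R M using M by (simp add: simple_module_def)
  interpret N: left_module R N using N by (simp add: simple_module_def)
  interpret h: group_hom "add_monoid M" "add_monoid N" h
    by (intro group_hom.intro group_hom_axioms.intro M.M.a_group N.M.a_group homI) (simp_all add: closed add)
  let ?K = "kernel (add_monoid M) (add_monoid N) h"
  have "submodule ?K R M"
    by (intro submodule.intro submodule_axioms.intro h.subgroup_kernel)
      (simp add: kernel_def smult M.smult_closed)
  moreover have "?K \<noteq> carrier M"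
    using x by (auto simp: kernel_def)
  ultimately have "?K = {\<zero>\<^bsub>M\<^esub>}"
    using M unfolding simple_module_def by blast
  then have inj: "inj_on h (carrier M)"
    using h.inj_iff_trivial_ker by simp
  have "subgroup (h ` carrier M) (add_monoid N)"
    using h.img_is_subgroup by simp
  then have "submodule (h ` carrier M) R N"
    by (intro submodule.intro submodule_axioms.intro) (auto simp: smult[symmetric] M.smult_closed)
  moreover have "h ` carrier M \<noteq> {\<zero>\<^bsub>N\<^esub>}"
    using x by blast
  ultimately have "h ` carrier M = carrier N"
    using N unfolding simple_module_def by blast
  then have "h \<in> module_isos R M N"
    using inj by (simp add: module_isos_def bij_betw_def add smult)
  then show ?thesis
    by (auto simp: module_iso_def)
qed

lemma (in witt_character) witt_module_simple:
  assumes "simple_module (reduced_uea (witt_lie n (-1)) \<chi>) M"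
  shows "witt_module \<chi> n M"
proof -
  have "closed_lie (witt_lie n (-1) :: ('k, 'k witt) restricted_lie)"
    by (rule closed_lie_witt[OF p_gt_2]) simp
  then show ?thesis
    using assms by (intro witt_module.intro u_module.intro witt_character_axioms) (simp_all add: simple_module_def)
qed

section \<open>Simplicity and classification of the Verma modules\<close>

context witt_weight
begin

lemma zspan_verma: "Z.zspan vec = carrier verma"
proof -
  have "Z.yspan vec = carrier verma"
    by (rule vec_generates[OF Z.yspan_submodule[OF vec_weight_vector] Z.yspan.base])
  then show ?thesis
    using Z.yspan_subset_zspan[OF vec_closed] vec_closed by (auto simp: Z.zspan_def)
qed

lemma ev_zsum:
  "app (ev (Z.zsum c)) vac = (\<Sum>a\<in>box CHAR('k) n. pm_scale (c a) (single a 1))"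
proof -
  have zgen: "ev (Z.zgen j) = z_op j" if "j \<le> n" for j
  proof -
    have "in_range TYPE('k) n (-1) j"
      using that p_gt_3 by (simp add: in_range_def)
    then show ?thesis
      using that by (simp add: Z.zgen_def endo_scalar.alg_eval_diff W.current_rep_e W.current_op_0 y_op_def)
  qed
  have "ev (Z.zprod (Suc n) a) = z_monomial n a" for a
    unfolding Z.zprod_def z_monomial_def endo_scalar.alg_eval_prod_list map_map
    by (intro arg_cong[of _ _ prod_list] map_cong) (auto simp: endo_scalar.alg_eval_power zgen)
  then show ?thesis
    by (simp only: Z.zsum_def endo_scalar.alg_eval_sum endo_scalar.alg_eval_mult endo_scalar.alg_eval_scalar
        app_sum_left app_simps app_scalar_endo) (intro sum.cong refl, simp only: app_z_monomial)
qed

lemma verma_embedding: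
  "\<exists>h. (\<forall>x\<in>carrier verma. h x \<in> V) \<and>
    (\<forall>g\<in>carrier FA. \<forall>x\<in>carrier verma. h (Z.act g x) = app (ev g) (h x)) \<and>
    h vec = vac \<and> inj_on h (carrier verma)"
proof -
  obtain h where h: "\<And>x. x \<in> carrier verma \<Longrightarrow> h x \<in> carrier model"
    "\<And>x y. x \<in> carrier verma \<Longrightarrow> y \<in> carrier verma \<Longrightarrow> h (x \<oplus>\<^bsub>verma\<^esub> y) = h x \<oplus>\<^bsub>model\<^esub> h y"
    "\<And>u x. u \<in> carrier full.U \<Longrightarrow> x \<in> carrier verma \<Longrightarrow> h (u \<odot>\<^bsub>verma\<^esub> x) = u \<odot>\<^bsub>model\<^esub> h x"
    "h vec = vac"
    by (rule verma_universal[OF mdl.witt_module_axioms mdl_weight_vector]) blast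
  have act: "h (Z.act g x) = app (ev g) (h x)" if "g \<in> carrier FA" "x \<in> carrier verma" for g x
    using h(1)[OF that(2)] h(3)[of "uq (witt_lie n (-1)) \<chi> g" x] that by (simp add: Z.act_def smult_model)
  have "inj_on h (carrier verma)"
  proof (rule inj_onI)
    fix x y assume xy: "x \<in> carrier verma" "y \<in> carrier verma" "h x = h y"
    then have "x \<in> Z.zspan vec" "y \<in> Z.zspan vec"
      by (simp_all only: zspan_verma)
    then obtain c d where c: "x = Z.act (Z.zsum c) vec" and d: "y = Z.act (Z.zsum d) vec"
      unfolding Z.zspan_def by blast
    have hz: "h (Z.act (Z.zsum e) vec) = (\<Sum>a\<in>box CHAR('k) n. pm_scale (e a) (single a 1))" for e
      using act[of "Z.zsum e" vec] vec_closed by (simp add: h(4) ev_zsum)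
    have sum_eq: "(\<Sum>a\<in>box CHAR('k) n. pm_scale (c a) (single a 1)) =
        (\<Sum>a\<in>box CHAR('k) n. pm_scale (d a) (single a 1))"
      using xy(3) unfolding c d hz .
    \<comment> \<open>Distinct ordered monomials are sent to distinct basis vectors of the model, so
      the coefficients can be read off there.\<close>
    have "c a = d a" if a: "a \<in> box CHAR('k) n" for a
    proof -
      have "lookup (\<Sum>b\<in>box CHAR('k) n. pm_scale (e b) (single b 1)) a = e a" for e :: "multi_exp \<Rightarrow> 'k"
        using a finite_box by (simp add: lookup_sum lookup_single when_def)
      from this[of c] this[of d] show ?thesis
        unfolding sum_eq by simp
    qed
    then have "Z.zsum c = Z.zsum d"
      unfolding Z.zsum_def by (intro sum.cong) auto
    then show "x = y"
      by (simp add: c d)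
  qed
  then show ?thesis
    using h(1,4) act by (intro exI[of _ h]) simp
qed

lemma vec_nonzero: "vec \<noteq> \<zero>\<^bsub>verma\<^esub>"
proof
  assume vec: "vec = \<zero>\<^bsub>verma\<^esub>"
  obtain h where h: "\<And>x. x \<in> carrier verma \<Longrightarrow> h x \<in> V"
    "\<And>g x. g \<in> carrier FA \<Longrightarrow> x \<in> carrier verma \<Longrightarrow> h (Z.act g x) = app (ev g) (h x)"
    "h vec = vac" "inj_on h (carrier verma)"
    using verma_embedding by blast
  have "h (Z.act 0 vec) = 0"
    using h(2)[of 0 vec] vec_closed by simp
  then have "vac = 0"
    using h(3) vec vec_closed by simp
  then have "lookup vac (\<lambda>_. 0) = 0"
    by simp
  then show False
    by simp
qed

text \<open>The weight l' is arbitrary, so that this serves both simplicity, where a submodule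
  supplies a vector of unknown weight, and the separation of the Verma modules.\<close>

lemma weight_vectors_verma:
  assumes w: "Z.weight_vector l' w" "w \<noteq> \<zero>\<^bsub>verma\<^esub>"
  obtains c where "c \<noteq> 0" "w = Z.act (free_scalar c) vec"
proof -
  obtain h where h: "\<And>x. x \<in> carrier verma \<Longrightarrow> h x \<in> V"
    "\<And>g x. g \<in> carrier FA \<Longrightarrow> x \<in> carrier verma \<Longrightarrow> h (Z.act g x) = app (ev g) (h x)"
    "h vec = vac" "inj_on h (carrier verma)"
    using verma_embedding by blast
  have wc: "w \<in> carrier verma"
    using w(1) by (simp add: Z.weight_vector_def)
  have "app (\<rho> (witt_e n 1 k)) (h w) = 0" if k: "k \<le> n" for k
  proof -
    have r: "in_range TYPE('k) n 1 k"
      using k p_gt_3 by (simp add: in_range_def)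
    have "Z.act (free_gen (witt_e n 1 k)) w = Z.act (free_scalar (weight_form n \<chi> l' (witt_e n 1 k))) w"
      using w(1) by (simp add: Z.weight_vector_def witt_e_in_filt)
    then have "h (Z.act (free_gen (witt_e n 1 k)) w) = h (Z.act (free_scalar 0) w)"
      by (simp only: weight_form_e[OF r]) simp
    then show ?thesis
      using h(2)[of "free_gen (witt_e n 1 k)" w] h(2)[of "free_scalar 0" w] wc by (simp add: witt_e_in_space)
  qed
  from e1_kernel[OF h(1)[OF wc] this]
  obtain c where "h w = pm_scale c vac"
    by blast
  then have "h w = h (Z.act (free_scalar c) vec)"
    using h(2)[of "free_scalar c" vec] h(3) vec_closed by simp
  then have eq: "w = Z.act (free_scalar c) vec"
    using inj_onD[OF h(4)] wc vec_closed by simp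
  moreover have "c \<noteq> 0"
    using eq w(2) vec_closed by auto
  ultimately show ?thesis
    using that by blast
qed

theorem verma_simple: "simple_module full.U verma"
  unfolding simple_module_def
proof (intro conjI allI impI)
  show "left_module full.U verma"
    by (rule Z.N.left_module_axioms)
  show "carrier verma \<noteq> {\<zero>\<^bsub>verma\<^esub>}"
    using vec_closed vec_nonzero by blast
  fix H assume H: "submodule H full.U verma"
  show "H = {\<zero>\<^bsub>verma\<^esub>} \<or> H = carrier verma"
  proof (rule disjCI)
    assume "H \<noteq> carrier verma"
    show "H = {\<zero>\<^bsub>verma\<^esub>}"
    proof (rule ccontr)
      assume "H \<noteq> {\<zero>\<^bsub>verma\<^esub>}"
      then obtain l' w where w: "w \<in> H" "w \<noteq> \<zero>\<^bsub>verma\<^esub>" "Z.weight_vector l' w"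
        by (rule Z.weight_vector_exists[OF H])
      obtain c where c: "c \<noteq> 0" "w = Z.act (free_scalar c) vec"
        by (rule weight_vectors_verma[OF w(3,2)])
      have "Z.act (free_scalar (inverse c)) w \<in> H"
        using Z.submodule_act[OF H _ w(1), of "free_scalar (inverse c)"] by simp
      then have "vec \<in> H"
        using c vec_closed by (simp add: Z.act_scalar_mult)
      then show False
        using vec_generates[OF H] \<open>H \<noteq> carrier verma\<close> by simp
    qed
  qed
qed

lemma weight_unique:
  assumes "Z.weight_vector l' w" "w \<noteq> \<zero>\<^bsub>verma\<^esub>"
  shows "l' = l"
proof -
  obtain c where c: "w = Z.act (free_scalar c) vec"
    using weight_vectors_verma[OF assms] by blast
  have wc: "w \<in> carrier verma"
    using assms(1) by (simp add: Z.weight_vector_def)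
  have r: "in_range TYPE('k) n 0 0"
    using p_gt_3 by (simp add: in_range_def)
  let ?e = "free_gen (witt_e n 0 0) :: 'k witt free_word \<Rightarrow>\<^sub>0 'k"
  have e: "Z.act ?e v = Z.act (free_scalar m) v" if "Z.weight_vector m v" for m v
    using that weight_form_e[OF r, of m] by (simp add: Z.weight_vector_def witt_e_in_filt)
  have "Z.act ?e w = Z.act (free_scalar c) (Z.act ?e vec)"
    unfolding c by (rule Z.act_scalar_commute) (simp_all add: witt_e_in_space vec_closed)
  also have "\<dots> = Z.act (free_scalar l) w"
    unfolding e[OF vec_weight_vector] c using vec_closed by (simp add: Z.act_scalar_mult mult.commute)
  finally have "Z.act (free_scalar l') w = Z.act (free_scalar l) w"
    using e[OF assms(1)] by simp
  then have "Z.act (free_scalar l' - free_scalar l) w = \<zero>\<^bsub>verma\<^esub>"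
    using Z.act_diff_eq_zero_iff[of "free_scalar l'" "free_scalar l" w] wc by simp
  then have "Z.act (free_scalar (l' - l)) w = \<zero>\<^bsub>verma\<^esub>"
    by (simp add: free_scalar_def single_diff)
  then show ?thesis
    using Z.act_scalar_eq_zero[OF wc] assms(2) by fastforce
qed

text \<open>The universal property gives a nonzero map from the simple Verma module to the simple
  module M, bijective by Schur's lemma; the isomorphism asked for is its inverse.\<close>

lemma module_iso_verma:
  assumes M: "simple_module full.U M"
    and w: "witt_module.weight_vector \<chi> n M l w" "w \<noteq> \<zero>\<^bsub>M\<^esub>"
  shows "module_iso full.U M verma"
proof -
  obtain h where h: "\<And>x. x \<in> carrier verma \<Longrightarrow> h x \<in> carrier M"
    "\<And>x y. x \<in> carrier verma \<Longrightarrow> y \<in> carrier verma \<Longrightarrow> h (x \<oplus>\<^bsub>verma\<^esub> y) = h x \<oplus>\<^bsub>M\<^esub> h y"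
    "\<And>u x. u \<in> carrier full.U \<Longrightarrow> x \<in> carrier verma \<Longrightarrow> h (u \<odot>\<^bsub>verma\<^esub> x) = u \<odot>\<^bsub>M\<^esub> h x"
    "h vec = w"
    by (rule verma_universal[OF witt_module_simple[OF M] w(1)]) blast
  show ?thesis
    by (rule module_iso_sym[OF Z.N.left_module_axioms], rule schur[OF verma_simple M h(1-3) vec_closed])
      (use h(4) w(2) in simp_all)
qed

text \<open>An isomorphism carries the generator of weight m to a nonzero weight vector of weight m
  in the other Verma module, where l is the only weight.\<close>

lemma module_iso_verma_weight:
  assumes m: "m \<in> weights n \<chi>" and iso: "module_iso full.U (reduced_verma n \<chi> m) verma"
  shows "m = l"
proof -
  interpret B: witt_weight \<chi> n m
    by (simp add: witt_weight_def witt_weight_axioms_def witt_character_axioms m)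
  obtain f where f: "bij_betw f (carrier B.verma) (carrier verma)"
    "\<And>x y. x \<in> carrier B.verma \<Longrightarrow> y \<in> carrier B.verma \<Longrightarrow> f (x \<oplus>\<^bsub>B.verma\<^esub> y) = f x \<oplus>\<^bsub>verma\<^esub> f y"
    "\<And>u x. u \<in> carrier full.U \<Longrightarrow> x \<in> carrier B.verma \<Longrightarrow> f (u \<odot>\<^bsub>B.verma\<^esub> x) = u \<odot>\<^bsub>verma\<^esub> f x"
    using iso unfolding module_iso_def module_isos_def by blast
  have fc: "f B.vec \<in> carrier verma"
    using bij_betwE[OF f(1)] B.vec_closed by blast
  have act: "Z.act g (f x) = f (B.Z.act g x)" if "g \<in> carrier FA" "x \<in> carrier B.verma" for g x
    using f(3)[of "uq (witt_lie n (-1)) \<chi> g" x] that by (simp add: Z.act_def B.Z.act_def)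
  have "Z.weight_vector m (f B.vec)"
    unfolding Z.weight_vector_def
  proof (intro conjI ballI fc)
    fix x :: "'k witt" assume x: "x \<in> witt_filt n 0"
    then have "free_gen x \<in> carrier FA"
      using filt_0_subset by auto
    moreover have "B.Z.act (free_gen x) B.vec = B.Z.act (free_scalar (weight_form n \<chi> m x)) B.vec"
      using B.vec_weight_vector x unfolding B.Z.weight_vector_def by blast
    ultimately show "Z.act (free_gen x) (f B.vec) = Z.act (free_scalar (weight_form n \<chi> m x)) (f B.vec)"
      using B.vec_closed by (simp add: act)
  qed
  moreover have "f B.vec \<noteq> \<zero>\<^bsub>verma\<^esub>"
  proof
    assume eq: "f B.vec = \<zero>\<^bsub>verma\<^esub>"
    have "f (B.Z.act 0 B.vec) = Z.act 0 (f B.vec)"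
      by (rule act[symmetric]) (simp_all add: B.vec_closed)
    then have "f \<zero>\<^bsub>B.verma\<^esub> = f B.vec"
      using eq fc B.vec_closed by simp
    then have "\<zero>\<^bsub>B.verma\<^esub> = B.vec"
      using inj_onD[OF bij_betw_imp_inj_on[OF f(1)]] B.vec_closed B.Z.N.M.zero_closed by blast
    then show False
      using B.vec_nonzero by simp
  qed
  ultimately show ?thesis
    by (rule weight_unique)
qed

end

theorem theorem3p6:
  fixes \<chi> :: "'k::alg_closed_field witt \<Rightarrow> 'k"
    and n :: nat
  assumes "CHAR('k) > 3"
    and "n \<ge> 1"
    and "linear_form (witt_space n) witt_scale \<chi>"
    and "witt_height n \<chi> = 1"
    and "\<chi> (witt_e n 0 n) \<noteq> 0"
  shows "(\<forall>l\<in>weights n \<chi>.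
            simple_module (reduced_uea (witt_lie n (-1)) \<chi>) (reduced_verma n \<chi> l)) \<and>
         (\<forall>M :: (('k witt free_word \<Rightarrow>\<^sub>0 'k) set set, 'm) module.
            simple_module (reduced_uea (witt_lie n (-1)) \<chi>) M \<longrightarrow>
            (\<exists>l\<in>weights n \<chi>.
               module_iso (reduced_uea (witt_lie n (-1)) \<chi>) M (reduced_verma n \<chi> l))) \<and>
         (\<forall>l\<in>weights n \<chi>. \<forall>m\<in>weights n \<chi>.
            module_iso (reduced_uea (witt_lie n (-1)) \<chi>)
              (reduced_verma n \<chi> l) (reduced_verma n \<chi> m) \<longleftrightarrow> l = m)"
proof -
  interpret witt_character \<chi> n
    by (rule witt_character.intro) (use assms in simp_all)
  have weight: "witt_weight \<chi> n l" if "l \<in> weights n \<chi>" for l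
    using that by (simp add: witt_weight_def witt_weight_axioms_def witt_character_axioms)
  show ?thesis
  proof (intro conjI ballI allI impI)
    fix l assume "l \<in> weights n \<chi>"
    then show "simple_module (reduced_uea (witt_lie n (-1)) \<chi>) (reduced_verma n \<chi> l)"
      by (intro witt_weight.verma_simple weight)
  next
    fix M :: "(('k witt free_word \<Rightarrow>\<^sub>0 'k) set set, 'm) module"
    assume M: "simple_module (reduced_uea (witt_lie n (-1)) \<chi>) M"
    interpret M: witt_module \<chi> n M
      by (rule witt_module_simple[OF M])
    have "carrier M \<noteq> {\<zero>\<^bsub>M\<^esub>}"
      using M by (simp add: simple_module_def)
    \<comment> \<open>A simple module is a nonzero submodule of itself, so it contains a weight
      vector.\<close>
    then obtain l v where "l \<in> weights n \<chi>" "v \<noteq> \<zero>\<^bsub>M\<^esub>" "M.weight_vector l v"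
      by (rule M.weight_vector_exists[OF M.N.submodule_carrier])
    then show "\<exists>l\<in>weights n \<chi>. module_iso (reduced_uea (witt_lie n (-1)) \<chi>) M (reduced_verma n \<chi> l)"
      using witt_weight.module_iso_verma[OF weight M] by blast
  next
    fix l m assume lm: "l \<in> weights n \<chi>" "m \<in> weights n \<chi>"
    show "module_iso (reduced_uea (witt_lie n (-1)) \<chi>) (reduced_verma n \<chi> l) (reduced_verma n \<chi> m) \<longleftrightarrow> l = m"
      using witt_weight.module_iso_verma_weight[OF weight[OF lm(2)] lm(1)] module_iso_refl by blast
  qed
qed

end
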